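(* Let $0<\alpha<\tfrac12$ and $d\in\mathbb R$ with $2d+2\alpha<1$. Put $a=1-d$ and $c=-\alpha/2$. Then $$\operatorname{tr}(T^3)=\prod_{j=0}^{2}\frac{\Gamma(a+jc)\,\Gamma(1+jc)\,\Gamma(1+(j+1)c)}{\Gamma(a+1+(2+j)c)\,\Gamma(1+c)},$$ where $T=T_{\alpha,d}$. Consequently the skewness (third cumulant of the variance-one variable) of $Y_{\alpha,d}$ is $$\kappa_3(Y_{\alpha,d})=\frac{8\operatorname{tr}(T^3)}{(2I_{2,\alpha,d})^{3/2}}.$$ At $d=0$ the expression reduces to $$\operatorname{tr}(K_\alpha^3)=\frac{6B(1-\alpha,1-\alpha)}{(2-3\alpha)(3-3\alpha)}.$$
   Context: For $0<\alpha<1/2$ and $d\in\mathbb R$ with $2d+2\alpha<1$, $T=T_{\alpha,d}$ is the positive Hilbert--Schmidt operator on $L^2(0,1)$ given by $$(Tf)(x)=\int_0^1x^{-d/2}y^{-d/2}|x-y|^{-\alpha}f(y)\,dy,$$ with eigenvalues $\mu_1\ge\mu_2\ge\cdots>0$, and $\operatorname{tr}(T^3)=\sum_j\mu_j^3$. For $d=0$ write $K_\alpha=T_{\alpha,0}$, i.e. $K_\alpha f(x)=\int_0^1|x-y|^{-\alpha}f(y)\,dy$. Put $$I_{2,\alpha,d}=\int_0^1\!\!\int_0^1x^{-d}y^{-d}|x-y|^{-2\alpha}\,dx\,dy=\operatorname{tr}(T^2),\qquad a_j=\frac{\mu_j}{\sqrt{2I_{2,\alpha,d}}}.$$ The sign-oriented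 weighted limit $Y_{\alpha,d}$ is the variance-one random variable with the law of $\sum_{j\ge1}a_j(Z_j^2-1)$, $Z_j$ independent $N(0,1)$ (convergence in $L^2$ and almost surely). $\kappa_3$ denotes the third cumulant. $B$ is the Euler beta function and $\Gamma$ the gamma function. *)

theory Defs
  imports "HOL-Probability.Probability"
begin

abbreviation I01 :: "real measure" where
  "I01 \<equiv> restrict_space lborel {0<..<1}"

text \<open>
  Real \<open>L\<^sup>2(0,1)\<close>, with square-integrable functions representing their a.e.-classes. The kernels
  below are real and symmetric, so eigenvalues and multiplicities do not change over the complex
  numbers.
\<close>

definition L2_01 :: "(real \<Rightarrow> real) set" where
  "L2_01 = {f. f \<in> borel_measurable I01 \<and> integrable I01 (\<lambda>x. (f x)\<^sup>2)}"

definition inner_L2 :: "(real \<Rightarrow> real) \<Rightarrow> (real \<Rightarrow> real) \<Rightarrow> real" where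
  "inner_L2 f g = (LINT x|I01. f x * g x)"

text \<open>The values \<open>0 powr _ = 0\<close> on the diagonal \<open>x = y\<close> are immaterial (a null set).\<close>

definition T_op :: "real \<Rightarrow> real \<Rightarrow> (real \<Rightarrow> real) \<Rightarrow> real \<Rightarrow> real" where
  "T_op \<alpha> d f x =
     (LINT y|I01. x powr (- d / 2) * y powr (- d / 2) * \<bar>x - y\<bar> powr (- \<alpha>) * f y)"

definition K_op :: "real \<Rightarrow> (real \<Rightarrow> real) \<Rightarrow> real \<Rightarrow> real" where
  "K_op \<alpha> = T_op \<alpha> 0"

definition I2 :: "real \<Rightarrow> real \<Rightarrow> real" where
  "I2 \<alpha> d =
     (LINT x|I01. LINT y|I01. x powr (- d) * y powr (- d) * \<bar>x - y\<bar> powr (- 2 * \<alpha>))"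

definition eigenspace :: "((real \<Rightarrow> real) \<Rightarrow> real \<Rightarrow> real) \<Rightarrow> real \<Rightarrow> (real \<Rightarrow> real) set" where
  "eigenspace A l = {f \<in> L2_01. AE x in I01. A f x = l * f x}"

text \<open>
  The eigenspace for \<open>l\<close>, taken modulo a.e. equality, has an orthonormal basis of \<open>n\<close> elements.
  For \<open>n = 0\<close> this says that \<open>l\<close> is not an eigenvalue.
\<close>

definition has_multiplicity :: "((real \<Rightarrow> real) \<Rightarrow> real \<Rightarrow> real) \<Rightarrow> real \<Rightarrow> nat \<Rightarrow> bool" where
  "has_multiplicity A l n \<longleftrightarrow>
     (\<exists>e :: nat \<Rightarrow> real \<Rightarrow> real.
        (\<forall>i<n. e i \<in> eigenspace A l) \<and>
        (\<forall>i<n. \<forall>j<n. inner_L2 (e i) (e j) = (if i = j then 1 else 0)) \<and>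
        (\<forall>f\<in>eigenspace A l. \<exists>c. AE x in I01. f x = (\<Sum>i<n. c i * e i x)))"

text \<open>
  \<open>\<mu> 0 \<ge> \<mu> 1 \<ge> \<dots> > 0\<close> lists all eigenvalues of \<open>A\<close>, each repeated according to its (finite)
  multiplicity.
\<close>

definition eigenvalue_sequence :: "((real \<Rightarrow> real) \<Rightarrow> real \<Rightarrow> real) \<Rightarrow> (nat \<Rightarrow> real) \<Rightarrow> bool" where
  "eigenvalue_sequence A \<mu> \<longleftrightarrow>
     decseq \<mu> \<and> (\<forall>j. \<mu> j > 0) \<and>
     (\<forall>l. finite {j. \<mu> j = l} \<and> has_multiplicity A l (card {j. \<mu> j = l}))"

definition iid_std_normal :: "'w measure \<Rightarrow> (nat \<Rightarrow> 'w \<Rightarrow> real) \<Rightarrow> bool" where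
  "iid_std_normal M Z \<longleftrightarrow>
     prob_space M \<and> prob_space.indep_vars M (\<lambda>_. borel) Z UNIV \<and>
     (\<forall>j. distributed M lborel (Z j) std_normal_density)"

text \<open>
  \<open>Y\<close> has the law of the pointwise sum of \<open>a\<^sub>j (Z\<^sub>j\<^sup>2 - 1)\<close>, which converges almost surely; the
  value of \<open>suminf\<close> on the exceptional null set does not affect the law.
\<close>

definition has_weighted_limit_law ::
  "real \<Rightarrow> real \<Rightarrow> (nat \<Rightarrow> real) \<Rightarrow> 'w measure \<Rightarrow> (nat \<Rightarrow> 'w \<Rightarrow> real) \<Rightarrow>
   'v measure \<Rightarrow> ('v \<Rightarrow> real) \<Rightarrow> bool" where
  "has_weighted_limit_law \<alpha> d \<mu> M Z N Y \<longleftrightarrow>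
     prob_space N \<and> Y \<in> borel_measurable N \<and>
     distr N borel Y =
       distr M borel (\<lambda>\<omega>. \<Sum>j. \<mu> j / sqrt (2 * I2 \<alpha> d) * ((Z j \<omega>)\<^sup>2 - 1))"

text \<open>The \<open>n\<close>-th derivative at \<open>0\<close> of the cumulant generating function.\<close>

definition cumulant :: "'v measure \<Rightarrow> nat \<Rightarrow> ('v \<Rightarrow> real) \<Rightarrow> real" where
  "cumulant N n Y = (deriv ^^ n) (\<lambda>t. ln (LINT \<omega>|N. exp (t * Y \<omega>))) 0"

end

theory Submission
  imports Defs "HOL-Real_Asymp.Real_Asymp"
begin

text \<open>
  The operator has a symmetric square-integrable kernel \<open>K\<close>, so its eigenfunctions
  \<open>e\<^sub>j\<close> diagonalise it: \<open>K = \<Sum>\<^sub>j \<mu>\<^sub>j e\<^sub>j \<otimes> e\<^sub>j\<close> in the mean-square sense, and the sum of the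
  \<open>\<mu>\<^sub>j\<^sup>3\<close> is the triple integral of \<open>K(x,y) K(y,z) K(z,x)\<close>. The square-integrable kernels form a
  Hilbert space in which composition is a continuous multiplication, and the spectral theorem needed
  here is proved inside this algebra. If the remainder \<open>R\<close> left after removing all \<open>\<mu>\<^sub>j e\<^sub>j \<otimes> e\<^sub>j\<close> had
  \<open>R R \<noteq> 0\<close>, Kellogg's iteration (\<open>eigenvector_of_selfadjoint_element\<close>) would produce from its
  powers a kernel \<open>P \<noteq> 0\<close> with \<open>R P = l P\<close>, \<open>l \<noteq> 0\<close>; the sections of \<open>P\<close> would be eigenfunctions
  of the operator orthogonal to every \<open>e\<^sub>j\<close>, which the completeness of the list of eigenvalues
  excludes. Hence \<open>R R = 0\<close>, and this suffices for the trace of the cube (\<open>spectral_expansion\<close>,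
  \<open>trace_cube_kernel\<close>).

  The integrand of the triple integral is symmetric and homogeneous. Integrating
  out the largest of the three variables leaves the two-dimensional Selberg integral with parameters
  \<open>a = 1 - d\<close>, \<open>b = 1 - \<alpha>\<close> and exponent \<open>-\<alpha>\<close> on \<open>\<bar>x - y\<bar>\<close>. Aomoto's integrations by
  parts, which stay valid for this negative exponent, give a recursion from \<open>a\<close> to \<open>a + 1\<close>
  (\<open>selberg_int_recursion\<close>). The product of Gamma functions satisfies the same recursion and
  agrees at \<open>a = 1\<close>, where scaling computes the integral. Both sides decrease in \<open>a\<close> and the factor of the recursion tends to \<open>1\<close>, which forces
  equality for all \<open>a\<close> (\<open>recursion_unique\<close>, \<open>selberg_int_Gamma\<close>).

  Since \<open>\<Sum>\<^sub>j \<mu>\<^sub>j\<^sup>2\<close> is finite, Kolmogorov's maximal inequality makes the random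
  series converge almost surely, and bounded second moments of the exponentials of its partial sums
  allow passing to the limit in the moment generating function. Near \<open>0\<close> the cumulant generating
  function is thus the sum of the functions \<open>- t a\<^sub>j - ln (1 - 2 t a\<^sub>j) / 2\<close>, and differentiating
  three times term by term gives \<open>\<Sum>\<^sub>j 8 a\<^sub>j\<^sup>3\<close> (\<open>third_cumulant_chaos\<close>).
\<close>

section \<open>Square-integrable functions\<close>

definition L2 :: "'a measure \<Rightarrow> ('a \<Rightarrow> real) \<Rightarrow> bool" where
  "L2 M f \<longleftrightarrow> f \<in> borel_measurable M \<and> integrable M (\<lambda>x. (f x)\<^sup>2)"

lemma L2_measurable[measurable_dest]: "L2 M f \<Longrightarrow> f \<in> borel_measurable M"
  by (simp add: L2_def)

lemma L2_integrable_mult: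
  assumes "L2 M f" "L2 M g" shows "integrable M (\<lambda>x. f x * g x)"
proof (rule Bochner_Integration.integrable_bound)
  show "integrable M (\<lambda>x. (f x)\<^sup>2 + (g x)\<^sup>2)"
    using assms by (auto simp: L2_def)
  show "(\<lambda>x. f x * g x) \<in> borel_measurable M" using assms by measurable
  show "AE x in M. norm (f x * g x) \<le> norm ((f x)\<^sup>2 + (g x)\<^sup>2)"
  proof (rule AE_I2)
    fix x
    have "\<bar>f x\<bar> * \<bar>g x\<bar> \<le> (f x)\<^sup>2 + (g x)\<^sup>2"
      using sum_squares_bound[of "\<bar>f x\<bar>" "\<bar>g x\<bar>"]
        mult_nonneg_nonneg[OF abs_ge_zero[of "f x"] abs_ge_zero[of "g x"]]
      unfolding power2_abs mult.assoc by linarith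
    thus "norm (f x * g x) \<le> norm ((f x)\<^sup>2 + (g x)\<^sup>2)" by (simp add: abs_mult)
  qed
qed

lemma L2_add: "L2 M f \<Longrightarrow> L2 M g \<Longrightarrow> L2 M (\<lambda>x. f x + g x)"
  using L2_integrable_mult[of M f g] by (auto simp: L2_def power2_sum mult.assoc)

lemma L2_cmult: "L2 M f \<Longrightarrow> L2 M (\<lambda>x. c * f x)"
  by (auto simp: L2_def power_mult_distrib)

lemma L2_uminus: "L2 M f \<Longrightarrow> L2 M (\<lambda>x. - f x)"
  by (auto simp: L2_def)

lemma L2_diff: "L2 M f \<Longrightarrow> L2 M g \<Longrightarrow> L2 M (\<lambda>x. f x - g x)"
  using L2_add[OF _ L2_uminus] by simp

lemma L2_zero: "L2 M (\<lambda>x. 0)"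
  by (auto simp: L2_def)

lemma L2_nn_integral:
  "L2 M f \<Longrightarrow> (\<integral>\<^sup>+x. ennreal ((f x)\<^sup>2) \<partial>M) = ennreal (LINT x|M. (f x)\<^sup>2)"
  by (auto simp: L2_def nn_integral_eq_integral)

lemma L2_iff_nn_integral:
  "L2 M f \<longleftrightarrow> f \<in> borel_measurable M \<and> (\<integral>\<^sup>+x. ennreal ((f x)\<^sup>2) \<partial>M) < \<infinity>"
  by (auto simp: L2_def integrable_iff_bounded)

lemma L2_eq_0:
  assumes "L2 M f" "(LINT x|M. (f x)\<^sup>2) = 0"
  shows "AE x in M. f x = 0"
  using assms integral_nonneg_eq_0_iff_AE[of M "\<lambda>x. (f x)\<^sup>2"] by (auto simp: L2_def)

lemma nn_integral_le_of_tendsto: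
  fixes f :: "nat \<Rightarrow> 'a \<Rightarrow> ennreal"
  assumes [measurable]: "\<And>n. f n \<in> borel_measurable M"
    and lim: "AE x in M. (\<lambda>n. f n x) \<longlonglongrightarrow> g x"
    and bd: "\<forall>\<^sub>F n in sequentially. (\<integral>\<^sup>+x. f n x \<partial>M) \<le> C"
  shows "(\<integral>\<^sup>+x. g x \<partial>M) \<le> C"
proof -
  have "(\<integral>\<^sup>+x. g x \<partial>M) = (\<integral>\<^sup>+x. liminf (\<lambda>n. f n x) \<partial>M)"
    by (rule nn_integral_cong_AE, use lim in eventually_elim) (simp add: lim_imp_Liminf)
  also have "\<dots> \<le> liminf (\<lambda>n. \<integral>\<^sup>+x. f n x \<partial>M)" by (rule nn_integral_liminf) measurable
  also have "\<dots> \<le> limsup (\<lambda>n. \<integral>\<^sup>+x. f n x \<partial>M)" by (intro Liminf_le_Limsup) auto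
  also have "\<dots> \<le> C" using bd by (rule Limsup_bounded)
  finally show ?thesis .
qed

text \<open>Along a subsequence with \<open>\<parallel>f\<^sub>k\<^sub>+\<^sub>1 - f\<^sub>k\<parallel>\<^sup>2 \<le> 4\<^sup>-\<^sup>k\<close> the sum \<open>\<Sum>\<^sub>k 2\<^sup>k \<bar>f\<^sub>k\<^sub>+\<^sub>1 - f\<^sub>k\<bar>\<^sup>2\<close> is a.e. finite, so
  the increments decay geometrically and the subsequence converges a.e.; Fatou's lemma turns
  this into convergence in mean square.\<close>
lemma L2_complete:
  assumes f: "\<And>n. L2 M (f n)"
    and cauchy: "\<And>e. e > 0 \<Longrightarrow> \<exists>N. \<forall>m\<ge>N. \<forall>n\<ge>N. (LINT x|M. (f m x - f n x)\<^sup>2) < e"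
  obtains g where "L2 M g" "(\<lambda>n. LINT x|M. (f n x - g x)\<^sup>2) \<longlonglongrightarrow> 0"
proof -
  have [measurable]: "f n \<in> borel_measurable M" for n using f by measurable
  have "\<exists>N. \<forall>m\<ge>N. \<forall>n\<ge>N. (LINT x|M. (f m x - f n x)\<^sup>2) < (1/4) ^ k" for k :: nat
    by (rule cauchy) simp
  then obtain N where N: "\<And>k m n. m \<ge> N k \<Longrightarrow> n \<ge> N k \<Longrightarrow> (LINT x|M. (f m x - f n x)\<^sup>2) < (1/4) ^ k"
    by metis
  define r where "r k = (\<Sum>i\<le>k. N i)" for k
  have r: "r k \<ge> N k" for k unfolding r_def by (rule member_le_sum) auto
  have rS: "r (Suc k) \<ge> r k" for k by (simp add: r_def)
  define h where "h k x = f (r (Suc k)) x - f (r k) x" for k x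
  have [measurable]: "h k \<in> borel_measurable M" for k unfolding h_def by measurable
  have hk: "(\<integral>\<^sup>+x. ennreal ((h k x)\<^sup>2) \<partial>M) \<le> ennreal ((1/4) ^ k)" for k
  proof -
    have "r (Suc k) \<ge> N k" using r[of k] rS[of k] by linarith
    hence "(LINT x|M. (h k x)\<^sup>2) < (1/4) ^ k" unfolding h_def using N r by simp
    thus ?thesis unfolding h_def by (subst L2_nn_integral) (auto intro!: L2_diff f ennreal_leI)
  qed
  have "(\<integral>\<^sup>+x. (\<Sum>k. ennreal (2 ^ k * (h k x)\<^sup>2)) \<partial>M) = (\<Sum>k. \<integral>\<^sup>+x. ennreal (2 ^ k * (h k x)\<^sup>2) \<partial>M)"
    by (rule nn_integral_suminf) measurable
  also have "\<dots> \<le> (\<Sum>k. ennreal ((1/2) ^ k))"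
  proof (rule suminf_le)
    fix k
    have "(\<integral>\<^sup>+x. ennreal (2 ^ k * (h k x)\<^sup>2) \<partial>M) = ennreal (2 ^ k) * (\<integral>\<^sup>+x. ennreal ((h k x)\<^sup>2) \<partial>M)"
      by (simp add: ennreal_mult' nn_integral_cmult)
    also have "\<dots> \<le> ennreal (2 ^ k) * ennreal ((1/4) ^ k)"
      by (intro mult_left_mono hk) auto
    also have "\<dots> = ennreal ((1/2) ^ k)"
      by (subst ennreal_mult'[symmetric]) (auto simp: power_mult_distrib[symmetric])
    finally show "(\<integral>\<^sup>+x. ennreal (2 ^ k * (h k x)\<^sup>2) \<partial>M) \<le> ennreal ((1/2) ^ k)" .
  qed auto
  also have "\<dots> = ennreal (\<Sum>k. (1/2) ^ k)"
    by (rule suminf_ennreal2) (auto intro: summable_geometric)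
  also have "\<dots> < \<infinity>" by simp
  finally have "AE x in M. (\<Sum>k. ennreal (2 ^ k * (h k x)\<^sup>2)) \<noteq> \<infinity>"
    by (intro nn_integral_noteq_infinite) auto
  hence conv: "AE x in M. convergent (\<lambda>k. f (r k) x)"
  proof (rule AE_mp, intro AE_I2 impI)
    fix x assume "(\<Sum>k. ennreal (2 ^ k * (h k x)\<^sup>2)) \<noteq> \<infinity>"
    hence "summable (\<lambda>k. 2 ^ k * (h k x)\<^sup>2)"
      by (intro summable_suminf_not_top) auto
    hence "Bseq (\<lambda>k. 2 ^ k * (h k x)\<^sup>2)"
      by (intro convergent_imp_Bseq convergentI[OF summable_LIMSEQ_zero])
    then obtain C where C: "C > 0" "\<And>k. norm (2 ^ k * (h k x)\<^sup>2) \<le> C"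
      by (auto simp: Bseq_def)
    have "norm (h k x) \<le> sqrt C * (1 / sqrt 2) ^ k" for k
    proof -
      have "(h k x)\<^sup>2 \<le> C / 2 ^ k" using C(2)[of k] by (simp add: abs_mult field_simps)
      hence "sqrt ((h k x)\<^sup>2) \<le> sqrt (C / 2 ^ k)" by (rule real_sqrt_le_mono)
      hence "\<bar>h k x\<bar> \<le> sqrt (C / 2 ^ k)" by simp
      thus ?thesis by (simp add: real_sqrt_divide real_sqrt_power power_divide)
    qed
    moreover have "summable (\<lambda>k. sqrt C * (1 / sqrt 2) ^ k)"
      by (intro summable_mult summable_geometric) auto
    ultimately have "summable (\<lambda>k. h k x)"
      using summable_comparison_test'[of "\<lambda>k. sqrt C * (1 / sqrt 2) ^ k" 0 "\<lambda>k. h k x"] by blast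
    hence "convergent (\<lambda>n. \<Sum>k<n. h k x)" by (simp add: summable_iff_convergent)
    hence "convergent (\<lambda>n. f (r n) x - f (r 0) x)"
      unfolding h_def by (subst (asm) sum_lessThan_telescope)
    thus "convergent (\<lambda>k. f (r k) x)"
      by (simp add: convergent_diff_const_right_iff)
  qed
  define g where "g x = lim (\<lambda>k. f (r k) x)" for x
  have [measurable]: "g \<in> borel_measurable M" unfolding g_def by measurable
  have lim: "AE x in M. (\<lambda>k. f (r k) x) \<longlonglongrightarrow> g x"
    using conv by (simp add: g_def convergent_LIMSEQ_iff)
  have fatou: "(\<integral>\<^sup>+x. ennreal ((f n x - g x)\<^sup>2) \<partial>M) \<le> ennreal ((1/4) ^ k)" if "n \<ge> N k" for n k
  proof (rule nn_integral_le_of_tendsto)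
    show "AE x in M. (\<lambda>i. ennreal ((f n x - f (r i) x)\<^sup>2)) \<longlonglongrightarrow> ennreal ((f n x - g x)\<^sup>2)"
      using lim by eventually_elim (intro tendsto_intros)
    show "\<forall>\<^sub>F i in sequentially. (\<integral>\<^sup>+x. ennreal ((f n x - f (r i) x)\<^sup>2) \<partial>M) \<le> ennreal ((1/4) ^ k)"
    proof (rule eventually_mono[OF eventually_ge_at_top[of k]])
      fix i assume "k \<le> i"
      hence "r k \<le> r i" using rS by (simp add: lift_Suc_mono_le)
      hence "r i \<ge> N k" using r[of k] by linarith
      hence "(LINT x|M. (f n x - f (r i) x)\<^sup>2) < (1/4) ^ k" by (rule N[OF that])
      thus "(\<integral>\<^sup>+x. ennreal ((f n x - f (r i) x)\<^sup>2) \<partial>M) \<le> ennreal ((1/4) ^ k)"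
        by (subst L2_nn_integral) (auto intro!: L2_diff f ennreal_leI)
    qed
  qed measurable
  have d: "L2 M (\<lambda>x. f (N 0) x - g x)"
    unfolding L2_iff_nn_integral using fatou[of 0 "N 0"] by (auto simp: le_less_trans)
  have g: "L2 M g"
    using L2_diff[OF f[of "N 0"] d] by simp
  show ?thesis
  proof (rule that[OF g])
    show "(\<lambda>n. LINT x|M. (f n x - g x)\<^sup>2) \<longlonglongrightarrow> 0"
    proof (rule LIMSEQ_I)
      fix e :: real assume "e > 0"
      then obtain k where k: "(1/4::real) ^ k < e"
        using real_arch_pow_inv[of e "1/4"] by auto
      show "\<exists>n0. \<forall>n\<ge>n0. norm ((LINT x|M. (f n x - g x)\<^sup>2) - 0) < e"
      proof (intro exI allI impI)
        fix n assume "n \<ge> N k"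
        from fatou[OF this] have "(LINT x|M. (f n x - g x)\<^sup>2) \<le> (1/4) ^ k"
          by (subst (asm) L2_nn_integral) (auto intro!: L2_diff f g)
        thus "norm ((LINT x|M. (f n x - g x)\<^sup>2) - 0) < e" using k by simp
      qed
    qed
  qed
qed

section \<open>Weighted sums of centred squares of normal variables\<close>

context prob_space
begin

text \<open>A functional of the variables before time \<open>k\<close> is orthogonal to the centred sum of the later ones;
  the form needed for stopping arguments.\<close>
lemma indep_past_future:
  fixes X :: "nat \<Rightarrow> 'a \<Rightarrow> real"
  assumes ind: "indep_vars (\<lambda>_. borel) X UNIV"
    and g: "g \<in> borel_measurable (PiM {m..<k} (\<lambda>_. borel :: real measure))"
    and int_g: "integrable M (\<lambda>w. g (\<lambda>i\<in>{m..<k}. X i w))"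
    and int: "\<And>i. integrable M (X i)" and mean: "\<And>i. expectation (X i) = 0"
  shows "integrable M (\<lambda>w. g (\<lambda>i\<in>{m..<k}. X i w) * (\<Sum>i=k..<n. X i w))"
    and "expectation (\<lambda>w. g (\<lambda>i\<in>{m..<k}. X i w) * (\<Sum>i=k..<n. X i w)) = 0"
proof -
  have "indep_var (PiM {m..<k} (\<lambda>_. borel)) (\<lambda>w. \<lambda>i\<in>{m..<k}. X i w)
      (PiM {k..<n} (\<lambda>_. borel)) (\<lambda>w. \<lambda>i\<in>{k..<n}. X i w)"
    by (rule indep_var_restrict[OF ind]) auto
  from indep_var_compose[OF this g, of "\<lambda>f. \<Sum>i=k..<n. f i" borel]
  have iv: "indep_var borel (\<lambda>w. g (\<lambda>i\<in>{m..<k}. X i w)) borel (\<lambda>w. \<Sum>i=k..<n. X i w)"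
    by (simp add: comp_def)
  have int_s: "integrable M (\<lambda>w. \<Sum>i=k..<n. X i w)" using int by simp
  show "integrable M (\<lambda>w. g (\<lambda>i\<in>{m..<k}. X i w) * (\<Sum>i=k..<n. X i w))"
    by (rule indep_var_integrable[OF iv int_g int_s])
  show "expectation (\<lambda>w. g (\<lambda>i\<in>{m..<k}. X i w) * (\<Sum>i=k..<n. X i w)) = 0"
    using indep_var_lebesgue_integral[OF iv int_g int_s] int mean by simp
qed

text \<open>Kolmogorov's maximal inequality. On the event that the partial sums first leave
  \<open>(- \<epsilon>, \<epsilon>)\<close> at time \<open>k\<close>, the increment after \<open>k\<close> is orthogonal to the sum up to \<open>k\<close>, hence the
  second moment of the full sum on that event is at least \<open>\<epsilon>\<^sup>2\<close> times its probability.\<close>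
lemma kolmogorov_maximal_inequality:
  fixes X :: "nat \<Rightarrow> 'a \<Rightarrow> real"
  assumes ind: "indep_vars (\<lambda>_. borel) X UNIV"
    and sq: "\<And>i. integrable M (\<lambda>w. (X i w)\<^sup>2)" and mean: "\<And>i. expectation (X i) = 0"
    and \<epsilon>: "\<epsilon> > 0"
  shows "prob {w\<in>space M. \<exists>k\<in>{m..n}. \<epsilon> \<le> \<bar>\<Sum>i=m..<k. X i w\<bar>}
    \<le> (\<Sum>i=m..<n. expectation (\<lambda>w. (X i w)\<^sup>2)) / \<epsilon>\<^sup>2"
proof -
  have rv [measurable]: "X i \<in> borel_measurable M" for i using ind by (auto simp: indep_vars_def)
  have int: "integrable M (X i)" for i by (rule square_integrable_imp_integrable[OF rv sq])
  define S where "S k w = (\<Sum>i=m..<k. X i w)" for k w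
  have [measurable]: "S k \<in> borel_measurable M" for k unfolding S_def by measurable
  have int_XX: "integrable M (\<lambda>w. X i w * X j w)" for i j
    by (rule L2_integrable_mult) (auto simp: L2_def sq)
  have S_sq: "integrable M (\<lambda>w. (S k w)\<^sup>2)" for k
    unfolding S_def power2_eq_square sum_product by (intro Bochner_Integration.integrable_sum int_XX)
  have S_int: "integrable M (S k)" for k unfolding S_def using int by simp
  have split_S: "S n w = S k w + (\<Sum>i=k..<n. X i w)" if "m \<le> k" "k \<le> n" for k n w
    unfolding S_def using sum.atLeastLessThan_concat[OF that, of "\<lambda>i. X i w"] by simp
  have var: "expectation (\<lambda>w. (S n w)\<^sup>2) = (\<Sum>i=m..<n. expectation (\<lambda>w. (X i w)\<^sup>2))" for n
  proof (induction n)
    case (Suc n)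
    show ?case
    proof (cases "m \<le> n")
      case True
      have c: "integrable M (\<lambda>w. S n w * X n w)" "expectation (\<lambda>w. S n w * X n w) = 0"
        using indep_past_future[OF ind _ _ int mean, of "\<lambda>f. \<Sum>i=m..<n. f i" m n "Suc n"] S_int[of n]
        unfolding S_def by simp_all
      have "(S (Suc n) w)\<^sup>2 = (S n w)\<^sup>2 + (X n w)\<^sup>2 + 2 * (S n w * X n w)" for w
        using True by (simp add: S_def power2_sum mult.assoc)
      thus ?thesis using True Suc c S_sq[of n] sq[of n] by simp
    qed (simp add: S_def)
  qed (simp add: S_def)
  \<comment> \<open>the event that \<open>k\<close> is the first exit time\<close>
  define A where "A k = {w\<in>space M. \<epsilon> \<le> \<bar>S k w\<bar> \<and> (\<forall>j\<in>{m..<k}. \<bar>S j w\<bar> < \<epsilon>)}" for k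
  have A_sets [measurable]: "A k \<in> sets M" for k unfolding A_def by measurable
  have disj: "disjoint_family_on A {m..n}"
    unfolding disjoint_family_on_def
  proof (intro ballI impI)
    have *: "A j \<inter> A k = {}" if "m \<le> j" "j < k" for j k
    proof -
      have "\<bar>S j w\<bar> < \<epsilon>" "\<epsilon> \<le> \<bar>S j w\<bar>" if "w \<in> A j" "w \<in> A k" for w
        using that \<open>m \<le> j\<close> \<open>j < k\<close> by (auto simp: A_def)
      thus ?thesis by (meson disjoint_iff not_le)
    qed
    fix j k assume "j \<in> {m..n}" "k \<in> {m..n}" "j \<noteq> k"
    thus "A j \<inter> A k = {}"
      using *[of j k] *[of k j] by (cases j k rule: linorder_cases) auto
  qed
  have eq: "{w\<in>space M. \<exists>k\<in>{m..n}. \<epsilon> \<le> \<bar>S k w\<bar>} = (\<Union>k\<in>{m..n}. A k)"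
  proof (intro set_eqI iffI)
    fix w assume "w \<in> {w\<in>space M. \<exists>k\<in>{m..n}. \<epsilon> \<le> \<bar>S k w\<bar>}"
    then obtain k where k: "w \<in> space M" "k \<in> {m..n}" "\<epsilon> \<le> \<bar>S k w\<bar>" by auto
    define l where "l = (LEAST k. k \<ge> m \<and> \<epsilon> \<le> \<bar>S k w\<bar>)"
    have l: "m \<le> l" "\<epsilon> \<le> \<bar>S l w\<bar>" using LeastI[of "\<lambda>k. k \<ge> m \<and> \<epsilon> \<le> \<bar>S k w\<bar>" k] k by (auto simp: l_def)
    have "l \<le> k" using Least_le[of "\<lambda>k. k \<ge> m \<and> \<epsilon> \<le> \<bar>S k w\<bar>" k] k by (auto simp: l_def)
    moreover have "\<bar>S j w\<bar> < \<epsilon>" if "j \<in> {m..<l}" for j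
      using not_less_Least[of j "\<lambda>k. k \<ge> m \<and> \<epsilon> \<le> \<bar>S k w\<bar>"] that by (auto simp: l_def)
    ultimately show "w \<in> (\<Union>k\<in>{m..n}. A k)" using l k by (auto simp: A_def intro!: bexI[of _ l])
  qed (auto simp: A_def)
  have key: "\<epsilon>\<^sup>2 * prob (A k) \<le> expectation (\<lambda>w. (S n w)\<^sup>2 * indicator (A k) w)" if k: "k \<in> {m..n}" for k
  proof -
    define B where "B = {f :: nat \<Rightarrow> real. \<epsilon> \<le> \<bar>\<Sum>i=m..<k. f i\<bar> \<and> (\<forall>j\<in>{m..<k}. \<bar>\<Sum>i=m..<j. f i\<bar> < \<epsilon>)}"
    define g where "g f = (\<Sum>i=m..<k. f i) * indicator B f" for f :: "nat \<Rightarrow> real"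
    have "{f \<in> space (PiM {m..<k} (\<lambda>_. borel)). f \<in> B} \<in> sets (PiM {m..<k} (\<lambda>_. borel :: real measure))"
    proof -
      have [measurable]: "(\<lambda>f. \<Sum>i=m..<j. f i) \<in> borel_measurable (PiM {m..<k} (\<lambda>_. borel :: real measure))" if "j \<le> k" for j
        using that by (intro borel_measurable_sum measurable_component_singleton) auto
      show ?thesis unfolding B_def mem_Collect_eq by measurable
    qed
    hence "(indicator B :: _ \<Rightarrow> real) \<in> borel_measurable (PiM {m..<k} (\<lambda>_. borel :: real measure))"
      by (subst borel_measurable_indicator_iff) (simp add: Int_def conj_commute)
    hence g_meas: "g \<in> borel_measurable (PiM {m..<k} (\<lambda>_. borel :: real measure))"
      unfolding g_def by (intro borel_measurable_times borel_measurable_sum measurable_component_singleton) auto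
    have gX: "g (\<lambda>i\<in>{m..<k}. X i w) = S k w * indicator (A k) w" if "w \<in> space M" for w
    proof -
      have 1: "(\<Sum>i=m..<j. (\<lambda>i\<in>{m..<k}. X i w) i) = S j w" if "j \<le> k" for j
        unfolding S_def using that by (intro sum.cong) auto
      have "(\<lambda>i\<in>{m..<k}. X i w) \<in> B \<longleftrightarrow> w \<in> A k"
        unfolding B_def A_def mem_Collect_eq using that 1 by auto
      thus ?thesis unfolding g_def 1[OF order_refl] by (simp add: indicator_def)
    qed
    have "integrable M (\<lambda>w. S k w * indicator (A k) w)"
      using integrable_mult_indicator[OF A_sets S_int] by (simp add: mult.commute)
    hence int_g: "integrable M (\<lambda>w. g (\<lambda>i\<in>{m..<k}. X i w))"
      by (subst Bochner_Integration.integrable_cong[OF refl gX]) auto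
    define R where "R w = (\<Sum>i=k..<n. X i w)" for w
    have cross0: "integrable M (\<lambda>w. g (\<lambda>i\<in>{m..<k}. X i w) * R w)"
      "expectation (\<lambda>w. g (\<lambda>i\<in>{m..<k}. X i w) * R w) = 0"
      unfolding R_def by (rule indep_past_future[OF ind g_meas int_g int mean])+
    have c: "integrable M (\<lambda>w. S k w * indicator (A k) w * R w)"
      using cross0(1) by (subst (asm) Bochner_Integration.integrable_cong[OF refl]) (auto simp: gX)
    have c0: "expectation (\<lambda>w. S k w * indicator (A k) w * R w) = 0"
      using cross0(2) by (subst (asm) Bochner_Integration.integral_cong[OF refl]) (auto simp: gX)
    have i1: "integrable M (\<lambda>w. (S k w)\<^sup>2 * indicator (A k) w)" for k
      using integrable_mult_indicator[OF A_sets S_sq] by (simp add: mult.commute)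
    have i2: "integrable M (\<lambda>w. (S n w)\<^sup>2 * indicator (A k) w)"
      using integrable_mult_indicator[OF A_sets S_sq] by (simp add: mult.commute)
    have "\<epsilon>\<^sup>2 * prob (A k) = expectation (\<lambda>w. \<epsilon>\<^sup>2 * indicator (A k) w)" by simp
    also have "\<dots> \<le> expectation (\<lambda>w. (S k w)\<^sup>2 * indicator (A k) w)"
    proof (rule integral_mono[OF _ i1])
      fix w
      have "\<epsilon>\<^sup>2 \<le> (S k w)\<^sup>2" if "w \<in> A k"
        using that \<epsilon> power_mono[of \<epsilon> "\<bar>S k w\<bar>" 2] by (auto simp: A_def)
      thus "\<epsilon>\<^sup>2 * indicator (A k) w \<le> (S k w)\<^sup>2 * indicator (A k) w" by (auto simp: indicator_def)
    qed (intro integrable_mult_right integrable_real_indicator, auto simp: emeasure_eq_measure)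
    also have "\<dots> = expectation (\<lambda>w. (S k w)\<^sup>2 * indicator (A k) w + 2 * (S k w * indicator (A k) w * R w))"
      using i1[of k] c c0 by simp
    also have "\<dots> \<le> expectation (\<lambda>w. (S n w)\<^sup>2 * indicator (A k) w)"
    proof (rule integral_mono[OF _ i2])
      show "integrable M (\<lambda>w. (S k w)\<^sup>2 * indicator (A k) w + 2 * (S k w * indicator (A k) w * R w))"
        using i1[of k] c by simp
      fix w
      have "S n w = S k w + R w" unfolding R_def using k by (intro split_S) auto
      hence "(S k w)\<^sup>2 + 2 * (S k w * R w) \<le> (S n w)\<^sup>2" by (simp add: power2_sum)
      thus "(S k w)\<^sup>2 * indicator (A k) w + 2 * (S k w * indicator (A k) w * R w) \<le> (S n w)\<^sup>2 * indicator (A k) w"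
        by (auto simp: indicator_def)
    qed
    finally show ?thesis .
  qed
  have "\<epsilon>\<^sup>2 * prob (\<Union>k\<in>{m..n}. A k) = (\<Sum>k\<in>{m..n}. \<epsilon>\<^sup>2 * prob (A k))"
    by (subst finite_measure_finite_Union[OF _ _ disj]) (auto simp: sum_distrib_left)
  also have "\<dots> \<le> (\<Sum>k\<in>{m..n}. expectation (\<lambda>w. (S n w)\<^sup>2 * indicator (A k) w))"
    by (intro sum_mono key)
  also have "\<dots> = expectation (\<lambda>w. \<Sum>k\<in>{m..n}. (S n w)\<^sup>2 * indicator (A k) w)"
    using integrable_mult_indicator[OF A_sets S_sq]
    by (subst Bochner_Integration.integral_sum) (auto simp: mult.commute)
  also have "\<dots> \<le> expectation (\<lambda>w. (S n w)\<^sup>2)"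
  proof (rule integral_mono[OF _ S_sq])
    show "integrable M (\<lambda>w. \<Sum>k\<in>{m..n}. (S n w)\<^sup>2 * indicator (A k) w)"
      using integrable_mult_indicator[OF A_sets S_sq]
      by (intro Bochner_Integration.integrable_sum) (auto simp: mult.commute)
    fix w
    have U: "(\<Sum>k\<in>{m..n}. indicator (A k) w) = (indicator (\<Union>k\<in>{m..n}. A k) w :: real)"
      by (rule indicator_UN_disjoint[symmetric]) (use disj in auto)
    show "(\<Sum>k\<in>{m..n}. (S n w)\<^sup>2 * indicator (A k) w) \<le> (S n w)\<^sup>2"
      unfolding sum_distrib_left[symmetric] U by (auto simp: indicator_def)
  qed
  also have "\<dots> = (\<Sum>i=m..<n. expectation (\<lambda>w. (X i w)\<^sup>2))" by (rule var)
  finally show ?thesis unfolding eq[unfolded S_def] using \<epsilon> by (simp add: field_simps)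
qed

text \<open>The maximal inequality bounds the probability that a partial sum started at \<open>m\<close> ever reaches
  \<open>\<epsilon>\<close>, and the bound is a multiple of the tail of the series of variances; letting \<open>m\<close> grow, the partial sums
  are almost surely Cauchy.\<close>
lemma AE_summable_indep:
  fixes X :: "nat \<Rightarrow> 'a \<Rightarrow> real"
  assumes ind: "indep_vars (\<lambda>_. borel) X UNIV"
    and sq: "\<And>i. integrable M (\<lambda>w. (X i w)\<^sup>2)" and mean: "\<And>i. expectation (X i) = 0"
    and sm: "summable (\<lambda>i. expectation (\<lambda>w. (X i w)\<^sup>2))"
  shows "AE w in M. summable (\<lambda>i. X i w)"
proof -
  have rv [measurable]: "X i \<in> borel_measurable M" for i using ind by (auto simp: indep_vars_def)
  define v where "v i = expectation (\<lambda>w. (X i w)\<^sup>2)" for i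
  have v0: "v i \<ge> 0" for i by (simp add: v_def)
  have smv: "summable v" using sm by (simp add: v_def[abs_def])
  define B where "B \<epsilon> m = {w\<in>space M. \<exists>k\<ge>m. \<epsilon> \<le> \<bar>\<Sum>i=m..<k. X i w\<bar>}" for \<epsilon> :: real and m
  have B_sets [measurable]: "B \<epsilon> m \<in> sets M" for \<epsilon> m unfolding B_def by measurable
  have B_le: "prob (B \<epsilon> m) \<le> (\<Sum>i. v (i + m)) / \<epsilon>\<^sup>2" if "\<epsilon> > 0" for \<epsilon> m
  proof -
    define C where "C n = {w\<in>space M. \<exists>k\<in>{m..n}. \<epsilon> \<le> \<bar>\<Sum>i=m..<k. X i w\<bar>}" for n
    have "C n \<in> sets M" for n unfolding C_def by measurable
    moreover have "incseq C" unfolding C_def by (rule incseq_SucI) auto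
    moreover have "(\<Union>n. C n) = B \<epsilon> m" unfolding C_def B_def by auto (meson atLeastAtMost_iff order_refl)
    ultimately have lim: "(\<lambda>n. prob (C n)) \<longlonglongrightarrow> prob (B \<epsilon> m)"
      using finite_Lim_measure_incseq[of C] by auto
    have "prob (C n) \<le> (\<Sum>i. v (i + m)) / \<epsilon>\<^sup>2" for n
    proof -
      have "prob (C n) \<le> (\<Sum>i=m..<n. v i) / \<epsilon>\<^sup>2"
        unfolding C_def v_def by (rule kolmogorov_maximal_inequality[OF ind sq mean that])
      also have "(\<Sum>i=m..<n. v i) = (\<Sum>i<n-m. v (i + m))"
        by (rule sum.reindex_bij_witness[of _ "\<lambda>i. i + m" "\<lambda>i. i - m"]) auto
      also have "\<dots> \<le> (\<Sum>i. v (i + m))"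
        using v0 smv by (intro sum_le_suminf) (auto simp: summable_iff_shift)
      finally show ?thesis by (simp add: divide_right_mono)
    qed
    thus ?thesis by (intro LIMSEQ_le_const2[OF lim]) auto
  qed
  have tail: "(\<lambda>m. \<Sum>i. v (i + m)) \<longlonglongrightarrow> 0"
    by (rule suminf_exist_split2[OF smv])
  have "AE w in M. \<exists>m. w \<notin> B \<epsilon> m" if \<epsilon>: "\<epsilon> > 0" for \<epsilon>
  proof -
    have "prob (\<Inter>m. B \<epsilon> m) \<le> 0"
    proof (rule LIMSEQ_le_const)
      show "(\<lambda>m. (\<Sum>i. v (i + m)) / \<epsilon>\<^sup>2) \<longlonglongrightarrow> 0" using tendsto_divide[OF tail tendsto_const, of "\<epsilon>\<^sup>2"] \<epsilon> by simp
      have "prob (\<Inter>m. B \<epsilon> m) \<le> (\<Sum>i. v (i + m)) / \<epsilon>\<^sup>2" for m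
        using finite_measure_mono[of "\<Inter>m. B \<epsilon> m" "B \<epsilon> m"] B_le[OF \<epsilon>, of m] by (auto intro: order.trans)
      thus "\<exists>N. \<forall>m\<ge>N. prob (\<Inter>m. B \<epsilon> m) \<le> (\<Sum>i. v (i + m)) / \<epsilon>\<^sup>2" by blast
    qed
    hence "prob (\<Inter>m. B \<epsilon> m) = 0" by (simp add: measure_le_0_iff)
    hence "(\<Inter>m. B \<epsilon> m) \<in> null_sets M" by (auto simp: emeasure_eq_measure null_sets_def)
    from AE_not_in[OF this] show ?thesis by simp
  qed
  hence "AE w in M. \<forall>n. \<exists>m. w \<notin> B (1 / real (Suc n)) m"
    by (subst AE_all_countable) simp
  thus ?thesis
  proof (rule AE_mp, intro AE_I2 impI)
    fix w assume w: "w \<in> space M" and *: "\<forall>n. \<exists>m. w \<notin> B (1 / real (Suc n)) m"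
    show "summable (\<lambda>i. X i w)"
      unfolding summable_Cauchy
    proof (intro allI impI)
      fix e :: real assume e: "e > 0"
      obtain n where n: "1 / real (Suc n) < e / 2" using nat_approx_posE[of "e / 2"] e by auto
      obtain m where m: "w \<notin> B (1 / real (Suc n)) m" using * by blast
      have small: "\<bar>\<Sum>i=m..<k. X i w\<bar> < e / 2" if "k \<ge> m" for k
      proof -
        have "\<not> 1 / real (Suc n) \<le> \<bar>\<Sum>i=m..<k. X i w\<bar>" using m w that unfolding B_def by blast
        thus ?thesis using n by linarith
      qed
      show "\<exists>N. \<forall>p\<ge>N. \<forall>q. norm (\<Sum>i=p..<q. X i w) < e"
      proof (intro exI allI impI)
        fix p q assume p: "p \<ge> m"
        show "norm (\<Sum>i=p..<q. X i w) < e"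
        proof (cases "p \<le> q")
          case True
          have "(\<Sum>i=m..<p. X i w) + (\<Sum>i=p..<q. X i w) = (\<Sum>i=m..<q. X i w)"
            by (rule sum.atLeastLessThan_concat[OF p True])
          thus ?thesis using small[OF p] small[OF order.trans[OF p True]] by simp
        qed (use e in simp)
      qed
    qed
  qed
qed

text \<open>Bounded second moments give uniform integrability: truncation at level \<open>b\<close> costs at most
  \<open>C / b\<close>, because \<open>x - min x b \<le> x\<^sup>2 / b\<close>.\<close>
lemma expectation_limit_square_bounded:
  fixes f :: "nat \<Rightarrow> 'a \<Rightarrow> real"
  assumes [measurable]: "\<And>n. f n \<in> borel_measurable M" "g \<in> borel_measurable M"
    and f0: "\<And>n w. 0 \<le> f n w" and g0: "\<And>w. 0 \<le> g w"
    and lim: "AE w in M. (\<lambda>n. f n w) \<longlonglongrightarrow> g w"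
    and f2: "\<And>n. integrable M (\<lambda>w. (f n w)\<^sup>2)" and bd: "\<And>n. expectation (\<lambda>w. (f n w)\<^sup>2) \<le> C"
    and conv: "(\<lambda>n. expectation (f n)) \<longlonglongrightarrow> L"
  shows "expectation g = L"
proof -
  have C0: "C \<ge> 0" using bd[of 0] by (rule order.trans[rotated]) simp
  have g2: "(\<integral>\<^sup>+w. ennreal ((g w)\<^sup>2) \<partial>M) \<le> ennreal C"
  proof (rule nn_integral_le_of_tendsto)
    show "AE w in M. (\<lambda>n. ennreal ((f n w)\<^sup>2)) \<longlonglongrightarrow> ennreal ((g w)\<^sup>2)"
      using lim by eventually_elim (intro tendsto_intros)
    show "\<forall>\<^sub>F n in sequentially. (\<integral>\<^sup>+w. ennreal ((f n w)\<^sup>2) \<partial>M) \<le> ennreal C"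
      by (rule always_eventually) (auto simp: nn_integral_eq_integral[OF f2] intro!: ennreal_leI bd)
  qed measurable
  have g2i: "integrable M (\<lambda>w. (g w)\<^sup>2)"
    by (rule integrableI_bounded) (use g2 in \<open>auto simp: le_less_trans\<close>)
  have g2e: "expectation (\<lambda>w. (g w)\<^sup>2) \<le> C"
    using g2 C0 by (subst (asm) nn_integral_eq_integral[OF g2i]) auto
  have fi: "integrable M (f n)" for n by (rule square_integrable_imp_integrable[OF _ f2]) measurable
  have gi: "integrable M g" by (rule square_integrable_imp_integrable[OF _ g2i]) measurable
  have trunc: "\<bar>expectation h - expectation (\<lambda>w. min (h w) b)\<bar> \<le> C / b"
    if h: "h \<in> borel_measurable M" "\<And>w. 0 \<le> h w" "integrable M (\<lambda>w. (h w)\<^sup>2)" "expectation (\<lambda>w. (h w)\<^sup>2) \<le> C"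
      and b: "b > 0" for h b
  proof -
    note [measurable] = h(1)
    have hi: "integrable M h" by (rule square_integrable_imp_integrable[OF h(1,3)])
    have mi: "integrable M (\<lambda>w. min (h w) b)"
      by (rule Bochner_Integration.integrable_bound[OF hi]) (use h(2) b in auto)
    have "\<bar>expectation h - expectation (\<lambda>w. min (h w) b)\<bar> = \<bar>expectation (\<lambda>w. h w - min (h w) b)\<bar>"
      using hi mi by simp
    also have "\<dots> \<le> expectation (\<lambda>w. (h w)\<^sup>2 / b)"
    proof (rule order.trans[OF integral_abs_bound integral_mono])
      show "integrable M (\<lambda>w. \<bar>h w - min (h w) b\<bar>)" "integrable M (\<lambda>w. (h w)\<^sup>2 / b)"
        using hi mi h(3) by simp_all
      fix w
      have "h w \<le> (h w)\<^sup>2 / b" if "h w > b"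
        using that b mult_left_mono[of b "h w" "h w"] by (simp add: field_simps power2_eq_square)
      thus "\<bar>h w - min (h w) b\<bar> \<le> (h w)\<^sup>2 / b"
        using b by (cases "h w > b") (auto simp: min_def)
    qed
    also have "\<dots> \<le> C / b" using h(4) b by (simp add: divide_right_mono)
    finally show ?thesis .
  qed
  have "\<bar>expectation g - L\<bar> \<le> e" if e: "e > 0" for e
  proof -
    define b where "b = 2 * (C + 1) / e"
    have b: "b > 0" using C0 e by (simp add: b_def)
    have Cb: "C / b \<le> e / 2" using C0 e by (simp add: b_def field_simps)
    have "(\<lambda>n. expectation (\<lambda>w. min (f n w) b)) \<longlonglongrightarrow> expectation (\<lambda>w. min (g w) b)"
    proof (rule integral_dominated_convergence[where w = "\<lambda>_. b"])
      show "AE w in M. (\<lambda>n. min (f n w) b) \<longlonglongrightarrow> min (g w) b"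
        using lim by eventually_elim (intro tendsto_intros)
      show "AE w in M. norm (min (f n w) b) \<le> b" for n using f0 b by (auto simp: min_def)
    qed auto
    hence "(\<lambda>n. \<bar>expectation (f n) - expectation (\<lambda>w. min (f n w) b)\<bar>) \<longlonglongrightarrow> \<bar>L - expectation (\<lambda>w. min (g w) b)\<bar>"
      by (intro tendsto_intros conv)
    hence "\<bar>L - expectation (\<lambda>w. min (g w) b)\<bar> \<le> C / b"
      by (rule LIMSEQ_le_const2) (use trunc[OF _ f0 f2 bd b] in auto)
    moreover have "\<bar>expectation g - expectation (\<lambda>w. min (g w) b)\<bar> \<le> C / b"
      by (rule trunc[OF _ g0 g2i g2e b]) measurable
    ultimately show ?thesis using Cb by linarith
  qed
  hence "\<bar>expectation g - L\<bar> \<le> 0" by (rule field_le_epsilon) simp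
  thus ?thesis by simp
qed

end

text \<open>The cumulant generating function of \<open>Z\<^sup>2 - 1\<close> for a standard normal \<open>Z\<close>.\<close>
definition cgf :: "real \<Rightarrow> real" where
  "cgf u = - u - ln (1 - 2 * u) / 2"

lemma abs_cgf_le:
  assumes "\<bar>u\<bar> \<le> 1 / 4" shows "\<bar>cgf u\<bar> \<le> 4 * u\<^sup>2"
proof -
  have "\<bar>ln (1 + (- (2 * u))) - (- (2 * u))\<bar> \<le> 2 * (- (2 * u))\<^sup>2"
    by (rule abs_ln_one_plus_x_minus_x_bound) (use assms in auto)
  thus ?thesis by (simp add: cgf_def power_mult_distrib abs_le_iff)
qed

lemma normal_square_moments:
  assumes Z: "distributed M lborel Z std_normal_density" and M: "prob_space M"
  shows "integrable M (\<lambda>w. ((Z w)\<^sup>2 - 1)\<^sup>2)" and "(LINT w|M. ((Z w)\<^sup>2 - 1)\<^sup>2) = 2"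
    and "(LINT w|M. (Z w)\<^sup>2 - 1) = 0"
proof -
  interpret prob_space M by fact
  have d: "integrable M (\<lambda>w. Z w ^ (2 * k))"
    "(LINT w|M. Z w ^ (2 * k)) = fact (2 * k) / (2 ^ k * fact k)" for k
    using distributed_integrable[OF Z, of "\<lambda>x. x ^ (2 * k)"] distributed_integral[OF Z, of "\<lambda>x. x ^ (2 * k)"]
      std_normal_moment_even[of k] by (auto simp: has_bochner_integral_iff)
  have 2: "integrable M (\<lambda>w. (Z w)\<^sup>2)" "(LINT w|M. (Z w)\<^sup>2) = 1"
    using d[of 1] by (simp_all add: fact_numeral)
  have 4: "integrable M (\<lambda>w. Z w ^ 4)" "(LINT w|M. Z w ^ 4) = 3"
    using d[of 2] by (simp_all add: fact_numeral)
  have e: "((Z w)\<^sup>2 - 1)\<^sup>2 = Z w ^ 4 - 2 * (Z w)\<^sup>2 + 1" for w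
    by (simp add: power2_eq_square algebra_simps power4_eq_xxxx)
  show "integrable M (\<lambda>w. ((Z w)\<^sup>2 - 1)\<^sup>2)" "(LINT w|M. ((Z w)\<^sup>2 - 1)\<^sup>2) = 2" "(LINT w|M. (Z w)\<^sup>2 - 1) = 0"
    unfolding e using 2 4 by (simp_all add: prob_space)
qed

lemma normal_square_mgf:
  assumes Z: "distributed M lborel Z std_normal_density" and u: "u < 1 / 2"
  shows "(\<integral>\<^sup>+w. ennreal (exp (u * ((Z w)\<^sup>2 - 1))) \<partial>M) = ennreal (exp (cgf u))"
proof -
  define \<sigma> where "\<sigma> = 1 / sqrt (1 - 2 * u)"
  have \<sigma>: "\<sigma> > 0" "\<sigma>\<^sup>2 = 1 / (1 - 2 * u)" using u by (simp_all add: \<sigma>_def power_divide)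
  have "(\<integral>\<^sup>+w. ennreal (exp (u * ((Z w)\<^sup>2 - 1))) \<partial>M)
      = (\<integral>\<^sup>+x. ennreal (std_normal_density x) * ennreal (exp (u * (x\<^sup>2 - 1))) \<partial>lborel)"
    by (rule distributed_nn_integral[OF Z, symmetric]) measurable
  also have "\<dots> = (\<integral>\<^sup>+x. ennreal (exp (- u) * \<sigma>) * ennreal (normal_density 0 \<sigma> x) \<partial>lborel)"
  proof (rule nn_integral_cong)
    fix x :: real
    have "sqrt (2 * pi * \<sigma>\<^sup>2) = sqrt (2 * pi) * \<sigma>" using \<sigma>(1) by (simp add: real_sqrt_mult)
    moreover have "- (x - 0)\<^sup>2 / (2 * \<sigma>\<^sup>2) = - x\<^sup>2 / 2 + u * x\<^sup>2" using u by (simp add: \<sigma>(2) field_simps)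
    ultimately have "normal_density 0 \<sigma> x = 1 / (sqrt (2 * pi) * \<sigma>) * (exp (- x\<^sup>2 / 2) * exp (u * x\<^sup>2))"
      unfolding normal_density_def by (simp only: exp_add)
    moreover have "exp (u * (x\<^sup>2 - 1)) = exp (u * x\<^sup>2) * exp (- u)" by (simp add: exp_add[symmetric] algebra_simps)
    ultimately have "std_normal_density x * exp (u * (x\<^sup>2 - 1)) = exp (- u) * \<sigma> * normal_density 0 \<sigma> x"
      using \<sigma>(1) by (simp add: std_normal_density_def)
    thus "ennreal (std_normal_density x) * ennreal (exp (u * (x\<^sup>2 - 1))) = ennreal (exp (- u) * \<sigma>) * ennreal (normal_density 0 \<sigma> x)"
      using \<sigma>(1) by (simp add: ennreal_mult'[symmetric])
  qed
  also have "\<dots> = ennreal (exp (- u) * \<sigma>) * (\<integral>\<^sup>+x. ennreal (normal_density 0 \<sigma> x) \<partial>lborel)"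
    by (rule nn_integral_cmult) measurable
  also have "(\<integral>\<^sup>+x. ennreal (normal_density 0 \<sigma> x) \<partial>lborel) = 1"
    using \<sigma> by (subst nn_integral_eq_integral) auto
  also have "exp (- u) * \<sigma> = exp (cgf u)"
  proof -
    have "exp (cgf u) = exp (- u) * exp (- (ln (1 - 2 * u) / 2))" by (simp add: cgf_def exp_add[symmetric])
    also have "exp (- (ln (1 - 2 * u) / 2)) = \<sigma>"
      using u by (simp add: \<sigma>_def exp_minus ln_sqrt[symmetric] inverse_eq_divide)
    finally show ?thesis ..
  qed
  finally show ?thesis by simp
qed

context
  fixes M :: "'w measure" and Z :: "nat \<Rightarrow> 'w \<Rightarrow> real" and a :: "nat \<Rightarrow> real"
  assumes Z: "iid_std_normal M Z" and a2: "summable (\<lambda>j. (a j)\<^sup>2)"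
begin

interpretation prob_space M using Z by (simp add: iid_std_normal_def)

lemma chaos_summable: "AE w in M. summable (\<lambda>j. a j * ((Z j w)\<^sup>2 - 1))"
proof (rule AE_summable_indep)
  have ind: "indep_vars (\<lambda>_. borel) Z UNIV" and dist: "\<And>j. distributed M lborel (Z j) std_normal_density"
    using Z by (auto simp: iid_std_normal_def)
  note mom = normal_square_moments[OF dist prob_space_axioms]
  show "indep_vars (\<lambda>_. borel) (\<lambda>j w. a j * ((Z j w)\<^sup>2 - 1)) UNIV"
    by (rule indep_vars_compose2[OF ind]) measurable
  show "integrable M (\<lambda>w. (a j * ((Z j w)\<^sup>2 - 1))\<^sup>2)" for j
    unfolding power_mult_distrib by (intro integrable_mult_right mom)
  show "expectation (\<lambda>w. a j * ((Z j w)\<^sup>2 - 1)) = 0" for j using mom(3)[of j] by simp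
  show "summable (\<lambda>j. expectation (\<lambda>w. (a j * ((Z j w)\<^sup>2 - 1))\<^sup>2))"
    unfolding power_mult_distrib using mom(2) a2 by (simp add: summable_mult2)
qed

text \<open>For the partial sums independence gives the formula at once. It passes to the limit because the
  same formula at \<open>2 t\<close> bounds the second moments; this is why \<open>\<bar>t a\<^sub>j\<bar>\<close> must stay at half the distance
  that \<open>abs_cgf_le\<close> permits.\<close>
lemma chaos_mgf:
  assumes t: "\<And>j. \<bar>t * a j\<bar> \<le> 1 / 8"
  shows "expectation (\<lambda>w. exp (t * (\<Sum>j. a j * ((Z j w)\<^sup>2 - 1)))) = exp (\<Sum>j. cgf (t * a j))"
proof -
  have ind: "indep_vars (\<lambda>_. borel) Z UNIV" and dist: "\<And>j. distributed M lborel (Z j) std_normal_density"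
    using Z by (auto simp: iid_std_normal_def)
  have [measurable]: "Z j \<in> borel_measurable M" for j using ind by (auto simp: indep_vars_def)
  define S where "S n w = (\<Sum>j<n. a j * ((Z j w)\<^sup>2 - 1))" for n w
  have [measurable]: "S n \<in> borel_measurable M" for n unfolding S_def by measurable
  have nn: "(\<integral>\<^sup>+w. ennreal (exp (s * S n w)) \<partial>M) = ennreal (exp (\<Sum>j<n. cgf (s * a j)))"
    if s: "\<And>j. \<bar>s * a j\<bar> \<le> 1 / 4" for s n
  proof -
    have "exp (s * S n w) = (\<Prod>j<n. exp ((s * a j) * ((Z j w)\<^sup>2 - 1)))" for w
      by (simp add: S_def sum_distrib_left exp_sum mult.assoc)
    hence "(\<integral>\<^sup>+w. ennreal (exp (s * S n w)) \<partial>M) = (\<integral>\<^sup>+w. (\<Prod>j<n. ennreal (exp ((s * a j) * ((Z j w)\<^sup>2 - 1)))) \<partial>M)"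
      by (simp add: prod_ennreal)
    also have "\<dots> = (\<Prod>j<n. \<integral>\<^sup>+w. ennreal (exp ((s * a j) * ((Z j w)\<^sup>2 - 1))) \<partial>M)"
    proof (rule indep_vars_nn_integral)
      show "indep_vars (\<lambda>_. borel) (\<lambda>j w. ennreal (exp ((s * a j) * ((Z j w)\<^sup>2 - 1)))) {..<n}"
        by (rule indep_vars_compose2[OF indep_vars_subset[OF ind]]) auto
    qed auto
    also have "\<dots> = (\<Prod>j<n. ennreal (exp (cgf (s * a j))))"
    proof (rule prod.cong[OF refl])
      fix j
      have "s * a j < 1 / 2" using s[of j] by linarith
      thus "(\<integral>\<^sup>+w. ennreal (exp ((s * a j) * ((Z j w)\<^sup>2 - 1))) \<partial>M) = ennreal (exp (cgf (s * a j)))"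
        by (rule normal_square_mgf[OF dist])
    qed
    also have "\<dots> = ennreal (exp (\<Sum>j<n. cgf (s * a j)))" by (simp add: prod_ennreal exp_sum)
    finally show ?thesis .
  qed
  have int: "integrable M (\<lambda>w. exp (s * S n w))"
    and expn: "expectation (\<lambda>w. exp (s * S n w)) = exp (\<Sum>j<n. cgf (s * a j))"
    if s: "\<And>j. \<bar>s * a j\<bar> \<le> 1 / 4" for s n
  proof -
    show i: "integrable M (\<lambda>w. exp (s * S n w))"
      by (rule integrableI_bounded) (auto simp: nn[OF s])
    show "expectation (\<lambda>w. exp (s * S n w)) = exp (\<Sum>j<n. cgf (s * a j))"
      using nn_integral_eq_integral[OF i] nn[OF s, of n] by simp
  qed
  have t4: "\<bar>t * a j\<bar> \<le> 1 / 4" and t24: "\<bar>(2 * t) * a j\<bar> \<le> 1 / 4" for j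
    using t[of j] by (simp_all add: abs_mult)
  have sm: "summable (\<lambda>j. cgf (t * a j))"
  proof (rule summable_comparison_test'[of "\<lambda>j. 4 * t\<^sup>2 * (a j)\<^sup>2" 0])
    show "norm (cgf (t * a j)) \<le> 4 * t\<^sup>2 * (a j)\<^sup>2" for j
      using abs_cgf_le[OF t4[of j]] by (simp add: power_mult_distrib mult.assoc)
  qed (intro summable_mult a2)
  show ?thesis
  proof (rule expectation_limit_square_bounded)
    have lim: "AE w in M. (\<lambda>n. S n w) \<longlonglongrightarrow> (\<Sum>j. a j * ((Z j w)\<^sup>2 - 1))"
      using chaos_summable by eventually_elim (simp add: S_def summable_LIMSEQ)
    show "AE w in M. (\<lambda>n. exp (t * S n w)) \<longlonglongrightarrow> exp (t * (\<Sum>j. a j * ((Z j w)\<^sup>2 - 1)))"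
      using lim by eventually_elim (intro tendsto_intros)
    have sq: "(exp (t * S n w))\<^sup>2 = exp ((2 * t) * S n w)" for n w
      by (simp add: power2_eq_square exp_add[symmetric])
    show "integrable M (\<lambda>w. (exp (t * S n w))\<^sup>2)" for n
      unfolding sq by (rule int[OF t24])
    show "expectation (\<lambda>w. (exp (t * S n w))\<^sup>2) \<le> exp (\<Sum>j. 16 * t\<^sup>2 * (a j)\<^sup>2)" for n
    proof -
      have "(\<Sum>j<n. cgf ((2 * t) * a j)) \<le> (\<Sum>j<n. 16 * t\<^sup>2 * (a j)\<^sup>2)"
      proof (rule sum_mono)
        fix j
        have "cgf ((2 * t) * a j) \<le> 4 * ((2 * t) * a j)\<^sup>2" using abs_cgf_le[OF t24[of j]] by linarith
        thus "cgf ((2 * t) * a j) \<le> 16 * t\<^sup>2 * (a j)\<^sup>2" by (simp add: power_mult_distrib mult.assoc)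
      qed
      also have "\<dots> \<le> (\<Sum>j. 16 * t\<^sup>2 * (a j)\<^sup>2)"
        by (intro sum_le_suminf summable_mult a2) auto
      finally show ?thesis unfolding sq expn[OF t24] by simp
    qed
    show "(\<lambda>n. expectation (\<lambda>w. exp (t * S n w))) \<longlonglongrightarrow> exp (\<Sum>j. cgf (t * a j))"
      unfolding expn[OF t4] by (intro tendsto_exp summable_LIMSEQ sm)
  qed auto
qed

end

text \<open>On a neighbourhood of \<open>0\<close> the first three derivatives of the terms are dominated by multiples of
  \<open>(a j)\<^sup>2\<close>, so the series may be differentiated termwise by the Weierstrass test.\<close>
lemma cgf_series_third_derivative:
  fixes a :: "nat \<Rightarrow> real"
  assumes a2: "summable (\<lambda>j. (a j)\<^sup>2)" and \<delta>: "\<delta> > 0" "\<And>j. \<delta> * \<bar>a j\<bar> \<le> 1 / 8"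
  shows "(deriv ^^ 3) (\<lambda>t. \<Sum>j. cgf (t * a j)) 0 = (\<Sum>j. 8 * a j ^ 3)"
proof -
  define I where "I = {- \<delta><..<\<delta>}"
  have I: "convex I" "open I" "interior I = I" "0 \<in> I" using \<delta> by (auto simp: I_def interior_open)
  have ta: "\<bar>t * a j\<bar> \<le> 1 / 8" if "t \<in> I" for t j
  proof -
    have "\<bar>t\<bar> * \<bar>a j\<bar> \<le> \<delta> * \<bar>a j\<bar>" using that by (intro mult_right_mono) (auto simp: I_def)
    thus ?thesis using \<delta>(2)[of j] by (simp add: abs_mult)
  qed
  have den: "1 - 2 * t * a j \<ge> 1 / 2" if "t \<in> I" for t j using ta[OF that, of j] by (simp add: abs_le_iff)
  define f1 where "f1 j t = 2 * t * (a j)\<^sup>2 / (1 - 2 * t * a j)" for j t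
  define f2 where "f2 j t = 2 * (a j)\<^sup>2 / (1 - 2 * t * a j)\<^sup>2" for j t
  define f3 where "f3 j t = 8 * a j ^ 3 / (1 - 2 * t * a j) ^ 3" for j t
  have d0: "((\<lambda>t. cgf (t * a j)) has_field_derivative f1 j t) (at t within I)" if "t \<in> I" for j t
    unfolding cgf_def f1_def using den[OF that, of j]
    by (auto intro!: derivative_eq_intros simp: divide_simps power2_eq_square algebra_simps)
  have d1: "(f1 j has_field_derivative f2 j t) (at t within I)" if "t \<in> I" for j t
    unfolding f1_def f2_def using den[OF that, of j]
    by (auto intro!: derivative_eq_intros simp: divide_simps power2_eq_square algebra_simps)
  have d2: "(f2 j has_field_derivative f3 j t) (at t within I)" if "t \<in> I" for j t
  proof -
    define D where "D = 1 - 2 * t * a j"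
    have D: "D \<noteq> 0" using den[OF that, of j] by (auto simp: D_def)
    have "((\<lambda>t. 1 - 2 * t * a j) has_field_derivative (- 2 * a j)) (at t within I)"
      by (auto intro!: derivative_eq_intros)
    from DERIV_divide[OF DERIV_const[of "2 * (a j)\<^sup>2"] DERIV_power[OF this, of 2]] D
    have "(f2 j has_field_derivative (0 * D\<^sup>2 - 2 * (a j)\<^sup>2 * (2 * (- 2 * a j * D))) / (D\<^sup>2 * D\<^sup>2)) (at t within I)"
      by (simp add: f2_def[abs_def] D_def)
    moreover have "(0 * D\<^sup>2 - 2 * (a j)\<^sup>2 * (2 * (- 2 * a j * D))) / (D\<^sup>2 * D\<^sup>2) = f3 j t"
      unfolding f3_def D_def[symmetric] using D by (simp add: divide_simps power2_eq_square power3_eq_cube)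
    ultimately show ?thesis by simp
  qed
  have inv: "1 / (1 - 2 * t * a j) \<le> 2" "0 < 1 - 2 * t * a j" if "t \<in> I" for t j
    using den[OF that, of j] by (simp_all add: divide_le_eq)
  have b1: "norm (f1 j t) \<le> 4 * \<delta> * (a j)\<^sup>2" if "t \<in> I" for j t
  proof -
    have "norm (f1 j t) = 2 * \<bar>t\<bar> * (a j)\<^sup>2 * (1 / (1 - 2 * t * a j))"
      using inv[OF that, of j] by (simp add: f1_def abs_mult)
    also have "\<dots> \<le> 2 * \<delta> * (a j)\<^sup>2 * 2"
      using that inv[OF that, of j] \<delta> by (intro mult_mono) (auto simp: I_def)
    finally show ?thesis by simp
  qed
  have b2: "norm (f2 j t) \<le> 8 * (a j)\<^sup>2" if "t \<in> I" for j t
  proof -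
    have "norm (f2 j t) = 2 * (a j)\<^sup>2 * (1 / (1 - 2 * t * a j))\<^sup>2" by (simp add: f2_def power_divide)
    also have "\<dots> \<le> 2 * (a j)\<^sup>2 * 2\<^sup>2"
      using inv[OF that, of j] by (intro mult_left_mono power_mono) auto
    finally show ?thesis by simp
  qed
  have b3: "norm (f3 j t) \<le> 8 / \<delta> * (a j)\<^sup>2" if "t \<in> I" for j t
  proof -
    have "norm (f3 j t) = 8 * \<bar>a j\<bar> ^ 3 * (1 / (1 - 2 * t * a j)) ^ 3"
      using inv[OF that, of j] by (simp add: f3_def power_divide abs_mult power_abs)
    also have "\<dots> \<le> 8 * \<bar>a j\<bar> ^ 3 * 2 ^ 3"
      using inv[OF that, of j] by (intro mult_left_mono power_mono) auto
    also have "\<dots> = 64 * \<bar>a j\<bar> * (a j)\<^sup>2" by (simp add: power3_eq_cube power2_eq_square)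
    also have "\<dots> \<le> 64 * (1 / (8 * \<delta>)) * (a j)\<^sup>2"
      using \<delta>(1) \<delta>(2)[of j] by (intro mult_right_mono mult_left_mono) (auto simp: field_simps)
    finally show ?thesis by (simp add: field_simps)
  qed
  have u1: "uniformly_convergent_on I (\<lambda>n t. \<Sum>j<n. f1 j t)"
    by (rule Weierstrass_m_test'[OF b1]) (auto intro: summable_mult a2)
  have u2: "uniformly_convergent_on I (\<lambda>n t. \<Sum>j<n. f2 j t)"
    by (rule Weierstrass_m_test'[OF b2]) (auto intro: summable_mult a2)
  have u3: "uniformly_convergent_on I (\<lambda>n t. \<Sum>j<n. f3 j t)"
    by (rule Weierstrass_m_test'[OF b3]) (auto intro: summable_mult a2)
  have s0: "summable (\<lambda>j. cgf (0 * a j))" by (simp add: cgf_def)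
  have s1: "summable (\<lambda>j. f1 j 0)" by (simp add: f1_def)
  have s2: "summable (\<lambda>j. f2 j 0)" unfolding f2_def by (simp add: summable_mult a2)
  have D1: "deriv (\<lambda>t. \<Sum>j. cgf (t * a j)) t = (\<Sum>j. f1 j t)" if "t \<in> I" for t
    by (rule DERIV_imp_deriv, rule has_field_derivative_series'(2)[OF I(1) d0 u1 I(4) s0]) (use that I in auto)
  have D2: "deriv (\<lambda>t. \<Sum>j. f1 j t) t = (\<Sum>j. f2 j t)" if "t \<in> I" for t
    by (rule DERIV_imp_deriv, rule has_field_derivative_series'(2)[OF I(1) d1 u2 I(4) s1]) (use that I in auto)
  have D3: "deriv (\<lambda>t. \<Sum>j. f2 j t) t = (\<Sum>j. f3 j t)" if "t \<in> I" for t
    by (rule DERIV_imp_deriv, rule has_field_derivative_series'(2)[OF I(1) d2 u3 I(4) s2]) (use that I in auto)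
  have near: "\<forall>\<^sub>F t in nhds 0. t \<in> I" using I by (simp add: eventually_nhds) blast
  have "(deriv ^^ 3) (\<lambda>t. \<Sum>j. cgf (t * a j)) 0 = (deriv ^^ 2) (deriv (\<lambda>t. \<Sum>j. cgf (t * a j))) 0"
    by (simp add: numeral_3_eq_3 numeral_2_eq_2)
  also have "\<dots> = (deriv ^^ 2) (\<lambda>t. \<Sum>j. f1 j t) 0"
    by (rule higher_deriv_cong_ev[OF _ refl]) (use near in eventually_elim, simp add: D1)
  also have "\<dots> = (deriv ^^ 1) (deriv (\<lambda>t. \<Sum>j. f1 j t)) 0"
    by (simp add: numeral_2_eq_2)
  also have "\<dots> = (deriv ^^ 1) (\<lambda>t. \<Sum>j. f2 j t) 0"
    by (rule higher_deriv_cong_ev[OF _ refl]) (use near in eventually_elim, simp add: D2)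
  also have "\<dots> = (\<Sum>j. f3 j 0)" using D3[OF I(4)] by simp
  finally show ?thesis by (simp add: f3_def)
qed

lemma third_cumulant_chaos:
  fixes a :: "nat \<Rightarrow> real"
  assumes Z: "iid_std_normal M Z" and a2: "summable (\<lambda>j. (a j)\<^sup>2)"
    and N: "prob_space N" and Y: "Y \<in> borel_measurable N"
    and law: "distr N borel Y = distr M borel (\<lambda>w. \<Sum>j. a j * ((Z j w)\<^sup>2 - 1))"
  shows "cumulant N 3 Y = (\<Sum>j. 8 * a j ^ 3)"
proof -
  \<comment> \<open>a positive bound for all \<open>\<bar>a j\<bar>\<close>; adding \<open>1\<close> covers the zero sequence\<close>
  define A where "A = sqrt (\<Sum>j. (a j)\<^sup>2) + 1"
  have A: "A \<ge> 1" using a2 by (simp add: A_def suminf_nonneg)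
  have aA: "\<bar>a j\<bar> \<le> A" for j
  proof -
    have "(a j)\<^sup>2 \<le> (\<Sum>j. (a j)\<^sup>2)" using sum_le_suminf[OF a2, of "{j}"] by simp
    hence "sqrt ((a j)\<^sup>2) \<le> sqrt (\<Sum>j. (a j)\<^sup>2)" by (rule real_sqrt_le_mono)
    thus ?thesis by (simp add: A_def)
  qed
  define \<delta> where "\<delta> = 1 / (8 * A)"
  have \<delta>: "\<delta> > 0" "\<delta> * \<bar>a j\<bar> \<le> 1 / 8" for j using A aA[of j] by (simp_all add: \<delta>_def field_simps)
  have "Z j \<in> borel_measurable M" for j
    using Z by (auto simp: iid_std_normal_def distributed_def)
  hence S [measurable]: "(\<lambda>w. \<Sum>j. a j * ((Z j w)\<^sup>2 - 1)) \<in> borel_measurable M" by measurable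
  have "ln (LINT w|N. exp (t * Y w)) = (\<Sum>j. cgf (t * a j))" if "\<bar>t\<bar> < \<delta>" for t
  proof -
    have "(LINT w|N. exp (t * Y w)) = (LINT y|distr N borel Y. exp (t * y))"
      by (rule integral_distr[symmetric]) (use Y in measurable)
    also have "\<dots> = (LINT w|M. exp (t * (\<Sum>j. a j * ((Z j w)\<^sup>2 - 1))))"
      unfolding law by (rule integral_distr) measurable
    also have "\<dots> = exp (\<Sum>j. cgf (t * a j))"
    proof (rule chaos_mgf[OF Z a2])
      fix j
      have "\<bar>t * a j\<bar> \<le> \<delta> * \<bar>a j\<bar>" unfolding abs_mult using that by (intro mult_right_mono) auto
      thus "\<bar>t * a j\<bar> \<le> 1 / 8" using \<delta>(2)[of j] by linarith
    qed
    finally show ?thesis by simp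
  qed
  moreover have "\<forall>\<^sub>F t in nhds (0::real). \<bar>t\<bar> < \<delta>"
    using \<delta>(1) by (auto simp: eventually_nhds_metric dist_real_def)
  ultimately have "\<forall>\<^sub>F t in nhds 0. ln (LINT w|N. exp (t * Y w)) = (\<Sum>j. cgf (t * a j))"
    by (auto elim: eventually_mono)
  hence "cumulant N 3 Y = (deriv ^^ 3) (\<lambda>t. \<Sum>j. cgf (t * a j)) 0"
    unfolding cumulant_def by (rule higher_deriv_cong_ev) simp
  also have "\<dots> = (\<Sum>j. 8 * a j ^ 3)" by (rule cgf_series_third_derivative[OF a2 \<delta>])
  finally show ?thesis .
qed

section \<open>Composition of square-integrable kernels\<close>

text \<open>The kernel of the composition of two integral operators, a continuous analogue of the product of
  matrices.\<close>
definition kcomp :: "'a measure \<Rightarrow> ('a \<times> 'a \<Rightarrow> real) \<Rightarrow> ('a \<times> 'a \<Rightarrow> real) \<Rightarrow> 'a \<times> 'a \<Rightarrow> real" where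
  "kcomp M A B = (\<lambda>(x, y). LINT z|M. A (x, z) * B (z, y))"

context sigma_finite_measure
begin

lemma pair_sigma_finite_self: "pair_sigma_finite M M" ..

lemma L2_tensor:
  assumes "L2 M f" "L2 M g"
  shows "L2 (M \<Otimes>\<^sub>M M) (\<lambda>(x, y). f x * g y)"
proof -
  interpret P: pair_sigma_finite M M by (rule pair_sigma_finite_self)
  have [measurable]: "f \<in> borel_measurable M" "g \<in> borel_measurable M" using assms by measurable
  have "(\<integral>\<^sup>+p. ennreal ((case p of (x, y) \<Rightarrow> f x * g y)\<^sup>2) \<partial>(M \<Otimes>\<^sub>M M))
      = (\<integral>\<^sup>+x. \<integral>\<^sup>+y. ennreal ((f x)\<^sup>2) * ennreal ((g y)\<^sup>2) \<partial>M \<partial>M)"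
    by (subst nn_integral_fst[symmetric])
      (auto simp: power_mult_distrib ennreal_mult' intro!: nn_integral_cong)
  also have "\<dots> = (\<integral>\<^sup>+x. ennreal ((f x)\<^sup>2) \<partial>M) * (\<integral>\<^sup>+x. ennreal ((g x)\<^sup>2) \<partial>M)"
    by (simp add: nn_integral_cmult nn_integral_multc)
  also have "\<dots> < \<infinity>" using assms by (auto simp: L2_iff_nn_integral ennreal_mult_less_top)
  finally show ?thesis unfolding L2_iff_nn_integral by auto
qed

lemma L2_swap:
  assumes "L2 (M \<Otimes>\<^sub>M M) A" shows "L2 (M \<Otimes>\<^sub>M M) (\<lambda>(x, y). A (y, x))"
proof -
  interpret P: pair_sigma_finite M M by (rule pair_sigma_finite_self)
  from assms show ?thesis
    unfolding L2_def
    using P.integrable_product_swap[of "\<lambda>p. (A p)\<^sup>2"] by (auto simp: split_beta' intro: measurable_pair_swap')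
qed

lemma L2_sections:
  assumes A: "L2 (M \<Otimes>\<^sub>M M) A"
  shows "AE x in M. L2 M (\<lambda>y. A (x, y))"
proof -
  interpret P: pair_sigma_finite M M by (rule pair_sigma_finite_self)
  have [measurable]: "A \<in> borel_measurable (M \<Otimes>\<^sub>M M)" using A by measurable
  have "(\<integral>\<^sup>+x. \<integral>\<^sup>+y. ennreal ((A (x, y))\<^sup>2) \<partial>M \<partial>M) \<noteq> \<infinity>"
    using A by (subst nn_integral_fst) (auto simp: L2_iff_nn_integral)
  hence "AE x in M. (\<integral>\<^sup>+y. ennreal ((A (x, y))\<^sup>2) \<partial>M) \<noteq> \<infinity>"
    by (intro nn_integral_PInf_AE) auto
  thus ?thesis
    by (rule AE_mp, intro AE_I2 impI) (auto simp: L2_iff_nn_integral less_top)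
qed

lemma L2_sections':
  assumes A: "L2 (M \<Otimes>\<^sub>M M) A"
  shows "AE y in M. L2 M (\<lambda>x. A (x, y))"
  using L2_sections[OF L2_swap[OF A]] by simp

lemma AE_pair_fst:
  assumes "AE x in M. P x" shows "AE p in M \<Otimes>\<^sub>M M. P (fst p)"
proof -
  interpret P: pair_sigma_finite M M by (rule pair_sigma_finite_self)
  from assms obtain N where N: "{x \<in> space M. \<not> P x} \<subseteq> N" "N \<in> null_sets M"
    by (rule AE_E3[of _ M]) (auto simp: null_sets_def)
  have [measurable]: "N \<in> sets M" using N by auto
  have "AE p in M \<Otimes>\<^sub>M M. fst p \<notin> N"
    by (rule P.AE_pair_measure) (use AE_not_in[OF N(2)] in auto)
  thus ?thesis
    by (rule AE_mp, intro AE_I2) (use N(1) in \<open>auto simp: space_pair_measure\<close>)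
qed

lemma AE_pair_swap:
  assumes "AE p in M \<Otimes>\<^sub>M M. P p" shows "AE p in M \<Otimes>\<^sub>M M. P (snd p, fst p)"
proof -
  interpret P: pair_sigma_finite M M by (rule pair_sigma_finite_self)
  have "AE p in distr (M \<Otimes>\<^sub>M M) (M \<Otimes>\<^sub>M M) (\<lambda>(x, y). (y, x)). P p"
    using assms P.distr_pair_swap by metis
  from AE_distrD[OF measurable_pair_swap' this] show ?thesis by (simp add: split_beta)
qed

lemma AE_pair_snd:
  assumes "AE x in M. P x" shows "AE p in M \<Otimes>\<^sub>M M. P (snd p)"
  using AE_pair_swap[OF AE_pair_fst[OF assms]] by simp

lemma AE_sections:
  assumes "AE p in M \<Otimes>\<^sub>M M. P p" shows "AE x in M. AE y in M. P (x, y)"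
  by (rule pair_sigma_finite.AE_pair[OF pair_sigma_finite_self assms])

lemma AE_sections':
  assumes "AE p in M \<Otimes>\<^sub>M M. P p" shows "AE y in M. AE x in M. P (x, y)"
  using AE_sections[OF AE_pair_swap[OF assms]] by simp

lemma L2_sections_pair:
  assumes "L2 (M \<Otimes>\<^sub>M M) A" "L2 (M \<Otimes>\<^sub>M M) B"
  shows "AE p in M \<Otimes>\<^sub>M M. L2 M (\<lambda>z. A (fst p, z)) \<and> L2 M (\<lambda>z. B (z, snd p))"
  using AE_pair_fst[OF L2_sections[OF assms(1)]] AE_pair_snd[OF L2_sections'[OF assms(2)]]
  by (rule AE_conjI)

lemma kcomp_measurable:
  assumes [measurable]: "A \<in> borel_measurable (M \<Otimes>\<^sub>M M)" "B \<in> borel_measurable (M \<Otimes>\<^sub>M M)"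
  shows "kcomp M A B \<in> borel_measurable (M \<Otimes>\<^sub>M M)"
  unfolding kcomp_def by measurable

text \<open>The Cauchy-Schwarz inequality for each pair \<open>(x, y)\<close>: the bound it gives is a function of \<open>x\<close>
  times a function of \<open>y\<close>. Where the defining integral diverges the composition is \<open>0\<close> and
  the bound is trivial.\<close>
lemma kcomp_bound:
  assumes A: "L2 (M \<Otimes>\<^sub>M M) A" and B: "L2 (M \<Otimes>\<^sub>M M) B"
  shows "(\<integral>\<^sup>+p. ennreal ((kcomp M A B p)\<^sup>2) \<partial>(M \<Otimes>\<^sub>M M))
      \<le> (\<integral>\<^sup>+p. ennreal ((A p)\<^sup>2) \<partial>(M \<Otimes>\<^sub>M M)) * (\<integral>\<^sup>+p. ennreal ((B p)\<^sup>2) \<partial>(M \<Otimes>\<^sub>M M))"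
proof -
  interpret P: pair_sigma_finite M M by (rule pair_sigma_finite_self)
  have [measurable]: "A \<in> borel_measurable (M \<Otimes>\<^sub>M M)" "B \<in> borel_measurable (M \<Otimes>\<^sub>M M)"
    using A B by measurable
  note [measurable] = kcomp_measurable
  have bd: "ennreal ((kcomp M A B (x, y))\<^sup>2)
      \<le> (\<integral>\<^sup>+z. ennreal ((A (x, z))\<^sup>2) \<partial>M) * (\<integral>\<^sup>+z. ennreal ((B (z, y))\<^sup>2) \<partial>M)"
    if xy: "x \<in> space M" "y \<in> space M" for x y
  proof (cases "integrable M (\<lambda>z. A (x, z) * B (z, y))")
    case True
    have [measurable]: "(\<lambda>z. A (x, z)) \<in> borel_measurable M" "(\<lambda>z. B (z, y)) \<in> borel_measurable M"
      using xy by measurable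
    have "ennreal ((kcomp M A B (x, y))\<^sup>2) = (ennreal \<bar>kcomp M A B (x, y)\<bar>)\<^sup>2"
      by (simp add: ennreal_power)
    also have "\<dots> \<le> (\<integral>\<^sup>+z. ennreal \<bar>A (x, z)\<bar> * ennreal \<bar>B (z, y)\<bar> \<partial>M)\<^sup>2"
    proof (intro power_mono)
      have "ennreal (norm (kcomp M A B (x, y))) \<le> (\<integral>\<^sup>+z. norm (A (x, z) * B (z, y)) \<partial>M)"
        unfolding kcomp_def split using integral_norm_bound_ennreal[OF True] by simp
      thus "ennreal \<bar>kcomp M A B (x, y)\<bar> \<le> (\<integral>\<^sup>+z. ennreal \<bar>A (x, z)\<bar> * ennreal \<bar>B (z, y)\<bar> \<partial>M)"
        by (simp add: abs_mult ennreal_mult)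
    qed auto
    also have "\<dots> \<le> (\<integral>\<^sup>+z. (ennreal \<bar>A (x, z)\<bar>)\<^sup>2 \<partial>M) * (\<integral>\<^sup>+z. (ennreal \<bar>B (z, y)\<bar>)\<^sup>2 \<partial>M)"
      by (rule Cauchy_Schwarz_nn_integral) measurable
    finally show ?thesis by (simp add: ennreal_power)
  next
    case False
    thus ?thesis by (simp add: kcomp_def not_integrable_integral_eq)
  qed
  have "(\<integral>\<^sup>+p. ennreal ((kcomp M A B p)\<^sup>2) \<partial>(M \<Otimes>\<^sub>M M))
      = (\<integral>\<^sup>+x. \<integral>\<^sup>+y. ennreal ((kcomp M A B (x, y))\<^sup>2) \<partial>M \<partial>M)"
    by (rule nn_integral_fst[symmetric]) measurable
  also have "\<dots> \<le> (\<integral>\<^sup>+x. \<integral>\<^sup>+y. (\<integral>\<^sup>+z. ennreal ((A (x, z))\<^sup>2) \<partial>M) * (\<integral>\<^sup>+z. ennreal ((B (z, y))\<^sup>2) \<partial>M) \<partial>M \<partial>M)"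
    by (intro nn_integral_mono bd)
  also have "\<dots> = (\<integral>\<^sup>+x. \<integral>\<^sup>+z. ennreal ((A (x, z))\<^sup>2) \<partial>M \<partial>M) * (\<integral>\<^sup>+y. \<integral>\<^sup>+z. ennreal ((B (z, y))\<^sup>2) \<partial>M \<partial>M)"
    by (simp add: nn_integral_cmult nn_integral_multc)
  also have "(\<integral>\<^sup>+x. \<integral>\<^sup>+z. ennreal ((A (x, z))\<^sup>2) \<partial>M \<partial>M) = (\<integral>\<^sup>+p. ennreal ((A p)\<^sup>2) \<partial>(M \<Otimes>\<^sub>M M))"
    by (rule nn_integral_fst) measurable
  also have "(\<integral>\<^sup>+y. \<integral>\<^sup>+z. ennreal ((B (z, y))\<^sup>2) \<partial>M \<partial>M) = (\<integral>\<^sup>+p. ennreal ((B p)\<^sup>2) \<partial>(M \<Otimes>\<^sub>M M))"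
    by (rule P.nn_integral_snd) measurable
  finally show ?thesis .
qed

lemma L2_kcomp:
  assumes "L2 (M \<Otimes>\<^sub>M M) A" "L2 (M \<Otimes>\<^sub>M M) B" shows "L2 (M \<Otimes>\<^sub>M M) (kcomp M A B)"
proof -
  have "(\<integral>\<^sup>+p. ennreal ((A p)\<^sup>2) \<partial>(M \<Otimes>\<^sub>M M)) * (\<integral>\<^sup>+p. ennreal ((B p)\<^sup>2) \<partial>(M \<Otimes>\<^sub>M M)) < \<infinity>"
    using assms by (auto simp: L2_iff_nn_integral ennreal_mult_less_top)
  thus ?thesis unfolding L2_iff_nn_integral
    using kcomp_bound[OF assms] kcomp_measurable assms by (auto simp: L2_def intro: le_less_trans)
qed

lemma kcomp_norm_le:
  assumes A: "L2 (M \<Otimes>\<^sub>M M) A" and B: "L2 (M \<Otimes>\<^sub>M M) B"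
  shows "(LINT p|(M \<Otimes>\<^sub>M M). (kcomp M A B p)\<^sup>2)
      \<le> (LINT p|(M \<Otimes>\<^sub>M M). (A p)\<^sup>2) * (LINT p|(M \<Otimes>\<^sub>M M). (B p)\<^sup>2)"
  using kcomp_bound[OF A B]
  by (simp add: L2_nn_integral A B L2_kcomp ennreal_mult'[symmetric])

text \<open>The function \<open>(x, z) \<mapsto> u x * v z\<close> is square integrable, so by the Cauchy-Schwarz
  inequality its product with the kernel is integrable and Fubini's theorem applies.\<close>
lemma bilinear_swap:
  assumes u: "L2 M u" and v: "L2 M v" and A: "L2 (M \<Otimes>\<^sub>M M) A"
  shows "(LINT x|M. u x * (LINT z|M. A (x, z) * v z)) = (LINT z|M. (LINT x|M. u x * A (x, z)) * v z)"
proof -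
  interpret P: pair_sigma_finite M M by (rule pair_sigma_finite_self)
  have "integrable (M \<Otimes>\<^sub>M M) (\<lambda>p. (case p of (x, z) \<Rightarrow> u x * v z) * A p)"
    by (rule L2_integrable_mult[OF L2_tensor[OF u v] A])
  hence i: "integrable (M \<Otimes>\<^sub>M M) (\<lambda>(x, z). u x * v z * A (x, z))"
    by (simp add: split_beta')
  have "(LINT z|M. LINT x|M. u x * v z * A (x, z)) = (LINT x|M. LINT z|M. u x * v z * A (x, z))"
    by (rule P.Fubini_integral[OF i])
  moreover have "(LINT x|M. u x * v z * A (x, z)) = (LINT x|M. u x * A (x, z)) * v z" for z
    by (subst integral_mult_left_zero[symmetric]) (simp add: mult_ac)
  moreover have "(LINT z|M. u x * v z * A (x, z)) = u x * (LINT z|M. A (x, z) * v z)" for x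
    by (subst integral_mult_right_zero[symmetric]) (simp add: mult_ac)
  ultimately show ?thesis by simp
qed

lemma kcomp_assoc:
  assumes A: "L2 (M \<Otimes>\<^sub>M M) A" and B: "L2 (M \<Otimes>\<^sub>M M) B" and C: "L2 (M \<Otimes>\<^sub>M M) C"
  shows "AE p in M \<Otimes>\<^sub>M M. kcomp M (kcomp M A B) C p = kcomp M A (kcomp M B C) p"
  using L2_sections_pair[OF A C]
proof (rule AE_mp, intro AE_I2 impI)
  fix p assume p: "L2 M (\<lambda>z. A (fst p, z)) \<and> L2 M (\<lambda>z. C (z, snd p))"
  from bilinear_swap[OF conjunct1[OF p] conjunct2[OF p] B]
  show "kcomp M (kcomp M A B) C p = kcomp M A (kcomp M B C) p"
    by (cases p) (simp add: kcomp_def)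
qed

lemma kcomp_cong_AE:
  assumes A: "L2 (M \<Otimes>\<^sub>M M) A" "L2 (M \<Otimes>\<^sub>M M) A'" and B: "L2 (M \<Otimes>\<^sub>M M) B" "L2 (M \<Otimes>\<^sub>M M) B'"
    and AA: "AE p in M \<Otimes>\<^sub>M M. A p = A' p" and BB: "AE p in M \<Otimes>\<^sub>M M. B p = B' p"
  shows "AE p in M \<Otimes>\<^sub>M M. kcomp M A B p = kcomp M A' B' p"
  using AE_pair_fst[OF AE_sections[OF AA]] AE_pair_snd[OF AE_sections'[OF BB]]
    L2_sections_pair[OF A(1) B(1)] L2_sections_pair[OF A(2) B(2)]
proof eventually_elim
  case (elim p)
  have "(LINT z|M. A (fst p, z) * B (z, snd p)) = (LINT z|M. A' (fst p, z) * B' (z, snd p))"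
  proof (rule integral_cong_AE)
    show "AE z in M. A (fst p, z) * B (z, snd p) = A' (fst p, z) * B' (z, snd p)"
      using elim(1,2) by eventually_elim simp
  qed (use elim(3,4) in \<open>auto simp: L2_def\<close>)
  thus ?case by (cases p) (simp add: kcomp_def)
qed

lemma kcomp_add_left:
  assumes A: "L2 (M \<Otimes>\<^sub>M M) A" "L2 (M \<Otimes>\<^sub>M M) A'" and B: "L2 (M \<Otimes>\<^sub>M M) B"
  shows "AE p in M \<Otimes>\<^sub>M M. kcomp M (\<lambda>p. A p + A' p) B p = kcomp M A B p + kcomp M A' B p"
  using L2_sections_pair[OF A(1) B(1)] L2_sections_pair[OF A(2) B(1)]
proof eventually_elim
  case (elim p)
  thus ?case by (cases p) (simp add: kcomp_def distrib_right L2_integrable_mult)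
qed

lemma kcomp_add_right:
  assumes A: "L2 (M \<Otimes>\<^sub>M M) A" and B: "L2 (M \<Otimes>\<^sub>M M) B" "L2 (M \<Otimes>\<^sub>M M) B'"
  shows "AE p in M \<Otimes>\<^sub>M M. kcomp M A (\<lambda>p. B p + B' p) p = kcomp M A B p + kcomp M A B' p"
  using L2_sections_pair[OF A(1) B(1)] L2_sections_pair[OF A(1) B(2)]
proof eventually_elim
  case (elim p)
  thus ?case by (cases p) (simp add: kcomp_def distrib_left L2_integrable_mult)
qed

lemma kcomp_scale_left: "kcomp M (\<lambda>p. c * A p) B p = c * kcomp M A B p"
  by (cases p) (simp add: kcomp_def mult.assoc)

lemma kcomp_scale_right: "kcomp M A (\<lambda>p. c * B p) p = c * kcomp M A B p"
  by (cases p) (simp add: kcomp_def mult.left_commute)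

text \<open>Composition with a symmetric kernel acts on the columns \<open>A (_, y)\<close> as a symmetric operator; the
  claim is \<open>bilinear_swap\<close> integrated over \<open>y\<close>.\<close>
lemma kcomp_selfadjoint:
  assumes K: "L2 (M \<Otimes>\<^sub>M M) K" and A: "L2 (M \<Otimes>\<^sub>M M) A" and B: "L2 (M \<Otimes>\<^sub>M M) B"
    and sym: "\<And>x y. K (x, y) = K (y, x)"
  shows "(LINT p|(M \<Otimes>\<^sub>M M). kcomp M K A p * B p) = (LINT p|(M \<Otimes>\<^sub>M M). A p * kcomp M K B p)"
proof -
  interpret P: pair_sigma_finite M M by (rule pair_sigma_finite_self)
  have [measurable]: "A \<in> borel_measurable (M \<Otimes>\<^sub>M M)" "B \<in> borel_measurable (M \<Otimes>\<^sub>M M)"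
    "kcomp M K A \<in> borel_measurable (M \<Otimes>\<^sub>M M)" "kcomp M K B \<in> borel_measurable (M \<Otimes>\<^sub>M M)"
    using A B L2_kcomp[OF K A] L2_kcomp[OF K B] by measurable
  have i1: "integrable (M \<Otimes>\<^sub>M M) (\<lambda>(x, y). kcomp M K A (x, y) * B (x, y))"
    using L2_integrable_mult[OF L2_kcomp[OF K A] B] by (simp add: split_beta')
  have i2: "integrable (M \<Otimes>\<^sub>M M) (\<lambda>(x, y). A (x, y) * kcomp M K B (x, y))"
    using L2_integrable_mult[OF A L2_kcomp[OF K B]] by (simp add: split_beta')
  have "(LINT p|(M \<Otimes>\<^sub>M M). kcomp M K A p * B p) = (LINT y|M. LINT x|M. kcomp M K A (x, y) * B (x, y))"
    using P.integral_snd[OF i1] by (simp add: split_beta')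
  also have "\<dots> = (LINT y|M. LINT x|M. A (x, y) * kcomp M K B (x, y))"
  proof (rule integral_cong_AE)
    show "AE y in M. (LINT x|M. kcomp M K A (x, y) * B (x, y)) = (LINT x|M. A (x, y) * kcomp M K B (x, y))"
      using L2_sections'[OF A] L2_sections'[OF B]
    proof eventually_elim
      case (elim y)
      from bilinear_swap[OF elim(2,1) K] show ?case
        by (simp add: kcomp_def mult_ac sym)
    qed
  qed measurable
  also have "\<dots> = (LINT p|(M \<Otimes>\<^sub>M M). A p * kcomp M K B p)"
    using P.integral_snd[OF i2] by (simp add: split_beta')
  finally show ?thesis .
qed

end

section \<open>The Hilbert algebra of kernels on the unit square\<close>

abbreviation I01x2 :: "(real \<times> real) measure" where "I01x2 \<equiv> I01 \<Otimes>\<^sub>M I01"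

interpretation I01: finite_measure I01
  by (rule finite_measureI) (simp add: emeasure_restrict_space)

definition kernel_eq :: "(real \<times> real \<Rightarrow> real) \<Rightarrow> (real \<times> real \<Rightarrow> real) \<Rightarrow> bool" where
  "kernel_eq A B \<longleftrightarrow> L2 I01x2 A \<and> L2 I01x2 B \<and> (AE p in I01x2. A p = B p)"

text \<open>Square-integrable kernels modulo a.e. equality. As a type they become a complete inner product
  space and at the same time a normed algebra under composition, which makes the theory of series,
  limits and continuity of multiplication available for them.\<close>
quotient_type hs = "real \<times> real \<Rightarrow> real" / partial: kernel_eq
proof (rule part_equivpI)
  show "\<exists>A. kernel_eq A A" by (rule exI[of _ "\<lambda>_. 0"]) (simp add: kernel_eq_def L2_zero)
  show "symp kernel_eq" by (rule sympI) (auto simp: kernel_eq_def elim: AE_mp)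
  show "transp kernel_eq"
  proof (rule transpI)
    fix A B C assume AB: "kernel_eq A B" and BC: "kernel_eq B C"
    have "AE p in I01x2. A p = B p" "AE p in I01x2. B p = C p"
      using AB BC by (auto simp: kernel_eq_def)
    hence "AE p in I01x2. A p = C p" by eventually_elim simp
    thus "kernel_eq A C" using AB BC by (simp add: kernel_eq_def)
  qed
qed

lemma kernel_eq_refl_iff: "kernel_eq A A \<longleftrightarrow> L2 I01x2 A"
  by (auto simp: kernel_eq_def)

instantiation hs :: "{zero, plus, uminus, minus, times, scaleR}"
begin

lift_definition zero_hs :: hs is "\<lambda>_. 0" by (simp add: kernel_eq_def L2_zero)
lift_definition plus_hs :: "hs \<Rightarrow> hs \<Rightarrow> hs" is "\<lambda>A B p. A p + B p"
  unfolding kernel_eq_def by (auto intro: L2_add)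
lift_definition uminus_hs :: "hs \<Rightarrow> hs" is "\<lambda>A p. - A p"
  unfolding kernel_eq_def by (auto intro: L2_uminus)
lift_definition minus_hs :: "hs \<Rightarrow> hs \<Rightarrow> hs" is "\<lambda>A B p. A p - B p"
  unfolding kernel_eq_def by (auto intro: L2_diff)
lift_definition scaleR_hs :: "real \<Rightarrow> hs \<Rightarrow> hs" is "\<lambda>c A p. c * A p"
  unfolding kernel_eq_def by (auto intro: L2_cmult)
lift_definition times_hs :: "hs \<Rightarrow> hs \<Rightarrow> hs" is "kcomp I01"
  unfolding kernel_eq_def by (blast intro: I01.L2_kcomp I01.kcomp_cong_AE)
instance ..
end

instance hs :: real_algebra
proof
  fix A B C :: hs and a b :: real
  show "A + B + C = A + (B + C)" by transfer (auto simp: kernel_eq_def add_ac intro!: L2_add)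
  show "A + B = B + A" by transfer (auto simp: kernel_eq_def add_ac intro!: L2_add)
  show "0 + A = A" by transfer (auto simp: kernel_eq_def)
  show "- A + A = 0" by transfer (auto simp: kernel_eq_def L2_zero)
  show "A - B = A + - B" by transfer (auto simp: kernel_eq_def intro!: L2_diff)
  show "a *\<^sub>R (A + B) = a *\<^sub>R A + a *\<^sub>R B"
    by transfer (auto simp: kernel_eq_def distrib_left intro!: L2_add L2_cmult)
  show "(a + b) *\<^sub>R A = a *\<^sub>R A + b *\<^sub>R A"
    by transfer (auto simp: kernel_eq_def distrib_right intro!: L2_add L2_cmult)
  show "a *\<^sub>R b *\<^sub>R A = (a * b) *\<^sub>R A"
    by transfer (auto simp: kernel_eq_def mult.assoc intro!: L2_cmult)
  show "1 *\<^sub>R A = A" by transfer (auto simp: kernel_eq_def)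
  show "A * B * C = A * (B * C)"
    by transfer (auto simp: kernel_eq_def intro!: I01.L2_kcomp I01.kcomp_assoc)
  show "(A + B) * C = A * C + B * C"
    by transfer (auto simp: kernel_eq_def intro!: I01.L2_kcomp L2_add I01.kcomp_add_left)
  show "A * (B + C) = A * B + A * C"
    by transfer (auto simp: kernel_eq_def intro!: I01.L2_kcomp L2_add I01.kcomp_add_right)
  show "a *\<^sub>R A * B = a *\<^sub>R (A * B)"
    by transfer (auto simp: kernel_eq_def I01.kcomp_scale_left intro!: I01.L2_kcomp L2_cmult)
  show "A * a *\<^sub>R B = a *\<^sub>R (A * B)"
    by transfer (auto simp: kernel_eq_def I01.kcomp_scale_right intro!: I01.L2_kcomp L2_cmult)
qed

instantiation hs :: real_inner
begin

lift_definition inner_hs :: "hs \<Rightarrow> hs \<Rightarrow> real" is "\<lambda>A B. LINT p|I01x2. A p * B p"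
  unfolding kernel_eq_def by (intro integral_cong_AE) (auto simp: L2_def)

definition norm_hs :: "hs \<Rightarrow> real" where "norm_hs A = sqrt (inner A A)"
definition dist_hs :: "hs \<Rightarrow> hs \<Rightarrow> real" where "dist_hs A B = norm (A - B)"
definition sgn_hs :: "hs \<Rightarrow> hs" where "sgn_hs A = inverse (norm A) *\<^sub>R A"

definition uniformity_hs :: "(hs \<times> hs) filter" where
  "uniformity_hs = (INF e\<in>{0 <..}. principal {(x, y). dist x y < e})"
definition open_hs :: "hs set \<Rightarrow> bool" where
  "open_hs U \<longleftrightarrow> (\<forall>x\<in>U. eventually (\<lambda>(x', y). x' = x \<longrightarrow> y \<in> U) uniformity)"

instance
proof
  fix A B C :: hs and a :: real
  show "inner A B = inner B A" by transfer (simp add: mult.commute)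
  show "inner (A + B) C = inner A C + inner B C"
    by transfer (auto simp: kernel_eq_def distrib_right L2_integrable_mult)
  show "inner (a *\<^sub>R A) B = a * inner A B" by transfer (simp add: mult.assoc)
  show "0 \<le> inner A A" by transfer simp
  show "inner A A = 0 \<longleftrightarrow> A = 0"
  proof transfer
    fix A assume "kernel_eq A A"
    hence A: "L2 I01x2 A" by (simp add: kernel_eq_def)
    have "(LINT p|I01x2. A p * A p) = 0 \<longleftrightarrow> (AE p in I01x2. A p = 0)"
      using A integral_nonneg_eq_0_iff_AE[of I01x2 "\<lambda>p. (A p)\<^sup>2"]
      by (auto simp: L2_def power2_eq_square)
    thus "((LINT p|I01x2. A p * A p) = 0) = kernel_eq A (\<lambda>_. 0)"
      by (auto simp: kernel_eq_def A L2_zero)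
  qed
qed (simp_all add: dist_hs_def sgn_hs_def norm_hs_def uniformity_hs_def open_hs_def)

end

instance hs :: real_normed_algebra
proof
  fix A B :: hs
  have "inner (A * B) (A * B) \<le> inner A A * inner B B"
  proof transfer
    fix A B assume "kernel_eq A A" "kernel_eq B B"
    hence "L2 I01x2 A" "L2 I01x2 B" by (auto simp: kernel_eq_def)
    from I01.kcomp_norm_le[OF this]
    show "(LINT p|I01x2. kcomp I01 A B p * kcomp I01 A B p)
        \<le> (LINT p|I01x2. A p * A p) * (LINT p|I01x2. B p * B p)"
      by (simp add: power2_eq_square)
  qed
  thus "norm (A * B) \<le> norm A * norm B"
    unfolding norm_hs_def real_sqrt_mult[symmetric] by (rule real_sqrt_le_mono)
qed

instance hs :: complete_space
proof
  fix X :: "nat \<Rightarrow> hs" assume X: "Cauchy X"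
  define f where "f n = rep_hs (X n)" for n
  have f: "L2 I01x2 (f n)" for n
    using Quotient_rep_reflp[OF Quotient_hs] by (simp add: f_def kernel_eq_refl_iff)
  have Xf: "X n = abs_hs (f n)" for n
    by (simp add: f_def Quotient_abs_rep[OF Quotient_hs])
  have nrm: "(norm (abs_hs A - abs_hs B))\<^sup>2 = (LINT p|I01x2. (A p - B p)\<^sup>2)"
    if "L2 I01x2 A" "L2 I01x2 B" for A B
  proof -
    have "kernel_eq A A" "kernel_eq B B" "kernel_eq (\<lambda>p. A p - B p) (\<lambda>p. A p - B p)"
      using that by (auto simp: kernel_eq_refl_iff intro: L2_diff)
    thus ?thesis
      unfolding power2_norm_eq_inner by (simp add: minus_hs.abs_eq inner_hs.abs_eq power2_eq_square)
  qed
  obtain g where g: "L2 I01x2 g" "(\<lambda>n. LINT x|I01x2. (f n x - g x)\<^sup>2) \<longlonglongrightarrow> 0"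
  proof (rule L2_complete[OF f])
    fix e :: real assume "e > 0"
    then obtain N where N: "\<And>m n. m \<ge> N \<Longrightarrow> n \<ge> N \<Longrightarrow> norm (X m - X n) < sqrt e"
      using CauchyD[OF X, of "sqrt e"] by auto
    have "(LINT x|I01x2. (f m x - f n x)\<^sup>2) < e" if "m \<ge> N" "n \<ge> N" for m n
    proof -
      have "(norm (X m - X n))\<^sup>2 < (sqrt e)\<^sup>2" using N[OF that] by (intro power_strict_mono) auto
      thus ?thesis using \<open>e > 0\<close> by (simp add: Xf nrm f)
    qed
    thus "\<exists>N. \<forall>m\<ge>N. \<forall>n\<ge>N. (LINT x|I01x2. (f m x - f n x)\<^sup>2) < e" by blast
  qed blast
  have "(\<lambda>n. (norm (X n - abs_hs g))\<^sup>2) \<longlonglongrightarrow> 0"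
    using g(2) by (simp add: Xf nrm f g(1))
  hence "(\<lambda>n. norm (X n - abs_hs g)) \<longlonglongrightarrow> 0"
    using tendsto_real_sqrt[of "\<lambda>n. (norm (X n - abs_hs g))\<^sup>2" 0] by simp
  hence "X \<longlonglongrightarrow> abs_hs g" by (simp add: LIM_zero_iff tendsto_norm_zero_iff)
  thus "convergent X" by (rule convergentI)
qed

section \<open>Spectral expansion in a Hilbert algebra\<close>

text \<open>Kellogg's method. By self-adjointness the inner product of two powers of \<open>R\<close> depends only on
  the sum of the exponents. The squared norms \<open>q n\<close> of the powers are therefore log-convex and their
  ratios increase to a limit \<open>L\<close>; the even powers divided by the matching powers of \<open>L\<close> form a Cauchy
  sequence, whose limit \<open>P\<close> satisfies \<open>R R P = L P\<close>. The index is shifted: \<open>p n\<close> is the power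
  \<open>n + 1\<close>, as the algebra has no unit.\<close>
lemma eigenvector_of_selfadjoint_element:
  fixes R :: "'a :: {real_inner, complete_space, real_normed_algebra}"
  assumes adj: "\<And>A B. inner (R * A) B = inner A (R * B)"
    and nz: "R * R \<noteq> 0"
  shows "\<exists>P l. P \<noteq> 0 \<and> l \<noteq> 0 \<and> R * P = l *\<^sub>R P"
proof -
  define p where "p n = ((\<lambda>X. R * X) ^^ n) R" for n
  have p0: "p 0 = R" and pS: "p (Suc n) = R * p n" for n by (simp_all add: p_def)
  have pp: "p m * p n = p (Suc (m + n))" for m n
    by (induction m) (simp_all add: p0 pS mult.assoc)
  have shift: "inner (p (Suc m)) (p n) = inner (p m) (p (Suc n))" for m n
    by (simp add: pS adj)
  have inner_p: "inner (p (k + m)) (p n) = inner (p m) (p (k + n))" for k m n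
    by (induction k arbitrary: n) (simp_all add: shift)
  define q where "q n = (norm (p n))\<^sup>2" for n
  have inner_even: "inner (p m) (p n) = q k" if "m + n = 2 * k" for m n k
  proof -
    have "inner (p m) (p n) = inner (p k) (p k)"
    proof (cases "m \<le> k")
      case True
      then obtain i where i: "k = i + m" by (metis add.commute le_Suc_ex)
      hence "n = i + k" using that by simp
      thus ?thesis using inner_p[of i m k] by (simp add: i)
    next
      case False
      then obtain i where i: "m = i + k" by (metis add.commute le_Suc_ex nat_le_linear)
      hence "k = i + n" using that by simp
      thus ?thesis using inner_p[of i k n] by (simp add: i)
    qed
    thus ?thesis by (simp add: q_def power2_norm_eq_inner)
  qed
  have p_nz: "p (Suc n) \<noteq> 0" for n
  proof (induction n)
    case (Suc n)
    have "inner (p n) (p (Suc (Suc n))) = q (Suc n)" by (rule inner_even) simp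
    thus ?case using Suc by (auto simp: q_def)
  qed (use nz in \<open>simp add: pS p0\<close>)
  have R0: "R \<noteq> 0" using nz by auto
  have q_pos: "q n > 0" for n
    using p_nz[of "n - 1"] R0 by (cases n) (auto simp: q_def p0)
  have q_lc: "(q (Suc n))\<^sup>2 \<le> q n * q (Suc (Suc n))" for n
  proof -
    have "q (Suc n) = inner (p n) (p (Suc (Suc n)))" by (rule inner_even[symmetric]) simp
    thus ?thesis using Cauchy_Schwarz_ineq[of "p n" "p (Suc (Suc n))"]
      by (simp add: q_def power2_norm_eq_inner)
  qed
  define r where "r n = q (Suc n) / q n" for n
  have r_inc: "incseq r"
  proof (rule incseq_SucI)
    fix n show "r n \<le> r (Suc n)"
      using q_lc[of n] q_pos[of n] q_pos[of "Suc n"]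
      by (simp add: r_def field_simps power2_eq_square)
  qed
  have r_bd: "r n \<le> (norm R)\<^sup>2" for n
  proof -
    have "q (Suc n) \<le> (norm R)\<^sup>2 * q n"
      unfolding q_def pS power_mult_distrib[symmetric]
      by (intro power_mono norm_mult_ineq) auto
    thus ?thesis using q_pos[of n] by (simp add: r_def field_simps)
  qed
  have r_pos: "r n > 0" for n using q_pos by (simp add: r_def)
  obtain L where L: "r \<longlonglongrightarrow> L" and rL: "\<And>n. r n \<le> L"
    using incseq_convergent[OF r_inc, of "(norm R)\<^sup>2"] r_bd by blast
  have L_pos: "L > 0" using r_pos[of 0] rL[of 0] by simp
  define v where "v n = q n / L ^ Suc n" for n
  have v_pos: "v n > 0" for n using q_pos L_pos by (simp add: v_def)
  have v_dec: "decseq v"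
  proof (rule decseq_SucI)
    fix n
    have "q (Suc n) \<le> L * q n" using rL[of n] q_pos[of n] by (simp add: r_def field_simps)
    thus "v (Suc n) \<le> v n" using L_pos by (simp add: v_def field_simps)
  qed
  \<comment> \<open>Submultiplicativity of the norm keeps \<open>v\<close> away from \<open>0\<close>: a value below \<open>1\<close> would make
      \<open>q\<close> decay geometrically faster than the ratios \<open>r n \<longlonglongrightarrow> L\<close> allow.\<close>
  have v_ge: "v k \<ge> 1" for k
  proof (rule ccontr)
    assume "\<not> v k \<ge> 1"
    hence qk: "q k < L ^ Suc k" using L_pos by (simp add: v_def field_simps)
    have "((\<lambda>x. x ^ Suc k) \<longlongrightarrow> L ^ Suc k) (at_left L)" by (intro tendsto_intros)
    hence "\<forall>\<^sub>F x in at_left L. q k < x ^ Suc k" using qk by (rule order_tendstoD)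
    moreover have "\<forall>\<^sub>F x in at_left L. x \<in> {0<..<L}"
      using L_pos by (rule eventually_at_left_real)
    ultimately have "\<forall>\<^sub>F x in at_left L. q k < x ^ Suc k \<and> x \<in> {0<..<L}"
      by (rule eventually_conj)
    then obtain l where l: "q k < l ^ Suc k" "0 < l" "l < L"
      using eventually_happens'[OF trivial_limit_at_left_real] by fastforce
    \<comment> \<open>Beyond \<open>N\<close> the numbers \<open>q n\<close> grow by at least the factor \<open>l\<close>, so \<open>u\<close> below increases there,
        while along the indices \<open>m i\<close> it tends to \<open>0\<close>.\<close>
    obtain N where N: "\<And>n. n \<ge> N \<Longrightarrow> r n > l"
      using order_tendstoD(1)[OF L l(3)] by (auto simp: eventually_sequentially)
    define u where "u n = q n / l ^ Suc n" for n
    have u_inc: "u n \<le> u (Suc n)" if "n \<ge> N" for n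
      using N[OF that] q_pos[of n] l(2) by (simp add: r_def u_def field_simps)
    have u_N: "u n \<ge> u N" if "n \<ge> N" for n
      using that by (induction rule: dec_induct) (use u_inc order_trans in blast)+
    have q_sub: "q (Suc (n + n)) \<le> (q n)\<^sup>2" for n
      unfolding q_def pp[symmetric]
      using power_mono[OF norm_mult_ineq[of "p n" "p n"], of 2] by (simp add: power2_eq_square mult_ac)
    have u_sub: "u (Suc (n + n)) \<le> (u n)\<^sup>2" for n
    proof -
      have e: "l ^ Suc (Suc (n + n)) = (l ^ Suc n)\<^sup>2"
        by (simp add: power2_eq_square power_add mult_ac)
      show ?thesis unfolding u_def e power_divide by (intro divide_right_mono q_sub) simp
    qed
    have u_pos: "u n > 0" for n using q_pos l by (simp add: u_def)
    have uk: "u k < 1" using l by (simp add: u_def field_simps)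
    \<comment> \<open>doubling of the exponent: \<open>p (Suc (n + n))\<close> is the square of \<open>p n\<close>\<close>
    define m where "m i = ((\<lambda>n. Suc (n + n)) ^^ i) k" for i
    have um: "u (m i) \<le> u k ^ (2 ^ i)" for i
    proof (induction i)
      case (Suc i)
      have "u (m (Suc i)) \<le> (u (m i))\<^sup>2" using u_sub by (simp add: m_def)
      also have "\<dots> \<le> (u k ^ (2 ^ i))\<^sup>2" using Suc u_pos[of "m i"] by (intro power_mono) auto
      finally show ?case by (simp add: power_mult[symmetric] mult.commute)
    qed (simp add: m_def)
    have mi: "m i \<ge> i" for i by (induction i) (simp_all add: m_def)
    have "(\<lambda>i. u k ^ i) \<longlonglongrightarrow> 0" using uk u_pos[of k] by (intro LIMSEQ_realpow_zero) auto
    hence "\<forall>\<^sub>F i in sequentially. u k ^ i < u N" using u_pos[of N] by (rule order_tendstoD)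
    then obtain I where I: "\<And>i. i \<ge> I \<Longrightarrow> u k ^ i < u N" by (auto simp: eventually_sequentially)
    define i where "i = max I N"
    have "u N \<le> u (m i)" using mi[of i] by (intro u_N) (simp add: i_def)
    also have "\<dots> \<le> u k ^ (2 ^ i)" by (rule um)
    also have "\<dots> < u N"
    proof (rule I)
      have "I \<le> i" by (simp add: i_def)
      also have "i \<le> 2 ^ i" by (simp add: less_imp_le)
      finally show "I \<le> 2 ^ i" .
    qed
    finally show False by simp
  qed
  obtain v' where v': "v \<longlonglongrightarrow> v'"
    using decseq_convergent[OF v_dec, of 1] v_ge by blast
  \<comment> \<open>the even powers \<open>R\<^sup>2\<^sup>k\<^sup>+\<^sup>2\<close>, normalised\<close>
  define X where "X k = (1 / L ^ Suc k) *\<^sub>R p (Suc (k + k))" for k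
  have XX: "inner (X j) (X k) = v (Suc (j + k))" for j k
  proof -
    have "inner (p (Suc (j + j))) (p (Suc (k + k))) = q (Suc (j + k))"
      by (rule inner_even) simp
    thus ?thesis using L_pos by (simp add: X_def v_def power_add)
  qed
  have "Cauchy X"
  proof (rule CauchyI)
    fix e :: real assume e: "e > 0"
    obtain N where N: "\<And>n. n \<ge> N \<Longrightarrow> \<bar>v n - v'\<bar> < e\<^sup>2 / 4"
      using v' e unfolding LIMSEQ_iff by (metis real_norm_def zero_less_divide_iff zero_less_numeral zero_less_power)
    show "\<exists>M. \<forall>m\<ge>M. \<forall>n\<ge>M. norm (X m - X n) < e"
    proof (intro exI allI impI)
      fix m n assume mn: "m \<ge> N" "n \<ge> N"
      have "(norm (X m - X n))\<^sup>2 = v (Suc (m + m)) - 2 * v (Suc (m + n)) + v (Suc (n + n))"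
        by (simp add: power2_norm_eq_inner inner_diff_left inner_diff_right XX add.commute)
      also have "\<dots> < e\<^sup>2"
        using N[of "Suc (m + m)", OF le_SucI[OF trans_le_add1[OF mn(1)]]]
          N[of "Suc (m + n)", OF le_SucI[OF trans_le_add1[OF mn(1)]]]
          N[of "Suc (n + n)", OF le_SucI[OF trans_le_add1[OF mn(2)]]] by linarith
      finally show "norm (X m - X n) < e"
        using e by (simp add: power_less_imp_less_base)
    qed
  qed
  then obtain P where P: "X \<longlonglongrightarrow> P" using Cauchy_convergent_iff convergent_def by blast
  have P0: "P \<noteq> 0"
  proof
    assume "P = 0"
    hence "(\<lambda>k. (norm (X k))\<^sup>2) \<longlonglongrightarrow> 0" using tendsto_power[OF tendsto_norm[OF P], of 2] by simp
    moreover have "(norm (X k))\<^sup>2 \<ge> 1" for k using XX[of k k] v_ge by (simp add: power2_norm_eq_inner)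
    ultimately show False using LIMSEQ_le_const[of "\<lambda>k. (norm (X k))\<^sup>2" 0 1] by auto
  qed
  have "(\<lambda>k. R * (R * X k)) \<longlonglongrightarrow> R * (R * P)" by (intro tendsto_intros P)
  moreover have "R * (R * X k) = L *\<^sub>R X (Suc k)" for k
    using L_pos by (simp add: X_def pS)
  ultimately have "(\<lambda>k. L *\<^sub>R X (Suc k)) \<longlonglongrightarrow> R * (R * P)" by simp
  moreover have "(\<lambda>k. L *\<^sub>R X (Suc k)) \<longlonglongrightarrow> L *\<^sub>R P"
    by (intro tendsto_intros LIMSEQ_Suc[OF P])
  ultimately have RRP: "R * (R * P) = L *\<^sub>R P" by (rule LIMSEQ_unique)
  have s: "sqrt L \<noteq> 0" "sqrt L * sqrt L = L" using L_pos by auto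
  \<comment> \<open>\<open>R\<^sup>2 - L\<close> factors as \<open>(R - \<surd>L) (R + \<surd>L)\<close>.\<close>
  show ?thesis
  proof (cases "R * P + sqrt L *\<^sub>R P = 0")
    case True
    hence "R * P = (- sqrt L) *\<^sub>R P" by (simp add: add_eq_0_iff2)
    thus ?thesis using P0 s by (intro exI[of _ P] exI[of _ "- sqrt L"]) auto
  next
    case False
    have "R * (R * P + sqrt L *\<^sub>R P) = sqrt L *\<^sub>R (R * P + sqrt L *\<^sub>R P)"
      using s by (simp add: distrib_left RRP scaleR_add_right)
    thus ?thesis using False s by blast
  qed
qed

text \<open>The remainder \<open>R\<close> of \<open>K\<close> after subtracting \<open>\<Sum>\<^sub>j \<mu>\<^sub>j E\<^sub>j\<close> (convergent by Bessel's inequality) satisfies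
  \<open>E\<^sub>j R = 0\<close>. An eigenvector of \<open>R\<close> would thus be one of \<open>K\<close> killed by all \<open>E\<^sub>j\<close>, so \<open>R R = 0\<close> by
  Kellogg's method, and \<open>K K = \<Sum>\<^sub>j \<mu>\<^sub>j\<^sup>2 E\<^sub>j\<close>. The hypotheses do not force \<open>R\<close> itself to vanish:
  it may be an element that annihilates the whole algebra.\<close>
lemma spectral_expansion:
  fixes K :: "'a :: {real_inner, complete_space, real_normed_algebra}" and E :: "nat \<Rightarrow> 'a"
  assumes adjK: "\<And>A B. inner (K * A) B = inner A (K * B)"
    and adjE: "\<And>j A B. inner (E j * A) B = inner A (E j * B)"
    and orth: "\<And>i j. inner (E i) (E j) = (if i = j then 1 else 0)"
    and idem: "\<And>i j. E i * E j = (if i = j then E i else 0)"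
    and KE: "\<And>j. K * E j = \<mu> j *\<^sub>R E j" and EK: "\<And>j. E j * K = \<mu> j *\<^sub>R E j"
    and coeff: "\<And>j. inner K (E j) = \<mu> j"
    and maximal: "\<And>P l. l \<noteq> 0 \<Longrightarrow> K * P = l *\<^sub>R P \<Longrightarrow> (\<And>j. E j * P = 0) \<Longrightarrow> P = 0"
  shows "summable (\<lambda>j. (\<mu> j)\<^sup>2) \<and> (\<lambda>j. \<mu> j ^ 3) sums inner (K * K) K"
proof -
  define S where "S n = (\<Sum>j<n. \<mu> j *\<^sub>R E j)" for n
  have SS: "inner (S m) (S n) = (\<Sum>j<m. (\<mu> j)\<^sup>2)" if "m \<le> n" for m n
  proof -
    have "inner (S m) (S n) = (\<Sum>i<m. \<Sum>j<n. if i = j then (\<mu> i)\<^sup>2 else 0)"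
      unfolding S_def inner_sum_left
      by (intro sum.cong refl, subst inner_sum_right, intro sum.cong refl)
        (simp add: orth power2_eq_square)
    also have "\<dots> = (\<Sum>i<m. (\<mu> i)\<^sup>2)"
      using that by (intro sum.cong refl) (auto simp: sum.delta')
    finally show ?thesis .
  qed
  have KS: "inner K (S n) = (\<Sum>j<n. (\<mu> j)\<^sup>2)" for n
    by (simp add: S_def inner_sum_right coeff power2_eq_square)
  have bessel: "(\<Sum>j<n. (\<mu> j)\<^sup>2) \<le> (norm K)\<^sup>2" for n
  proof -
    have "(norm (K - S n))\<^sup>2 = (norm K)\<^sup>2 - (\<Sum>j<n. (\<mu> j)\<^sup>2)"
      unfolding power2_norm_eq_inner inner_diff_left inner_diff_right
      using KS[of n] SS[of n n] by (simp add: inner_commute)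
    thus ?thesis using zero_le_power2[of "norm (K - S n)"] by linarith
  qed
  have sm: "summable (\<lambda>j. (\<mu> j)\<^sup>2)"
    by (rule summableI_nonneg_bounded[OF _ bessel]) simp
  have "Cauchy S"
  proof (rule CauchyI)
    fix e :: real assume e: "e > 0"
    have "Cauchy (\<lambda>n. \<Sum>j<n. (\<mu> j)\<^sup>2)"
      using sm by (simp add: summable_iff_convergent convergent_Cauchy)
    then obtain N where N: "\<And>m n. m \<ge> N \<Longrightarrow> n \<ge> N \<Longrightarrow>
        norm ((\<Sum>j<m. (\<mu> j)\<^sup>2) - (\<Sum>j<n. (\<mu> j)\<^sup>2)) < e\<^sup>2"
      using CauchyD[of "\<lambda>n. \<Sum>j<n. (\<mu> j)\<^sup>2" "e\<^sup>2"] e by (metis zero_less_power)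
    have *: "norm (S n - S m) < e" if "m \<ge> N" "n \<ge> N" "m \<le> n" for m n
    proof -
      have "(norm (S n - S m))\<^sup>2 = (\<Sum>j<n. (\<mu> j)\<^sup>2) - (\<Sum>j<m. (\<mu> j)\<^sup>2)"
        unfolding power2_norm_eq_inner inner_diff_left inner_diff_right
        using SS[of m n] SS[of m m] SS[of n n] that by (simp add: inner_commute)
      also have "\<dots> < e\<^sup>2" using N[of n m] that by simp
      finally show ?thesis using e by (simp add: power_less_imp_less_base)
    qed
    show "\<exists>M. \<forall>m\<ge>M. \<forall>n\<ge>M. norm (S m - S n) < e"
      by (metis * nat_le_linear norm_minus_commute)
  qed
  then obtain S' where S': "S \<longlonglongrightarrow> S'" using Cauchy_convergent_iff convergent_def by blast
  have adjS: "inner (S' * A) B = inner A (S' * B)" for A B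
  proof (rule LIMSEQ_unique)
    show "(\<lambda>n. inner (S n * A) B) \<longlonglongrightarrow> inner (S' * A) B" by (intro tendsto_intros S')
    have "inner (S n * A) B = inner A (S n * B)" for n
      by (simp add: S_def sum_distrib_right inner_sum_left inner_sum_right adjE)
    moreover have "(\<lambda>n. inner A (S n * B)) \<longlonglongrightarrow> inner A (S' * B)" by (intro tendsto_intros S')
    ultimately show "(\<lambda>n. inner (S n * A) B) \<longlonglongrightarrow> inner A (S' * B)" by simp
  qed
  define R where "R = K - S'"
  have adjR: "inner (R * A) B = inner A (R * B)" for A B
    by (simp add: R_def left_diff_distrib inner_diff_left inner_diff_right adjK adjS)
  have ES: "E j * S' = \<mu> j *\<^sub>R E j" for j
  proof (rule LIMSEQ_unique)
    show "(\<lambda>n. E j * S n) \<longlonglongrightarrow> E j * S'" by (intro tendsto_intros S')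
    have "E j * S n = \<mu> j *\<^sub>R E j" if "n > j" for n
    proof -
      have "E j * S n = (\<Sum>i<n. if i = j then \<mu> j *\<^sub>R E j else 0)"
        unfolding S_def sum_distrib_left by (intro sum.cong refl) (auto simp: idem)
      thus ?thesis using that by (subst (asm) sum.delta) auto
    qed
    thus "(\<lambda>n. E j * S n) \<longlonglongrightarrow> \<mu> j *\<^sub>R E j"
      by (intro tendsto_eventually eventually_mono[OF eventually_gt_at_top[of j]])
  qed
  have ER: "E j * R = 0" for j by (simp add: R_def right_diff_distrib EK ES)
  have SA: "S' * A = 0" if "\<And>j. E j * A = 0" for A
  proof (rule LIMSEQ_unique)
    show "(\<lambda>n. S n * A) \<longlonglongrightarrow> S' * A" by (intro tendsto_intros S')
    show "(\<lambda>n. S n * A) \<longlonglongrightarrow> 0" by (simp add: S_def sum_distrib_right that)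
  qed
  have RR: "R * R = 0"
  proof (rule ccontr)
    assume "R * R \<noteq> 0"
    from eigenvector_of_selfadjoint_element[OF adjR this]
    obtain P l where P: "P \<noteq> 0" "l \<noteq> 0" "R * P = l *\<^sub>R P" by blast
    have EP: "E j * P = 0" for j
    proof -
      have "l *\<^sub>R (E j * P) = E j * (R * P)" by (simp add: P)
      also have "\<dots> = 0" by (simp add: mult.assoc[symmetric] ER)
      finally show ?thesis using P by simp
    qed
    have "K * P = R * P + S' * P" by (simp add: R_def left_diff_distrib)
    hence "K * P = l *\<^sub>R P" using P SA[OF EP] by simp
    thus False using maximal[OF P(2) _ EP] P(1) by blast
  qed
  have "K * K = K * S' + S' * R + R * R" by (simp add: R_def algebra_simps)
  hence KK: "K * K = K * S'" using RR SA[OF ER] by simp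
  have "(\<lambda>n. inner (K * S n) K) \<longlonglongrightarrow> inner (K * S') K" by (intro tendsto_intros S')
  moreover have "inner (K * S n) K = (\<Sum>j<n. \<mu> j ^ 3)" for n
    using coeff by (simp add: S_def sum_distrib_left inner_sum_left KE inner_commute[of "E _"]
        power3_eq_cube mult_ac)
  ultimately show ?thesis using sm by (simp add: sums_def KK)
qed

section \<open>Eigenvalues of a symmetric kernel and the trace of its cube\<close>

lemma hs_cases:
  obtains f where "L2 I01x2 f" "X = abs_hs f"
proof
  show "L2 I01x2 (rep_hs X)"
    using Quotient_rep_reflp[OF Quotient_hs] by (simp add: kernel_eq_refl_iff)
  show "X = abs_hs (rep_hs X)" by (simp add: Quotient_abs_rep[OF Quotient_hs])
qed

lemma abs_hs_eq_iff:
  "L2 I01x2 A \<Longrightarrow> L2 I01x2 B \<Longrightarrow> abs_hs A = abs_hs B \<longleftrightarrow> (AE p in I01x2. A p = B p)"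
  using Quotient_rel[OF Quotient_hs, of A B] by (auto simp: kernel_eq_def)

lemma times_abs_hs: "L2 I01x2 A \<Longrightarrow> L2 I01x2 B \<Longrightarrow> abs_hs A * abs_hs B = abs_hs (kcomp I01 A B)"
  by (rule times_hs.abs_eq) (simp_all add: kernel_eq_refl_iff)

lemma scaleR_abs_hs: "L2 I01x2 A \<Longrightarrow> c *\<^sub>R abs_hs A = abs_hs (\<lambda>p. c * A p)"
  by (rule scaleR_hs.abs_eq) (simp_all add: kernel_eq_refl_iff)

lemma inner_abs_hs:
  "L2 I01x2 A \<Longrightarrow> L2 I01x2 B \<Longrightarrow> inner (abs_hs A) (abs_hs B) = (LINT p|I01x2. A p * B p)"
  by (rule inner_hs.abs_eq) (simp_all add: kernel_eq_refl_iff)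

lemma selfadjoint_abs_hs:
  assumes K: "L2 I01x2 K" and sym: "\<And>x y. K (x, y) = K (y, x)"
  shows "inner (abs_hs K * X) Y = inner X (abs_hs K * Y)"
proof -
  obtain A where A: "L2 I01x2 A" "X = abs_hs A" by (rule hs_cases)
  obtain B where B: "L2 I01x2 B" "Y = abs_hs B" by (rule hs_cases)
  show ?thesis using I01.kcomp_selfadjoint[OF K A(1) B(1) sym]
    by (simp add: A B K times_abs_hs inner_abs_hs I01.L2_kcomp)
qed

definition tensor :: "(real \<Rightarrow> real) \<Rightarrow> (real \<Rightarrow> real) \<Rightarrow> real \<times> real \<Rightarrow> real" where
  "tensor f g = (\<lambda>(x, y). f x * g y)"

lemma L2_01_iff: "f \<in> L2_01 \<longleftrightarrow> L2 I01 f"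
  by (simp add: L2_01_def L2_def)

lemma L2_tensor_I01: "L2 I01 f \<Longrightarrow> L2 I01 g \<Longrightarrow> L2 I01x2 (tensor f g)"
  unfolding tensor_def by (rule I01.L2_tensor)

definition kernel_op :: "(real \<times> real \<Rightarrow> real) \<Rightarrow> (real \<Rightarrow> real) \<Rightarrow> real \<Rightarrow> real" where
  "kernel_op K f x = (LINT y|I01. K (x, y) * f y)"

lemma kcomp_tensor: "kcomp I01 (tensor f g) (tensor f' g') p = inner_L2 g f' * tensor f g' p"
proof -
  have "(LINT z|I01. f x * g z * (f' z * g' y)) = (LINT z|I01. (f x * g' y) * (g z * f' z))" for x y
    by (intro Bochner_Integration.integral_cong) (auto simp: mult_ac)
  thus ?thesis by (cases p) (simp add: kcomp_def tensor_def inner_L2_def)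
qed

lemma kcomp_kernel_tensor: "kcomp I01 K (tensor f g) p = tensor (kernel_op K f) g p"
  by (cases p) (simp add: kcomp_def tensor_def kernel_op_def mult.assoc[symmetric])

lemma kcomp_tensor_kernel: 
  "kcomp I01 (tensor f g) K (x, y) = f x * (LINT z|I01. g z * K (z, y))"
  by (simp add: kcomp_def tensor_def mult.assoc)

lemma inner_kernel_tensor:
  assumes K: "L2 I01x2 K" and f: "L2 I01 f" and g: "L2 I01 g"
  shows "(LINT p|I01x2. K p * tensor f g p) = inner_L2 f (kernel_op K g)"
proof -
  interpret P: pair_sigma_finite I01 I01 by (rule I01.pair_sigma_finite_self)
  have "(LINT p|I01x2. K p * tensor f g p) = (LINT x|I01. LINT y|I01. K (x, y) * tensor f g (x, y))"
    by (rule P.integral_fst'[symmetric]) (rule L2_integrable_mult[OF K L2_tensor_I01[OF f g]])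
  also have "\<dots> = (LINT x|I01. f x * (LINT y|I01. K (x, y) * g y))"
    by (intro Bochner_Integration.integral_cong refl, subst integral_mult_right_zero[symmetric])
      (simp add: tensor_def mult_ac)
  finally show ?thesis by (simp add: inner_L2_def kernel_op_def)
qed

lemma kernel_op_selfadjoint:
  assumes K: "L2 I01x2 K" and sym: "\<And>x y. K (x, y) = K (y, x)" and f: "L2 I01 f" and g: "L2 I01 g"
  shows "inner_L2 f (kernel_op K g) = inner_L2 (kernel_op K f) g"
  using I01.bilinear_swap[OF f g K]
  by (simp add: inner_L2_def kernel_op_def sym mult.commute)

lemma inner_L2_cong_AE:
  assumes "AE x in I01. f x = f' x" "AE x in I01. g x = g' x"
    "f \<in> borel_measurable I01" "f' \<in> borel_measurable I01" "g \<in> borel_measurable I01" "g' \<in> borel_measurable I01"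
  shows "inner_L2 f g = inner_L2 f' g'"
  unfolding inner_L2_def
proof (rule integral_cong_AE)
  show "AE x in I01. f x * g x = f' x * g' x" using assms(1,2) by eventually_elim simp
qed (use assms in auto)

lemma kernel_op_measurable:
  assumes [measurable]: "K \<in> borel_measurable I01x2" "f \<in> borel_measurable I01"
  shows "kernel_op K f \<in> borel_measurable I01"
  unfolding kernel_op_def by measurable

lemma inner_L2_scale: "inner_L2 g (\<lambda>x. c * f x) = c * inner_L2 g f"
proof -
  have "(\<lambda>x. g x * (c * f x)) = (\<lambda>x. c * (g x * f x))" by (simp add: mult_ac)
  thus ?thesis by (simp add: inner_L2_def)
qed

lemma inner_L2_eigen:
  assumes K: "L2 I01x2 K" and f: "f \<in> eigenspace (kernel_op K) l" and g: "L2 I01 g"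
  shows "inner_L2 g (kernel_op K f) = l * inner_L2 g f"
proof -
  have fl: "L2 I01 f" "AE x in I01. kernel_op K f x = l * f x"
    using f by (auto simp: eigenspace_def L2_01_iff)
  have "inner_L2 g (kernel_op K f) = inner_L2 g (\<lambda>x. l * f x)"
    by (rule inner_L2_cong_AE) (use fl g K kernel_op_measurable[of K f] in \<open>auto simp: L2_def\<close>)
  thus ?thesis by (simp add: inner_L2_scale)
qed

lemma inner_L2_commute: "inner_L2 f g = inner_L2 g f"
  by (simp add: inner_L2_def mult.commute)

lemma inner_L2_zero_AE: "AE x in I01. f x = 0 \<Longrightarrow> L2 I01 f \<Longrightarrow> L2 I01 g \<Longrightarrow> inner_L2 g f = 0"
  using inner_L2_cong_AE[of g g f "\<lambda>_. 0"] by (simp add: L2_def) (simp add: inner_L2_def)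

text \<open>Reading the bases of the eigenspaces along the sequence of eigenvalues: the \<open>j\<close>-th function is
  the basis vector for \<open>\<mu> j\<close> whose number is the count of earlier occurrences of that value.\<close>
lemma eigenfunction_sequence:
  assumes K: "L2 I01x2 K" and sym: "\<And>x y. K (x, y) = K (y, x)"
    and ev: "eigenvalue_sequence (kernel_op K) \<mu>"
  obtains e where "\<forall>j. e j \<in> eigenspace (kernel_op K) (\<mu> j)"
    and "\<forall>i j. inner_L2 (e i) (e j) = (if i = j then 1 else 0)"
    and "\<forall>l. \<forall>f\<in>eigenspace (kernel_op K) l. (\<forall>j. inner_L2 (e j) f = 0) \<longrightarrow> (AE x in I01. f x = 0)"
proof -
  define n where "n l = card {j. \<mu> j = l}" for l
  have fin: "finite {j. \<mu> j = l}" for l using ev by (auto simp: eigenvalue_sequence_def)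
  have "\<forall>l. has_multiplicity (kernel_op K) l (n l)" using ev by (auto simp: eigenvalue_sequence_def n_def)
  then obtain b where b': "\<forall>l. (\<forall>i<n l. b l i \<in> eigenspace (kernel_op K) l) \<and>
      (\<forall>i<n l. \<forall>j<n l. inner_L2 (b l i) (b l j) = (if i = j then 1 else 0)) \<and>
      (\<forall>f\<in>eigenspace (kernel_op K) l. \<exists>c. AE x in I01. f x = (\<Sum>i<n l. c i * b l i x))"
    unfolding has_multiplicity_def by (auto dest!: choice)
  have b: "i < n l \<Longrightarrow> b l i \<in> eigenspace (kernel_op K) l"
    "i < n l \<Longrightarrow> j < n l \<Longrightarrow> inner_L2 (b l i) (b l j) = (if i = j then 1 else 0)"
    "f \<in> eigenspace (kernel_op K) l \<Longrightarrow> \<exists>c. AE x in I01. f x = (\<Sum>i<n l. c i * b l i x)" for l i j f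
    using spec[OF b', of l] by blast+
  define idx where "idx j = card {i. i < j \<and> \<mu> i = \<mu> j}" for j
  have idx_lt: "idx j < n (\<mu> j)" for j
    unfolding idx_def n_def by (rule psubset_card_mono[OF fin]) auto
  have idx_mono: "idx i < idx j" if "i < j" "\<mu> i = \<mu> j" for i j
    unfolding idx_def by (rule psubset_card_mono) (use that in auto)
  have idx_inj: "inj_on idx {j. \<mu> j = l}" for l
  proof (rule inj_onI)
    fix i j assume "i \<in> {j. \<mu> j = l}" "j \<in> {j. \<mu> j = l}" "idx i = idx j"
    thus "i = j" using idx_mono[of i j] idx_mono[of j i] by (cases i j rule: linorder_cases) auto
  qed
  have idx_surj: "idx ` {j. \<mu> j = l} = {..<n l}" for l
  proof (rule card_subset_eq)
    show "idx ` {j. \<mu> j = l} \<subseteq> {..<n l}" using idx_lt by auto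
    show "card (idx ` {j. \<mu> j = l}) = card {..<n l}" using idx_inj by (simp add: card_image n_def)
  qed auto
  define e where "e j = b (\<mu> j) (idx j)" for j
  have eE: "e j \<in> eigenspace (kernel_op K) (\<mu> j)" for j
    unfolding e_def by (rule b(1)[OF idx_lt])
  hence eL: "L2 I01 (e j)" for j by (auto simp: eigenspace_def L2_01_iff)
  have "inner_L2 (e i) (e j) = (if i = j then 1 else 0)" for i j
  proof -
    show "inner_L2 (e i) (e j) = (if i = j then 1 else 0)"
    proof (cases "\<mu> i = \<mu> j")
      case True
      have "idx i = idx j \<longleftrightarrow> i = j" using inj_on_eq_iff[OF idx_inj[of "\<mu> j"]] True by simp
      thus ?thesis using b(2)[of "idx i" "\<mu> j" "idx j"] idx_lt[of i] idx_lt[of j] True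
        by (simp add: e_def)
    next
      case False
      have "\<mu> j * inner_L2 (e i) (e j) = inner_L2 (e i) (kernel_op K (e j))"
        by (rule inner_L2_eigen[OF K eE eL, symmetric])
      also have "\<dots> = inner_L2 (kernel_op K (e i)) (e j)"
        by (rule kernel_op_selfadjoint[OF K sym eL eL])
      also have "\<dots> = inner_L2 (e j) (kernel_op K (e i))"
        by (rule inner_L2_commute)
      also have "\<dots> = \<mu> i * inner_L2 (e j) (e i)"
        by (rule inner_L2_eigen[OF K eE eL])
      also have "inner_L2 (e j) (e i) = inner_L2 (e i) (e j)"
        by (rule inner_L2_commute)
      finally show ?thesis using False by auto
    qed
  qed
  moreover have "AE x in I01. f x = 0"
    if f: "f \<in> eigenspace (kernel_op K) l" and orth: "\<forall>j. inner_L2 (e j) f = 0" for f l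
  proof -
    obtain c where c: "AE x in I01. f x = (\<Sum>i<n l. c i * b l i x)" using b(3)[OF f] by blast
    have fL: "L2 I01 f" using f by (auto simp: eigenspace_def L2_01_iff)
    have bL: "L2 I01 (b l i)" if "i < n l" for i
      using b(1)[OF that] by (auto simp: eigenspace_def L2_01_iff)
    have bf: "inner_L2 (b l i) f = 0" if "i < n l" for i
    proof -
      have "i \<in> idx ` {j. \<mu> j = l}" using idx_surj[of l] \<open>i < n l\<close> by simp
      then obtain j where "\<mu> j = l" "idx j = i" by auto
      thus ?thesis using spec[OF orth, of j] by (simp add: e_def)
    qed
    have int: "integrable I01 (\<lambda>x. b l i x * f x)" if "i < n l" for i
      by (rule L2_integrable_mult[OF bL[OF that] fL])
    have "(LINT x|I01. (f x)\<^sup>2) = (LINT x|I01. (\<Sum>i<n l. c i * (b l i x * f x)))"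
    proof (rule integral_cong_AE)
      show "AE x in I01. (f x)\<^sup>2 = (\<Sum>i<n l. c i * (b l i x * f x))"
        using c
      proof eventually_elim
        case (elim x)
        have "(f x)\<^sup>2 = (\<Sum>i<n l. c i * b l i x) * f x"
          by (subst elim[symmetric]) (simp add: power2_eq_square)
        thus ?case by (simp add: sum_distrib_right mult.assoc)
      qed
    qed (use fL bL in \<open>auto simp: L2_def intro!: borel_measurable_sum borel_measurable_times\<close>)
    also have "\<dots> = (\<Sum>i<n l. c i * inner_L2 (b l i) f)"
      unfolding inner_L2_def using int by (subst Bochner_Integration.integral_sum) auto
    also have "\<dots> = 0" by (simp add: bf)
    finally show "AE x in I01. f x = 0" by (rule L2_eq_0[OF fL])
  qed
  ultimately show ?thesis using that[of e] eE by blast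
qed

text \<open>The projections \<open>E\<^sub>j\<close> of \<open>spectral_expansion\<close> are the kernels \<open>e\<^sub>j \<otimes> e\<^sub>j\<close>. Its maximality
  hypothesis holds because for almost every \<open>y\<close> the column \<open>P (_, y)\<close> of a kernel eigenvector \<open>P\<close> is
  an eigenfunction of the operator, orthogonal to all \<open>e\<^sub>j\<close>, hence zero.\<close>
theorem trace_cube_kernel:
  assumes K: "L2 I01x2 K" and sym: "\<And>x y. K (x, y) = K (y, x)"
    and ev: "eigenvalue_sequence (kernel_op K) \<mu>"
  shows "summable (\<lambda>j. (\<mu> j)\<^sup>2)"
    and "(\<lambda>j. \<mu> j ^ 3) sums (LINT p|I01x2. kcomp I01 K K p * K p)"
proof -
  interpret P: pair_sigma_finite I01 I01 by (rule I01.pair_sigma_finite_self)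
  obtain e where e: "\<forall>j. e j \<in> eigenspace (kernel_op K) (\<mu> j)"
    "\<forall>i j. inner_L2 (e i) (e j) = (if i = j then 1 else 0)"
    "\<forall>l. \<forall>f\<in>eigenspace (kernel_op K) l. (\<forall>j. inner_L2 (e j) f = 0) \<longrightarrow> (AE x in I01. f x = 0)"
    by (rule eigenfunction_sequence[OF K sym ev])
  note eE = spec[OF e(1)] and orth = spec[OF spec[OF e(2)]]
  have eL: "L2 I01 (e j)" and eAE: "AE x in I01. kernel_op K (e j) x = \<mu> j * e j x" for j
    using eE[of j] by (auto simp: eigenspace_def L2_01_iff)
  define T where "T j = tensor (e j) (e j)" for j
  have TL: "L2 I01x2 (T j)" for j unfolding T_def by (rule L2_tensor_I01[OF eL eL])
  have T_sym: "T j (x, y) = T j (y, x)" for j x y by (simp add: T_def tensor_def)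
  define E where "E j = abs_hs (T j)" for j
  have ip: "inner (abs_hs A) (E j) = inner_L2 (e j) (kernel_op A (e j))" if "L2 I01x2 A" for A j
    using inner_abs_hs[OF that TL[of j]] inner_kernel_tensor[OF that eL[of j] eL[of j]]
    by (simp add: E_def T_def)
  have "summable (\<lambda>j. (\<mu> j)\<^sup>2) \<and> (\<lambda>j. \<mu> j ^ 3) sums inner (abs_hs K * abs_hs K) (abs_hs K)"
  proof (rule spectral_expansion[where E = E])
    show "inner (abs_hs K * A) B = inner A (abs_hs K * B)" for A B
      by (rule selfadjoint_abs_hs[OF K sym])
    show "inner (E j * A) B = inner A (E j * B)" for j A B
      unfolding E_def by (rule selfadjoint_abs_hs[OF TL T_sym])
    show "inner (E i) (E j) = (if i = j then 1 else 0)" for i j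
    proof -
      have "kernel_op (T i) (e j) = (\<lambda>x. inner_L2 (e i) (e j) * e i x)"
        by (auto simp: kernel_op_def T_def tensor_def inner_L2_def fun_eq_iff mult.assoc)
      hence "inner (E i) (E j) = inner_L2 (e j) (\<lambda>x. inner_L2 (e i) (e j) * e i x)"
        using ip[OF TL, of i j] by (simp add: E_def)
      also have "\<dots> = inner_L2 (e i) (e j) * inner_L2 (e j) (e i)"
        by (rule inner_L2_scale)
      finally show ?thesis by (simp add: orth)
    qed
    show "E i * E j = (if i = j then E i else 0)" for i j
    proof -
      have "kcomp I01 (T i) (T j) = (\<lambda>p. inner_L2 (e i) (e j) * tensor (e i) (e j) p)"
        unfolding T_def by (rule ext) (rule kcomp_tensor)
      hence "E i * E j = inner_L2 (e i) (e j) *\<^sub>R abs_hs (tensor (e i) (e j))"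
        by (simp add: E_def times_abs_hs TL scaleR_abs_hs L2_tensor_I01 eL)
      thus ?thesis by (simp add: orth E_def T_def)
    qed
    show "abs_hs K * E j = \<mu> j *\<^sub>R E j" for j
    proof -
      have "AE p in I01x2. kcomp I01 K (T j) p = \<mu> j * T j p"
        using I01.AE_pair_fst[OF eAE[of j]]
        by eventually_elim (unfold T_def kcomp_kernel_tensor, simp add: tensor_def split_beta)
      thus ?thesis
        by (simp add: E_def times_abs_hs K TL scaleR_abs_hs abs_hs_eq_iff I01.L2_kcomp L2_cmult)
    qed
    show "E j * abs_hs K = \<mu> j *\<^sub>R E j" for j
    proof -
      have "AE p in I01x2. kcomp I01 (T j) K p = \<mu> j * T j p"
        using I01.AE_pair_snd[OF eAE[of j]]
      proof eventually_elim
        case (elim p)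
        have "(LINT z|I01. e j z * K (z, snd p)) = kernel_op K (e j) (snd p)"
          by (simp add: kernel_op_def sym[of _ "snd p"] mult.commute)
        thus ?case using elim
          by (cases p) (simp add: T_def kcomp_tensor_kernel, simp add: tensor_def)
      qed
      thus ?thesis
        by (simp add: E_def times_abs_hs K TL scaleR_abs_hs abs_hs_eq_iff I01.L2_kcomp L2_cmult)
    qed
    show "inner (abs_hs K) (E j) = \<mu> j" for j
      by (simp add: ip[OF K] inner_L2_eigen[OF K eE eL] orth)
    fix X l assume l: "l \<noteq> 0" and KX: "abs_hs K * X = l *\<^sub>R X" and EX: "\<And>j. E j * X = 0"
    obtain p where p: "L2 I01x2 p" "X = abs_hs p" by (rule hs_cases)
    have [measurable]: "p \<in> borel_measurable I01x2" using p by (auto simp: L2_def)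
    have "AE q in I01x2. kcomp I01 K p q = l * p q"
      using KX p by (simp add: times_abs_hs K scaleR_abs_hs abs_hs_eq_iff I01.L2_kcomp L2_cmult)
    hence 1: "AE y in I01. AE x in I01. kcomp I01 K p (x, y) = l * p (x, y)"
      by (rule I01.AE_sections')
    have 2: "AE y in I01. \<forall>j. AE x in I01. kcomp I01 (T j) p (x, y) = 0"
    proof (subst AE_all_countable, rule allI)
      fix j
      have "abs_hs (kcomp I01 (T j) p) = abs_hs (\<lambda>_. 0)"
        using EX[of j] p by (simp add: E_def times_abs_hs TL zero_hs_def)
      hence "AE q in I01x2. kcomp I01 (T j) p q = 0"
        using p by (simp add: abs_hs_eq_iff I01.L2_kcomp TL L2_zero)
      thus "AE y in I01. AE x in I01. kcomp I01 (T j) p (x, y) = 0" by (rule I01.AE_sections')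
    qed
    have "AE y in I01. AE x in I01. p (x, y) = 0"
      using 1 2 I01.L2_sections'[OF p(1)]
    proof eventually_elim
      case (elim y)
      have "(\<lambda>x. p (x, y)) \<in> eigenspace (kernel_op K) l"
        using elim(1,3) by (simp add: eigenspace_def L2_01_iff kcomp_def kernel_op_def)
      moreover have "inner_L2 (e j) (\<lambda>x. p (x, y)) = 0" for j
      proof -
        have "AE x in I01. e j x * inner_L2 (e j) (\<lambda>x. p (x, y)) = 0"
          using elim(2) by (simp add: T_def kcomp_tensor_kernel inner_L2_def)
        hence "AE x in I01. e j x = 0" if "inner_L2 (e j) (\<lambda>x. p (x, y)) \<noteq> 0"
          using that by simp
        thus ?thesis using inner_L2_zero_AE[OF _ eL eL, of j j] orth[of j j] by auto
      qed
      ultimately show ?case using e(3) by blast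
    qed
    hence "AE q in I01x2. p (snd q, fst q) = 0"
      by (intro P.AE_pair_measure) auto
    from I01.AE_pair_swap[OF this] have "AE q in I01x2. p q = 0" by simp
    thus "X = 0" using p by (simp add: zero_hs_def abs_hs_eq_iff L2_zero)
  qed
  thus "summable (\<lambda>j. (\<mu> j)\<^sup>2)" "(\<lambda>j. \<mu> j ^ 3) sums (LINT p|I01x2. kcomp I01 K K p * K p)"
    by (simp_all add: times_abs_hs K inner_abs_hs I01.L2_kcomp)
qed

section \<open>A two-dimensional Selberg integral\<close>

lemma I01_measurable [measurable]: "(\<lambda>x. x) \<in> borel_measurable I01"
  by (rule measurable_restrict_space1) simp

lemma I01_measurable_fst [measurable]: "fst \<in> borel_measurable (I01 \<Otimes>\<^sub>M N)"
  using measurable_compose[OF measurable_fst[of I01 N] I01_measurable] by simp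

lemma I01_measurable_snd [measurable]: "snd \<in> borel_measurable (N \<Otimes>\<^sub>M I01)"
  using measurable_compose[OF measurable_snd[of N I01] I01_measurable] by simp

lemma I01_measurable_fst_fst [measurable]:
  "(\<lambda>p. fst (fst p)) \<in> borel_measurable ((I01 \<Otimes>\<^sub>M N) \<Otimes>\<^sub>M L)"
  by (rule measurable_compose[OF measurable_fst I01_measurable_fst])

lemma I01_measurable_snd_fst [measurable]:
  "(\<lambda>p. snd (fst p)) \<in> borel_measurable ((N \<Otimes>\<^sub>M I01) \<Otimes>\<^sub>M L)"
  by (rule measurable_compose[OF measurable_fst I01_measurable_snd])

lemma space_I01 [simp]: "space I01 = {0<..<1}" by (simp add: space_restrict_space)

interpretation I01x2: pair_sigma_finite I01 I01 by (rule I01.pair_sigma_finite_self)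

lemma AE_I01x2_I: "(\<And>x y. 0 < x \<Longrightarrow> x < 1 \<Longrightarrow> 0 < y \<Longrightarrow> y < 1 \<Longrightarrow> P (x, y)) \<Longrightarrow> AE p in I01x2. P p"
  by (rule AE_I2) (auto simp: space_pair_measure)

lemma integral_I01_eqI:
  assumes "integrable I01 f" "(f has_integral c) {0..1}"
  shows "(LINT x|I01. f x) = (c :: real)"
proof -
  have "set_integrable lborel {0<..<1} f"
    using assms(1) by (simp add: integrable_restrict_space set_integrable_def)
  from set_borel_integral_eq_integral[OF this]
  have "(LINT x:{0<..<1}|lborel. f x) = integral {0<..<1} f" by simp
  also have "\<dots> = c" using assms(2) by (simp add: has_integral_Icc_iff_Ioo integral_unique)
  finally show ?thesis by (simp add: integral_restrict_space set_lebesgue_integral_def)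
qed

lemma Beta_I01:
  assumes "p > 0" "q > (0 :: real)"
  shows "integrable I01 (\<lambda>t. t powr (p - 1) * (1 - t) powr (q - 1))"
    and "(LINT t|I01. t powr (p - 1) * (1 - t) powr (q - 1)) = Beta p q"
proof -
  have "set_integrable lborel {0<..<1} (\<lambda>t. t powr (p - 1) * (1 - t) powr (q - 1))"
    by (rule set_integrable_subset[OF integrable_Beta[OF assms]]) auto
  thus *: "integrable I01 (\<lambda>t. t powr (p - 1) * (1 - t) powr (q - 1))"
    by (simp add: integrable_restrict_space set_integrable_def)
  show "(LINT t|I01. t powr (p - 1) * (1 - t) powr (q - 1)) = Beta p q"
    by (rule integral_I01_eqI[OF * has_integral_Beta_real[OF assms]])
qed

lemma integrable_tensor:
  assumes f: "integrable I01 f" and g: "integrable I01 (g :: real \<Rightarrow> real)"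
  shows "integrable I01x2 (\<lambda>p. f (fst p) * g (snd p))"
proof (rule integrableI_bounded)
  have [measurable]: "f \<in> borel_measurable I01" "g \<in> borel_measurable I01" using f g by auto
  show "(\<lambda>p. f (fst p) * g (snd p)) \<in> borel_measurable I01x2" by measurable
  have "(\<integral>\<^sup>+p. ennreal (norm (f (fst p) * g (snd p))) \<partial>I01x2)
      = (\<integral>\<^sup>+x. \<integral>\<^sup>+y. ennreal (norm (f x)) * ennreal (norm (g y)) \<partial>I01 \<partial>I01)"
    by (subst I01.nn_integral_fst[symmetric]) (auto simp: abs_mult ennreal_mult' intro!: nn_integral_cong)
  also have "\<dots> = (\<integral>\<^sup>+x. ennreal (norm (f x)) \<partial>I01) * (\<integral>\<^sup>+x. ennreal (norm (g x)) \<partial>I01)"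
    by (simp add: nn_integral_cmult nn_integral_multc)
  also have "\<dots> < \<infinity>" using f g by (auto simp: integrable_iff_bounded ennreal_mult_less_top)
  finally show "(\<integral>\<^sup>+p. ennreal (norm (f (fst p) * g (snd p))) \<partial>I01x2) < \<infinity>" .
qed

text \<open>The logarithmic derivative of \<open>t\<^sup>p (1 - t)\<^sup>1\<^sup>-\<^sup>\<alpha> (1 - w t)\<^sup>-\<^sup>\<alpha>\<close> times \<open>t (1 - t)\<close>.\<close>
definition dlog :: "real \<Rightarrow> real \<Rightarrow> real \<Rightarrow> real \<Rightarrow> real" where
  "dlog \<alpha> p w t = p * (1 - t) - (1 - \<alpha>) * t + \<alpha> * t * (1 - t) * w / (1 - w * t)"

text \<open>The factor through which one of the two variables enters \<open>selberg_fn\<close> below when the other has the value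
  \<open>w\<close>.\<close>
definition beta_weight :: "real \<Rightarrow> real \<Rightarrow> real \<Rightarrow> real \<Rightarrow> real" where
  "beta_weight \<alpha> p w t = t powr (p - 1) * (1 - t) powr (- \<alpha>) * (1 - w * t) powr (- \<alpha>)"

text \<open>Selberg's integrand \<open>(x y)\<^sup>a\<^sup>-\<^sup>1 ((1 - x) (1 - y) \<bar>x - y\<bar>)\<^sup>-\<^sup>\<alpha>\<close> on the triangle \<open>x < y\<close>, in the coordinates
  \<open>(s, y)\<close> with \<open>x = s y\<close> and including their Jacobian. They turn the triangle into a square, on which
  Fubini's theorem applies, and put the singularity of the diagonal on the side \<open>s = 1\<close>.\<close>
definition selberg_fn :: "real \<Rightarrow> real \<Rightarrow> real \<times> real \<Rightarrow> real" where
  "selberg_fn \<alpha> a = (\<lambda>(s, y). s powr (a - 1) * y powr (2 * a - 1 - \<alpha>)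
     * ((1 - s) * (1 - y) * (1 - s * y)) powr (- \<alpha>))"

definition selberg_int :: "real \<Rightarrow> real \<Rightarrow> real" where
  "selberg_int \<alpha> a = (LINT p|I01x2. selberg_fn \<alpha> a p)"

lemma selberg_fn_measurable [measurable]: "selberg_fn \<alpha> a \<in> borel_measurable I01x2"
  unfolding selberg_fn_def split_beta by measurable

lemma selberg_fn_nonneg: "selberg_fn \<alpha> a p \<ge> 0"
  by (simp add: selberg_fn_def split_beta)

lemma selberg_int_nonneg: "selberg_int \<alpha> a \<ge> 0"
  unfolding selberg_int_def by (intro integral_nonneg_AE) (simp add: selberg_fn_nonneg)

context
  fixes \<alpha> :: real
  assumes \<alpha>: "0 < \<alpha>" "\<alpha> < 1 / 2"
begin

lemma dlog_bound:
  assumes "0 < p" "0 < w" "w < 1" "0 < t" "t < 1"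
  shows "\<bar>dlog \<alpha> p w t\<bar> \<le> p + 2"
proof -
  have wt: "0 < w * t" "w * t < 1" using assms mult_strict_mono[of w 1 t 1] by simp_all
  have "t * (1 - t) * w / (1 - w * t) \<le> 1"
  proof -
    have "t * w * (1 - t) \<le> 1 * (1 - t)" using assms wt by (intro mult_right_mono) (auto simp: mult.commute)
    also have "\<dots> \<le> 1 - w * t" using assms mult_right_mono[of w 1 t] by simp
    finally show ?thesis using wt by (simp add: divide_le_eq mult_ac)
  qed
  moreover have "0 \<le> t * (1 - t) * w / (1 - w * t)" using assms wt by auto
  ultimately have 1: "0 \<le> \<alpha> * (t * (1 - t) * w / (1 - w * t))" "\<alpha> * (t * (1 - t) * w / (1 - w * t)) \<le> 1"
    using \<alpha> mult_mono[of \<alpha> 1 "t * (1 - t) * w / (1 - w * t)" 1]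
      mult_nonneg_nonneg[of \<alpha> "t * (1 - t) * w / (1 - w * t)"] by simp_all
  have 2: "0 \<le> p * (1 - t)" "p * (1 - t) \<le> p" using assms by (auto simp: mult_left_le)
  have 3: "0 \<le> (1 - \<alpha>) * t" "(1 - \<alpha>) * t \<le> 1" using assms \<alpha> mult_mono[of "1 - \<alpha>" 1 t 1] by auto
  have "dlog \<alpha> p w t = p * (1 - t) - (1 - \<alpha>) * t + \<alpha> * (t * (1 - t) * w / (1 - w * t))"
    by (simp add: dlog_def mult_ac)
  thus ?thesis using 1 2 3 by linarith
qed

text \<open>The integrand is the derivative of \<open>t\<^sup>p (1 - t)\<^sup>1\<^sup>-\<^sup>\<alpha> (1 - w t)\<^sup>-\<^sup>\<alpha>\<close>, which vanishes at both
  ends of the interval.\<close>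
lemma integral_dlog_beta_weight:
  assumes p: "0 < p" and w: "0 < w" "w < 1"
  shows "(LINT t|I01. dlog \<alpha> p w t * beta_weight \<alpha> p w t) = 0"
proof (rule integral_I01_eqI)
  have [measurable]: "beta_weight \<alpha> p w \<in> borel_measurable I01" "dlog \<alpha> p w \<in> borel_measurable I01"
    unfolding beta_weight_def dlog_def by measurable
  show "integrable I01 (\<lambda>t. dlog \<alpha> p w t * beta_weight \<alpha> p w t)"
  proof (rule Bochner_Integration.integrable_bound)
    show "integrable I01 (\<lambda>t. (p + 2) * (1 - w) powr (- \<alpha>) * (t powr (p - 1) * (1 - t) powr ((1 - \<alpha>) - 1)))"
      using p \<alpha> by (intro integrable_mult_right Beta_I01) auto
    show "AE t in I01. norm (dlog \<alpha> p w t * beta_weight \<alpha> p w t)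
        \<le> norm ((p + 2) * (1 - w) powr (- \<alpha>) * (t powr (p - 1) * (1 - t) powr ((1 - \<alpha>) - 1)))"
    proof (rule AE_I2)
      fix t assume t: "t \<in> space I01"
      hence t: "0 < t" "t < 1" by auto
      have "w * t \<le> w" using w t by (simp add: mult_left_le)
      hence "(1 - w * t) powr (- \<alpha>) \<le> (1 - w) powr (- \<alpha>)"
        using w \<alpha> by (intro powr_mono2') auto
      hence "\<bar>dlog \<alpha> p w t\<bar> * (t powr (p - 1) * (1 - t) powr (- \<alpha>) * (1 - w * t) powr (- \<alpha>))
          \<le> (p + 2) * (t powr (p - 1) * (1 - t) powr (- \<alpha>) * (1 - w) powr (- \<alpha>))"
        using dlog_bound[OF p w t] p by (intro mult_mono) auto
      thus "norm (dlog \<alpha> p w t * beta_weight \<alpha> p w t)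
        \<le> norm ((p + 2) * (1 - w) powr (- \<alpha>) * (t powr (p - 1) * (1 - t) powr ((1 - \<alpha>) - 1)))"
        using p by (simp add: beta_weight_def abs_mult mult_ac)
    qed
  qed measurable
  define G where "G t = t powr p * (1 - t) powr (1 - \<alpha>) * (1 - w * t) powr (- \<alpha>)" for t
  have wt: "w * t < 1" if "0 \<le> t" "t \<le> 1" for t
  proof -
    have "w * t \<le> w" using that w by (simp add: mult_left_le)
    thus ?thesis using w by linarith
  qed
  have "((\<lambda>t. dlog \<alpha> p w t * beta_weight \<alpha> p w t) has_integral G 1 - G 0) {0..1}"
  proof (rule fundamental_theorem_of_calculus_interior)
    show "continuous_on {0..1} G"
      unfolding G_def
      by (intro continuous_on_mult continuous_on_powr' continuous_intros) (use p \<alpha> wt in \<open>force+\<close>)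
    fix t :: real assume "t \<in> {0<..<1}"
    hence t: "0 < t" "t < 1" "w * t < 1" using wt[of t] by auto
    have e1: "t powr p = t * t powr (p - 1)" "(1 - t) powr (1 - \<alpha>) = (1 - t) * (1 - t) powr (- \<alpha>)"
      "(1 - w * t) powr (- \<alpha> - 1) = (1 - w * t) powr (- \<alpha>) / (1 - w * t)"
      using t by (simp_all add: powr_diff powr_minus field_simps)
    have alg: "(p * X) * ((1 - t) * Y) * Z + (t * X) * (- ((1 - \<alpha>) * Y)) * Z
        + (t * X) * ((1 - t) * Y) * (\<alpha> * w * (Z / D))
        = (p * (1 - t) - (1 - \<alpha>) * t + \<alpha> * t * (1 - t) * w / D) * (X * Y * Z)" for X Y Z D :: real
      by (cases "D = 0") (simp_all add: field_simps)
    have "(G has_real_derivative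
        (p * t powr (p - 1)) * (1 - t) powr (1 - \<alpha>) * (1 - w * t) powr (- \<alpha>)
        + t powr p * (- ((1 - \<alpha>) * (1 - t) powr (- \<alpha>))) * (1 - w * t) powr (- \<alpha>)
        + t powr p * (1 - t) powr (1 - \<alpha>) * (\<alpha> * w * (1 - w * t) powr (- \<alpha> - 1))) (at t)"
      unfolding G_def using t
      by (auto intro!: derivative_eq_intros simp: algebra_simps)
    also have "(p * t powr (p - 1)) * (1 - t) powr (1 - \<alpha>) * (1 - w * t) powr (- \<alpha>)
        + t powr p * (- ((1 - \<alpha>) * (1 - t) powr (- \<alpha>))) * (1 - w * t) powr (- \<alpha>)
        + t powr p * (1 - t) powr (1 - \<alpha>) * (\<alpha> * w * (1 - w * t) powr (- \<alpha> - 1))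
        = dlog \<alpha> p w t * beta_weight \<alpha> p w t"
      unfolding e1 dlog_def beta_weight_def by (rule alg)
    finally show "(G has_vector_derivative dlog \<alpha> p w t * beta_weight \<alpha> p w t) (at t)"
      by (simp add: has_real_derivative_iff_has_vector_derivative)
  qed simp
  moreover have "G 1 = 0" "G 0 = 0" by (simp_all add: G_def)
  ultimately show "((\<lambda>t. dlog \<alpha> p w t * beta_weight \<alpha> p w t) has_integral 0) {0..1}" by simp
qed

lemma selberg_fn_split:
  assumes "0 < s" "s < 1" "0 < y" "y < 1"
  shows "selberg_fn \<alpha> a (s, y) = y powr (2 * a - 1 - \<alpha>) * (1 - y) powr (- \<alpha>) * beta_weight \<alpha> a y s"
    and "selberg_fn \<alpha> a (s, y) = s powr (a - 1) * (1 - s) powr (- \<alpha>) * beta_weight \<alpha> (2 * a - \<alpha>) s y"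
    and "y * selberg_fn \<alpha> a (s, y) = s powr (a - 1) * (1 - s) powr (- \<alpha>) * beta_weight \<alpha> (2 * a - \<alpha> + 1) s y"
    and "selberg_fn \<alpha> (a + 1) (s, y) = s * y\<^sup>2 * selberg_fn \<alpha> a (s, y)"
proof -
  have sy: "s * y < 1" using assms mult_strict_mono[of s 1 y 1] by simp
  have m: "((1 - s) * (1 - y) * (1 - s * y)) powr (- \<alpha>)
      = (1 - s) powr (- \<alpha>) * (1 - y) powr (- \<alpha>) * (1 - s * y) powr (- \<alpha>)"
    using assms sy by (simp add: powr_mult)
  show "selberg_fn \<alpha> a (s, y) = y powr (2 * a - 1 - \<alpha>) * (1 - y) powr (- \<alpha>) * beta_weight \<alpha> a y s"
    unfolding selberg_fn_def split m beta_weight_def by (simp add: mult_ac)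
  have e: "2 * a - 1 - \<alpha> = 2 * a - \<alpha> - 1" by simp
  show 2: "selberg_fn \<alpha> a (s, y) = s powr (a - 1) * (1 - s) powr (- \<alpha>) * beta_weight \<alpha> (2 * a - \<alpha>) s y"
    unfolding selberg_fn_def split m beta_weight_def e by (simp add: mult_ac)
  have e': "y powr (2 * a - \<alpha> + 1 - 1) = y * y powr (2 * a - \<alpha> - 1)" 
    using assms by (simp add: powr_diff)
  show "y * selberg_fn \<alpha> a (s, y) = s powr (a - 1) * (1 - s) powr (- \<alpha>) * beta_weight \<alpha> (2 * a - \<alpha> + 1) s y"
    unfolding 2 beta_weight_def e' by (simp add: mult_ac)
  have "s powr (a + 1 - 1) = s * s powr (a - 1)" "y powr (2 * (a + 1) - 1 - \<alpha>) = y\<^sup>2 * y powr (2 * a - 1 - \<alpha>)"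
    using assms powr_add[of s "a - 1" 1] powr_add[of y "2 * a - 1 - \<alpha>" 2] by (simp_all add: algebra_simps)
  thus "selberg_fn \<alpha> (a + 1) (s, y) = s * y\<^sup>2 * selberg_fn \<alpha> a (s, y)"
    by (simp add: selberg_fn_def mult_ac)
qed

lemma selberg_fn_integrable:
  assumes "2 * a > \<alpha>"
  shows "integrable I01x2 (selberg_fn \<alpha> a)"
proof (rule Bochner_Integration.integrable_bound)
  show "integrable I01x2 (\<lambda>p. (fst p powr (a - 1) * (1 - fst p) powr ((1 - 2 * \<alpha>) - 1))
      * (snd p powr ((2 * a - \<alpha>) - 1) * (1 - snd p) powr ((1 - \<alpha>) - 1)))"
    using assms \<alpha> by (intro integrable_tensor Beta_I01) auto
  show "AE p in I01x2. norm (selberg_fn \<alpha> a p) \<le> norm ((fst p powr (a - 1) * (1 - fst p) powr ((1 - 2 * \<alpha>) - 1))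
      * (snd p powr ((2 * a - \<alpha>) - 1) * (1 - snd p) powr ((1 - \<alpha>) - 1)))"
  proof (rule AE_I01x2_I)
    fix s y :: real assume sy: "0 < s" "s < 1" "0 < y" "y < 1"
    have "(1 - s * y) powr (- \<alpha>) \<le> (1 - s) powr (- \<alpha>)"
      using sy \<alpha> by (intro powr_mono2') (auto simp: mult_left_le)
    hence "y powr (2 * a - \<alpha> - 1) * (1 - y) powr (- \<alpha>) * beta_weight \<alpha> a y s
        \<le> y powr (2 * a - \<alpha> - 1) * (1 - y) powr (- \<alpha>) * (s powr (a - 1) * (1 - s) powr (- \<alpha>) * (1 - s) powr (- \<alpha>))"
      unfolding beta_weight_def by (intro mult_left_mono) (auto simp: mult.commute)
    moreover have "(1 - s) powr (- \<alpha>) * (1 - s) powr (- \<alpha>) = (1 - s) powr (- (2 * \<alpha>))"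
      by (simp add: powr_add[symmetric])
    ultimately show "norm (selberg_fn \<alpha> a (s, y)) \<le> norm ((fst (s, y) powr (a - 1) * (1 - fst (s, y)) powr ((1 - 2 * \<alpha>) - 1))
      * (snd (s, y) powr ((2 * a - \<alpha>) - 1) * (1 - snd (s, y)) powr ((1 - \<alpha>) - 1)))"
      using selberg_fn_nonneg[of \<alpha> a "(s, y)"] by (simp add: selberg_fn_split(1)[OF sy] algebra_simps)
  qed
qed measurable

lemma selberg_fn_bounded_integrable:
  assumes a: "2 * a > \<alpha>" and [measurable]: "g \<in> borel_measurable I01x2"
    and "\<And>s y. 0 < s \<Longrightarrow> s < 1 \<Longrightarrow> 0 < y \<Longrightarrow> y < 1 \<Longrightarrow> \<bar>g (s, y)\<bar> \<le> C"
  shows "integrable I01x2 (\<lambda>p. g p * selberg_fn \<alpha> a p)"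
proof (rule Bochner_Integration.integrable_bound)
  show "integrable I01x2 (\<lambda>p. C * selberg_fn \<alpha> a p)" by (intro integrable_mult_right selberg_fn_integrable a)
  show "AE p in I01x2. norm (g p * selberg_fn \<alpha> a p) \<le> norm (C * selberg_fn \<alpha> a p)"
    using selberg_fn_nonneg
    by (intro AE_I01x2_I) (auto simp: abs_mult intro!: mult_right_mono order.trans[OF assms(3)])
qed measurable

text \<open>Aomoto's argument in the coordinates \<open>(s, y)\<close>, \<open>x = s y\<close>. The vector fields
  \<open>(x (1 - x), y (1 - y))\<close> and \<open>(x y (1 - x), x y (1 - y))\<close> preserve the triangle \<open>x < y\<close>, so the
  divergences of their products with the integrand integrate to \<open>0\<close>. In the new coordinates both have
  the \<open>s\<close>-component \<open>s (1 - s) y\<close> (integral \<open>A\<close>), and their \<open>y\<close>-components are \<open>y (1 - y)\<close> (integral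
  \<open>B\<close>) and \<open>s y\<^sup>2 (1 - y)\<close> (integral \<open>C\<close>). In \<open>A + B\<close> and \<open>A + C\<close> the denominators \<open>1 - s y\<close> cancel;
  eliminating the moment \<open>m\<close> of \<open>x + y\<close> leaves the recursion.\<close>
lemma selberg_int_recursion:
  assumes a: "2 * a > \<alpha>"
  shows "(a + 1 - 2 * \<alpha>) * (2 * a + 2 - 3 * \<alpha>) * selberg_int \<alpha> (a + 1) = a * (2 * a - \<alpha>) * selberg_int \<alpha> a"
proof -
  have dm [measurable]: "(\<lambda>p. dlog \<alpha> q (snd p) (fst p)) \<in> borel_measurable I01x2"
    "(\<lambda>p. dlog \<alpha> q (fst p) (snd p)) \<in> borel_measurable I01x2" for q
    unfolding dlog_def by measurable
  have a0: "a > 0" "2 * a - \<alpha> > 0" "2 * a - \<alpha> + 1 > 0" using a \<alpha> by auto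
  have mbd: "\<bar>u * v\<bar> \<le> c" if "0 \<le> u" "u \<le> 1" "\<bar>v\<bar> \<le> c" for u v c :: real
    using mult_mono[of "\<bar>u\<bar>" 1 "\<bar>v\<bar>" c] that by (simp add: abs_mult)
  have iA: "integrable I01x2 (\<lambda>p. snd p * dlog \<alpha> a (snd p) (fst p) * selberg_fn \<alpha> a p)"
    by (rule selberg_fn_bounded_integrable[OF a, where C = "a + 2"])
      (use a0 in \<open>auto intro!: mbd dlog_bound\<close>)
  have iB: "integrable I01x2 (\<lambda>p. dlog \<alpha> (2 * a - \<alpha>) (fst p) (snd p) * selberg_fn \<alpha> a p)"
    by (rule selberg_fn_bounded_integrable[OF a, where C = "2 * a - \<alpha> + 2"])
      (use a0 in \<open>auto intro!: dlog_bound\<close>)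
  have iC: "integrable I01x2 (\<lambda>p. fst p * snd p * dlog \<alpha> (2 * a - \<alpha> + 1) (fst p) (snd p) * selberg_fn \<alpha> a p)"
    by (rule selberg_fn_bounded_integrable[OF a, where C = "2 * a - \<alpha> + 1 + 2"])
      (use a0 in \<open>auto intro!: mbd order.trans[OF dlog_bound] simp: mult_le_one\<close>)
  have A: "(LINT p|I01x2. snd p * dlog \<alpha> a (snd p) (fst p) * selberg_fn \<alpha> a p) = 0"
  proof -
    have "(LINT p|I01x2. snd p * dlog \<alpha> a (snd p) (fst p) * selberg_fn \<alpha> a p)
        = (LINT y|I01. LINT s|I01. y * dlog \<alpha> a y s * selberg_fn \<alpha> a (s, y))"
      using I01x2.integral_snd[of "\<lambda>s y. y * dlog \<alpha> a y s * selberg_fn \<alpha> a (s, y)"] iA by (simp add: split_beta')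
    also have "\<dots> = (LINT y|I01. LINT s|I01. (y * y powr (2 * a - 1 - \<alpha>) * (1 - y) powr (- \<alpha>)) * (dlog \<alpha> a y s * beta_weight \<alpha> a y s))"
      by (intro Bochner_Integration.integral_cong refl) (auto simp: selberg_fn_split(1) mult_ac)
    also have "\<dots> = (LINT y|I01. 0)"
      by (intro Bochner_Integration.integral_cong refl) (auto simp: integral_dlog_beta_weight a a0)
    finally show ?thesis by simp
  qed
  have B: "(LINT p|I01x2. dlog \<alpha> (2 * a - \<alpha>) (fst p) (snd p) * selberg_fn \<alpha> a p) = 0"
  proof -
    have "(LINT p|I01x2. dlog \<alpha> (2 * a - \<alpha>) (fst p) (snd p) * selberg_fn \<alpha> a p)
        = (LINT s|I01. LINT y|I01. dlog \<alpha> (2 * a - \<alpha>) s y * selberg_fn \<alpha> a (s, y))"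
      using I01x2.integral_fst'[OF iB] by simp
    also have "\<dots> = (LINT s|I01. LINT y|I01. (s powr (a - 1) * (1 - s) powr (- \<alpha>)) * (dlog \<alpha> (2 * a - \<alpha>) s y * beta_weight \<alpha> (2 * a - \<alpha>) s y))"
      by (intro Bochner_Integration.integral_cong refl) (auto simp: selberg_fn_split(2) mult_ac)
    also have "\<dots> = (LINT y|I01. 0)"
      by (intro Bochner_Integration.integral_cong refl) (auto simp: integral_dlog_beta_weight a a0)
    finally show ?thesis by simp
  qed
  have C: "(LINT p|I01x2. fst p * snd p * dlog \<alpha> (2 * a - \<alpha> + 1) (fst p) (snd p) * selberg_fn \<alpha> a p) = 0"
  proof -
    have "(LINT p|I01x2. fst p * snd p * dlog \<alpha> (2 * a - \<alpha> + 1) (fst p) (snd p) * selberg_fn \<alpha> a p)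
        = (LINT s|I01. LINT y|I01. s * dlog \<alpha> (2 * a - \<alpha> + 1) s y * (y * selberg_fn \<alpha> a (s, y)))"
      using I01x2.integral_fst'[OF iC] by (simp add: mult_ac)
    also have "\<dots> = (LINT s|I01. LINT y|I01. (s * s powr (a - 1) * (1 - s) powr (- \<alpha>)) * (dlog \<alpha> (2 * a - \<alpha> + 1) s y * beta_weight \<alpha> (2 * a - \<alpha> + 1) s y))"
      by (intro Bochner_Integration.integral_cong refl) (auto simp: selberg_fn_split(3) mult_ac)
    also have "\<dots> = (LINT y|I01. 0)"
      by (intro Bochner_Integration.integral_cong refl) (auto simp: integral_dlog_beta_weight a a0)
    finally show ?thesis by simp
  qed
  have iF: "integrable I01x2 (selberg_fn \<alpha> a)" by (rule selberg_fn_integrable[OF a])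
  have iM: "integrable I01x2 (\<lambda>p. (snd p + fst p * snd p) * selberg_fn \<alpha> a p)"
  proof (rule selberg_fn_bounded_integrable[OF a, where C = 2])
    fix s y :: real assume sy: "0 < s" "s < 1" "0 < y" "y < 1"
    have "s * y \<le> 1" "0 \<le> s * y" using sy by (simp_all add: mult_le_one)
    thus "\<bar>snd (s, y) + fst (s, y) * snd (s, y)\<bar> \<le> 2" using sy by simp
  qed measurable
  define m where "m = (LINT p|I01x2. (snd p + fst p * snd p) * selberg_fn \<alpha> a p)"
  have "0 = (LINT p|I01x2. snd p * dlog \<alpha> a (snd p) (fst p) * selberg_fn \<alpha> a p
      + dlog \<alpha> (2 * a - \<alpha>) (fst p) (snd p) * selberg_fn \<alpha> a p)"
    using A B iA iB by simp
  also have "\<dots> = (LINT p|I01x2. (2 * a - \<alpha>) * selberg_fn \<alpha> a p - (a + 1 - 2 * \<alpha>) * ((snd p + fst p * snd p) * selberg_fn \<alpha> a p))"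
  proof (rule integral_cong_AE, (measurable)[2], rule AE_I01x2_I)
    fix s y :: real assume sy: "0 < s" "s < 1" "0 < y" "y < 1"
    have "1 - s * y \<noteq> 0" using sy mult_strict_mono[of s 1 y 1] by simp
    hence "y * dlog \<alpha> a y s + dlog \<alpha> (2 * a - \<alpha>) s y = (2 * a - \<alpha>) - (a + 1 - 2 * \<alpha>) * (y + s * y)"
      by (simp add: dlog_def divide_simps mult.commute[of y s]) (simp add: algebra_simps)
    thus "snd (s, y) * dlog \<alpha> a (snd (s, y)) (fst (s, y)) * selberg_fn \<alpha> a (s, y)
        + dlog \<alpha> (2 * a - \<alpha>) (fst (s, y)) (snd (s, y)) * selberg_fn \<alpha> a (s, y)
        = (2 * a - \<alpha>) * selberg_fn \<alpha> a (s, y) - (a + 1 - 2 * \<alpha>) * ((snd (s, y) + fst (s, y) * snd (s, y)) * selberg_fn \<alpha> a (s, y))"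
      by (metis (no_types, opaque_lifting) distrib_right fst_conv left_diff_distrib mult.assoc snd_conv)
  qed
  also have "\<dots> = (2 * a - \<alpha>) * selberg_int \<alpha> a - (a + 1 - 2 * \<alpha>) * m"
    using iF iM by (simp add: selberg_int_def m_def)
  finally have 1: "(2 * a - \<alpha>) * selberg_int \<alpha> a = (a + 1 - 2 * \<alpha>) * m" by simp
  have iF1: "integrable I01x2 (selberg_fn \<alpha> (a + 1))" using a by (intro selberg_fn_integrable) auto
  have "0 = (LINT p|I01x2. snd p * dlog \<alpha> a (snd p) (fst p) * selberg_fn \<alpha> a p
      + fst p * snd p * dlog \<alpha> (2 * a - \<alpha> + 1) (fst p) (snd p) * selberg_fn \<alpha> a p)"
    using A C iA iC by simp
  also have "\<dots> = (LINT p|I01x2. a * ((snd p + fst p * snd p) * selberg_fn \<alpha> a p) - (2 * a + 2 - 3 * \<alpha>) * selberg_fn \<alpha> (a + 1) p)"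
  proof (rule integral_cong_AE, (measurable)[2], rule AE_I01x2_I)
    fix s y :: real assume sy: "0 < s" "s < 1" "0 < y" "y < 1"
    have "1 - s * y \<noteq> 0" using sy mult_strict_mono[of s 1 y 1] by simp
    hence "y * dlog \<alpha> a y s + s * y * dlog \<alpha> (2 * a - \<alpha> + 1) s y = a * (y + s * y) - (2 * a + 2 - 3 * \<alpha>) * (s * y\<^sup>2)"
      by (simp add: dlog_def divide_simps mult.commute[of y s]) (simp add: algebra_simps power2_eq_square)
    thus "snd (s, y) * dlog \<alpha> a (snd (s, y)) (fst (s, y)) * selberg_fn \<alpha> a (s, y)
        + fst (s, y) * snd (s, y) * dlog \<alpha> (2 * a - \<alpha> + 1) (fst (s, y)) (snd (s, y)) * selberg_fn \<alpha> a (s, y)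
        = a * ((snd (s, y) + fst (s, y) * snd (s, y)) * selberg_fn \<alpha> a (s, y)) - (2 * a + 2 - 3 * \<alpha>) * selberg_fn \<alpha> (a + 1) (s, y)"
      unfolding selberg_fn_split(4)[OF sy] fst_conv snd_conv
      by (metis (no_types, opaque_lifting) distrib_right left_diff_distrib mult.assoc)
  qed
  also have "\<dots> = a * m - (2 * a + 2 - 3 * \<alpha>) * selberg_int \<alpha> (a + 1)"
    using iF1 iM by (simp add: selberg_int_def m_def)
  finally have 2: "a * m = (2 * a + 2 - 3 * \<alpha>) * selberg_int \<alpha> (a + 1)" by simp
  have "(a + 1 - 2 * \<alpha>) * (2 * a + 2 - 3 * \<alpha>) * selberg_int \<alpha> (a + 1) = (a + 1 - 2 * \<alpha>) * (a * m)"
    by (simp add: 2)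
  also have "\<dots> = a * ((2 * a - \<alpha>) * selberg_int \<alpha> a)" by (simp add: 1)
  finally show ?thesis by simp
qed

lemma selberg_int_antimono:
  assumes "2 * a > \<alpha>" "a \<le> b" shows "selberg_int \<alpha> b \<le> selberg_int \<alpha> a"
  unfolding selberg_int_def
proof (rule integral_mono_AE)
  show "integrable I01x2 (selberg_fn \<alpha> a)" "integrable I01x2 (selberg_fn \<alpha> b)"
    using assms by (auto intro!: selberg_fn_integrable)
  show "AE p in I01x2. selberg_fn \<alpha> b p \<le> selberg_fn \<alpha> a p"
    by (rule AE_I01x2_I, unfold selberg_fn_def split)
      (use assms in \<open>auto intro!: mult_mono powr_mono'\<close>)
qed

end

lemma nn_integral_I01: "(\<integral>\<^sup>+x. f x \<partial>I01) = (\<integral>\<^sup>+x. f x * indicator {0<..<1} x \<partial>lborel)"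
  by (rule nn_integral_restrict_space) simp

lemma nn_integral_I01_scale:
  assumes [measurable]: "g \<in> borel_measurable borel" and z: "0 < z" "z < 1"
  shows "(\<integral>\<^sup>+x. g x * indicator {..<z} x \<partial>I01) = (\<integral>\<^sup>+s. ennreal z * g (z * s) \<partial>I01)"
proof -
  have "(\<integral>\<^sup>+x. g x * indicator {..<z} x \<partial>I01)
      = ennreal z * (\<integral>\<^sup>+s. g (0 + z * s) * indicator {..<z} (0 + z * s) * indicator {0<..<1} (0 + z * s) \<partial>lborel)"
    unfolding nn_integral_I01 using z by (subst nn_integral_real_affine[of _ z 0]) auto
  also have "(\<integral>\<^sup>+s. g (0 + z * s) * indicator {..<z} (0 + z * s) * indicator {0<..<1} (0 + z * s) \<partial>lborel)
      = (\<integral>\<^sup>+s. g (z * s) \<partial>I01)"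
    unfolding nn_integral_I01
  proof (intro nn_integral_cong)
    fix s
    have "z * s < z \<longleftrightarrow> s < 1" "0 < z * s \<longleftrightarrow> 0 < s" using z by (auto simp: zero_less_mult_iff)
    moreover have "z * s < 1" if "z * s < z" using that z by linarith
    ultimately show "g (0 + z * s) * indicator {..<z} (0 + z * s) * indicator {0<..<1} (0 + z * s)
      = g (z * s) * indicator {0<..<1} s"
      by (auto simp: indicator_def)
  qed
  also have "ennreal z * \<dots> = (\<integral>\<^sup>+s. ennreal z * g (z * s) \<partial>I01)"
  proof (rule nn_integral_cmult[symmetric])
    show "(\<lambda>s. g (z * s)) \<in> borel_measurable I01"
      by (rule measurable_compose[of "\<lambda>s. z * s" I01 borel]) measurable
  qed
  finally show ?thesis .
qed

lemma nn_integral_I01_reflect: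
  assumes [measurable]: "g \<in> borel_measurable borel"
  shows "(\<integral>\<^sup>+x. g x \<partial>I01) = (\<integral>\<^sup>+x. g (1 - x) \<partial>I01)"
proof -
  have "(\<integral>\<^sup>+x. g x \<partial>I01) = (\<integral>\<^sup>+s. g (1 + (-1) * s) * indicator {0<..<1} (1 + (-1) * s) \<partial>lborel)"
    unfolding nn_integral_I01 by (subst nn_integral_real_affine[of _ "-1" 1]) auto
  also have "\<dots> = (\<integral>\<^sup>+x. g (1 - x) \<partial>I01)"
    unfolding nn_integral_I01 by (intro nn_integral_cong) (auto simp: indicator_def)
  finally show ?thesis .
qed

lemma nn_integral_Beta:
  assumes "p > 0" "q > (0 :: real)"
  shows "(\<integral>\<^sup>+t. ennreal (t powr (p - 1) * (1 - t) powr (q - 1)) \<partial>I01) = ennreal (Beta p q)"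
  using nn_integral_eq_integral[OF Beta_I01(1)[OF assms]] Beta_I01(2)[OF assms] by simp

lemma Beta_1_right:
  assumes "p > 0" shows "Beta p 1 = 1 / (p :: real)"
proof -
  have "p \<notin> \<int>\<^sub>\<le>\<^sub>0" using assms by (auto simp: nonpos_Ints_def)
  thus ?thesis using assms by (simp add: Beta_def Gamma_plus1 Gamma_eq_zero_iff)
qed

lemma nn_integral_powr_I01:
  assumes "p > (0 :: real)"
  shows "(\<integral>\<^sup>+t. ennreal (t powr (p - 1)) \<partial>I01) = ennreal (1 / p)"
proof -
  have "(\<integral>\<^sup>+t. ennreal (t powr (p - 1)) \<partial>I01) = (\<integral>\<^sup>+t. ennreal (t powr (p - 1) * (1 - t) powr (1 - 1)) \<partial>I01)"
    by (intro nn_integral_cong) auto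
  also have "\<dots> = ennreal (1 / p)" using assms by (subst nn_integral_Beta) (auto simp: Beta_1_right)
  finally show ?thesis .
qed

lemma AE_I01_neq: "AE x in I01. x \<noteq> (c :: real)"
proof -
  have "AE x in lborel. x \<noteq> c" by (rule AE_lborel_singleton)
  thus ?thesis by (subst AE_restrict_space_iff) auto
qed

lemma indicator_lessThan_measurable [measurable]:
  fixes f g :: "'b \<Rightarrow> real"
  assumes [measurable]: "f \<in> borel_measurable M" "g \<in> borel_measurable M"
  shows "(\<lambda>p. indicator {..<f p} (g p) :: ennreal) \<in> borel_measurable M"
  unfolding indicator_def lessThan_def mem_Collect_eq by measurable

lemma nn_integral_I01_sym:
  fixes f :: "real \<Rightarrow> real \<Rightarrow> ennreal"
  assumes m [measurable]: "(\<lambda>p. f (fst p) (snd p)) \<in> borel_measurable I01x2"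
    and sym: "\<And>x y. f x y = f y x"
  shows "(\<integral>\<^sup>+y. \<integral>\<^sup>+x. f x y \<partial>I01 \<partial>I01) = 2 * (\<integral>\<^sup>+y. \<integral>\<^sup>+x. f x y * indicator {..<y} x \<partial>I01 \<partial>I01)"
proof -
  have m' [measurable]: "(\<lambda>p. f (snd p) (fst p)) \<in> borel_measurable I01x2" using m sym by simp
  have ind: "(\<lambda>p. indicator {..<snd p} (fst p) :: ennreal) \<in> borel_measurable I01x2"
    "(\<lambda>p. indicator {..<fst p} (snd p) :: ennreal) \<in> borel_measurable I01x2"
    by measurable
  have my: "(\<lambda>x. f x y) \<in> borel_measurable I01" if "y \<in> space I01" for y
    using measurable_compose[OF measurable_Pair2'[OF that, of I01] m] by simp
  have iy: "(\<lambda>x. indicator {..<y} x :: ennreal) \<in> borel_measurable I01"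
    "(\<lambda>x. indicator {..<x} y :: ennreal) \<in> borel_measurable I01" for y :: real
    by measurable
  have "(\<integral>\<^sup>+y. \<integral>\<^sup>+x. f x y \<partial>I01 \<partial>I01)
      = (\<integral>\<^sup>+y. (\<integral>\<^sup>+x. f x y * indicator {..<y} x \<partial>I01) + (\<integral>\<^sup>+x. f x y * indicator {..<x} y \<partial>I01) \<partial>I01)"
  proof (intro nn_integral_cong)
    fix y assume y: "y \<in> space I01"
    have "(\<integral>\<^sup>+x. f x y \<partial>I01) = (\<integral>\<^sup>+x. f x y * indicator {..<y} x + f x y * indicator {..<x} y \<partial>I01)"
      by (intro nn_integral_cong_AE eventually_mono[OF AE_I01_neq[of y]]) (auto simp: indicator_def)
    also have "\<dots> = (\<integral>\<^sup>+x. f x y * indicator {..<y} x \<partial>I01) + (\<integral>\<^sup>+x. f x y * indicator {..<x} y \<partial>I01)"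
      by (intro nn_integral_add borel_measurable_times_ennreal my iy y)
    finally show "(\<integral>\<^sup>+x. f x y \<partial>I01) = \<dots>" .
  qed
  also have "\<dots> = (\<integral>\<^sup>+y. \<integral>\<^sup>+x. f x y * indicator {..<y} x \<partial>I01 \<partial>I01) + (\<integral>\<^sup>+y. \<integral>\<^sup>+x. f x y * indicator {..<x} y \<partial>I01 \<partial>I01)"
    using borel_measurable_times_ennreal[OF m' ind(2)] borel_measurable_times_ennreal[OF m' ind(1)] m' ind
    by (intro nn_integral_add I01.borel_measurable_nn_integral) (simp_all add: split_beta' sym)
  also have "(\<integral>\<^sup>+y. \<integral>\<^sup>+x. f x y * indicator {..<x} y \<partial>I01 \<partial>I01) = (\<integral>\<^sup>+x. \<integral>\<^sup>+y. f x y * indicator {..<x} y \<partial>I01 \<partial>I01)"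
    using borel_measurable_times_ennreal[OF m ind(1)] borel_measurable_times_ennreal[OF m ind(2)]
    by (intro I01x2.Fubini') (simp add: split_beta')
  also have "\<dots> = (\<integral>\<^sup>+y. \<integral>\<^sup>+x. f x y * indicator {..<y} x \<partial>I01 \<partial>I01)" by (simp add: sym)
  finally show ?thesis by (simp add: mult_2)
qed

text \<open>At the positive integers both functions agree. The quotient at \<open>a\<close> equals the quotient
  at \<open>a + n\<close>, and monotonicity compares the latter with values at neighbouring integers, whose
  ratios tend to \<open>1\<close>.\<close>
lemma recursion_unique:
  fixes f g \<rho> :: "real \<Rightarrow> real"
  assumes f_mono: "\<And>a b. a0 < a \<Longrightarrow> a \<le> b \<Longrightarrow> f b \<le> f a"
    and g_mono: "\<And>a b. a0 < a \<Longrightarrow> a \<le> b \<Longrightarrow> g b \<le> g a"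
    and g_pos: "\<And>a. a0 < a \<Longrightarrow> 0 < g a"
    and f_rec: "\<And>a. a0 < a \<Longrightarrow> f (a + 1) = \<rho> a * f a"
    and g_rec: "\<And>a. a0 < a \<Longrightarrow> g (a + 1) = \<rho> a * g a"
    and \<rho>: "(\<rho> \<longlongrightarrow> 1) at_top"
    and f1: "f 1 = g 1" and a0: "0 \<le> a0" "a0 < 1" and a: "a0 < a"
  shows "f a = g a"
proof -
  have nat: "f (real (Suc n)) = g (real (Suc n))" for n
  proof (induction n)
    case (Suc n)
    have "a0 < real (Suc n)" using a0 by simp
    from f_rec[OF this] g_rec[OF this] Suc show ?case by (simp add: add.commute)
  qed (use f1 in simp)
  have \<rho>_pos: "\<rho> x > 0" if "a0 < x" for x
    using g_rec[OF that] g_pos[OF that] g_pos[of "x + 1"] that by (simp add: zero_less_mult_iff)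
  have ratio: "f (a + real n) / g (a + real n) = f a / g a" for n
  proof (induction n)
    case (Suc n)
    have "a0 < a + real n" using a by simp
    from f_rec[OF this] g_rec[OF this] \<rho>_pos[OF this] Suc show ?case by (simp add: add_ac)
  qed simp
  define m where "m = nat \<lfloor>a\<rfloor>"
  have m: "real m \<le> a" "a \<le> real m + 1" using a a0 unfolding m_def by linarith+
  define k where "k n = real (Suc (n + m))" for n
  have k0: "a0 < k n" for n using a0 by (simp add: k_def)
  have bounds: "f a / g a \<le> 1 / \<rho> (k n)" "\<rho> (k n) \<le> f a / g a" for n
  proof -
    have kn: "k n \<le> a + real (Suc n)" "a + real (Suc n) \<le> k n + 1" using m by (simp_all add: k_def)
    have an: "a0 < a + real (Suc n)" using a by simp
    have fk: "f (k n) = g (k n)" unfolding k_def by (rule nat)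
    have fk1: "f (k n + 1) = g (k n + 1)" using nat[of "Suc (n + m)"] by (simp add: k_def add_ac)
    have gk1: "g (k n + 1) > 0" using k0[of n] by (intro g_pos) simp
    have "f a / g a = f (a + real (Suc n)) / g (a + real (Suc n))" by (rule ratio[symmetric])
    also have "\<dots> \<le> g (k n) / g (k n + 1)"
      using f_mono[OF k0 kn(1)] g_mono[OF an kn(2)] fk gk1 g_pos[OF k0, of n] by (intro frac_le) auto
    also have "\<dots> = 1 / \<rho> (k n)" using g_rec[OF k0, of n] g_pos[OF k0, of n] by simp
    finally show "f a / g a \<le> 1 / \<rho> (k n)" .
    have "\<rho> (k n) = g (k n + 1) / g (k n)" using g_rec[OF k0, of n] g_pos[OF k0, of n] by simp
    also have "\<dots> \<le> f (a + real (Suc n)) / g (a + real (Suc n))"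
      using f_mono[OF an kn(2)] g_mono[OF k0 kn(1)] fk1 gk1 g_pos[OF an] by (intro frac_le) auto
    also have "\<dots> = f a / g a" by (rule ratio)
    finally show "\<rho> (k n) \<le> f a / g a" .
  qed
  have "filterlim k at_top sequentially"
    unfolding k_def by (rule filterlim_compose[OF filterlim_real_sequentially]) 
      (rule filterlim_compose[OF filterlim_Suc filterlim_add_const_nat_at_top])
  hence lim: "(\<lambda>n. \<rho> (k n)) \<longlonglongrightarrow> 1" by (rule filterlim_compose[OF \<rho>])
  have "f a / g a \<ge> 1" by (rule LIMSEQ_le_const2[OF lim]) (use bounds in auto)
  moreover have "f a / g a \<le> 1 / 1"
    by (rule LIMSEQ_le_const[OF tendsto_divide[OF tendsto_const lim]]) (use bounds in auto)
  ultimately show ?thesis using g_pos[OF a] by simp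
qed

context
  fixes \<alpha> :: real
  assumes \<alpha>: "0 < \<alpha>" "\<alpha> < 1 / 2"
begin

lemma nn_integral_selberg_fn:
  assumes "2 * a > \<alpha>"
  shows "(\<integral>\<^sup>+y. \<integral>\<^sup>+s. ennreal (selberg_fn \<alpha> a (s, y)) \<partial>I01 \<partial>I01) = ennreal (selberg_int \<alpha> a)"
proof -
  have "(\<integral>\<^sup>+y. \<integral>\<^sup>+s. ennreal (selberg_fn \<alpha> a (s, y)) \<partial>I01 \<partial>I01) = (\<integral>\<^sup>+p. ennreal (selberg_fn \<alpha> a p) \<partial>I01x2)"
    by (rule I01x2.nn_integral_snd) (use selberg_fn_measurable[of \<alpha> a] in measurable)
  also have "\<dots> = ennreal (selberg_int \<alpha> a)"
    unfolding selberg_int_def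
    by (rule nn_integral_eq_integral[OF selberg_fn_integrable[OF \<alpha> assms]]) (simp add: selberg_fn_nonneg)
  finally show ?thesis .
qed

text \<open>At \<open>a = 1\<close> the reflection \<open>(x, y) \<mapsto> (1 - y, 1 - x)\<close> turns the integral over \<open>x < y\<close> into one whose
  integrand is homogeneous, so that scaling separates the variables.\<close>
lemma selberg_int_1: "selberg_int \<alpha> 1 = Beta (1 - \<alpha>) (1 - \<alpha>) / (2 - 3 * \<alpha>)"
proof -
  define \<psi> where "\<psi> x y = ennreal (((1 - x) * (1 - y) * (y - x)) powr (- \<alpha>))" for x y :: real
  define \<phi> where "\<phi> x y = ennreal ((x * y * (y - x)) powr (- \<alpha>))" for x y :: real
  have [measurable]: "(\<lambda>p. \<psi> (f p) (g p)) \<in> borel_measurable M" "(\<lambda>p. \<phi> (f p) (g p)) \<in> borel_measurable M"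
    if [measurable]: "f \<in> borel_measurable M" "g \<in> borel_measurable M" for f g and M :: "'b measure"
    unfolding \<psi>_def \<phi>_def by measurable
  have "ennreal (selberg_int \<alpha> 1) = (\<integral>\<^sup>+y. \<integral>\<^sup>+s. ennreal (selberg_fn \<alpha> 1 (s, y)) \<partial>I01 \<partial>I01)"
    using \<alpha> by (subst nn_integral_selberg_fn) auto
  also have "\<dots> = (\<integral>\<^sup>+y. \<integral>\<^sup>+s. ennreal y * \<psi> (y * s) y \<partial>I01 \<partial>I01)"
  proof (intro nn_integral_cong)
    fix s y assume "y \<in> space I01" "s \<in> space I01"
    hence sy: "0 < y" "y < 1" "0 < s" "s < 1" by auto
    have "s * y < 1" using sy mult_strict_mono[of s 1 y 1] by simp
    hence "((1 - y * s) * (1 - y) * (y - y * s)) powr (- \<alpha>)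
        = ((1 - s) * (1 - y) * (1 - s * y)) powr (- \<alpha>) * y powr (- \<alpha>)"
      using sy by (subst powr_mult[symmetric]) (auto simp: algebra_simps)
    moreover have "y powr (2 * 1 - 1 - \<alpha>) = y * y powr (- \<alpha>)" using sy powr_add[of y 1 "- \<alpha>"] by simp
    ultimately show "ennreal (selberg_fn \<alpha> 1 (s, y)) = ennreal y * \<psi> (y * s) y"
      using sy by (simp add: selberg_fn_def \<psi>_def ennreal_mult'[symmetric] mult_ac)
  qed
  also have "\<dots> = (\<integral>\<^sup>+y. \<integral>\<^sup>+x. \<psi> x y * indicator {..<y} x \<partial>I01 \<partial>I01)"
    by (intro nn_integral_cong nn_integral_I01_scale[symmetric]) auto
  also have "\<dots> = (\<integral>\<^sup>+y. \<integral>\<^sup>+x. \<psi> (1 - x) (1 - y) * indicator {..<1 - y} (1 - x) \<partial>I01 \<partial>I01)"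
  proof -
    have "(\<integral>\<^sup>+y. \<integral>\<^sup>+x. \<psi> x y * indicator {..<y} x \<partial>I01 \<partial>I01)
        = (\<integral>\<^sup>+y. \<integral>\<^sup>+x. \<psi> x (1 - y) * indicator {..<1 - y} x \<partial>I01 \<partial>I01)"
      by (rule nn_integral_I01_reflect) measurable
    also have "\<dots> = (\<integral>\<^sup>+y. \<integral>\<^sup>+x. \<psi> (1 - x) (1 - y) * indicator {..<1 - y} (1 - x) \<partial>I01 \<partial>I01)"
      by (intro nn_integral_cong nn_integral_I01_reflect) measurable
    finally show ?thesis .
  qed
  also have "\<dots> = (\<integral>\<^sup>+y. \<integral>\<^sup>+x. \<phi> y x * indicator {..<x} y \<partial>I01 \<partial>I01)"
    by (intro nn_integral_cong) (auto simp: \<psi>_def \<phi>_def indicator_def mult_ac)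
  also have "\<dots> = (\<integral>\<^sup>+x. \<integral>\<^sup>+y. \<phi> y x * indicator {..<x} y \<partial>I01 \<partial>I01)"
    by (rule I01x2.Fubini') (simp add: split_beta')
  also have "\<dots> = (\<integral>\<^sup>+x. \<integral>\<^sup>+s. ennreal x * \<phi> (x * s) x \<partial>I01 \<partial>I01)"
    by (intro nn_integral_cong nn_integral_I01_scale) auto
  also have "\<dots> = (\<integral>\<^sup>+x. \<integral>\<^sup>+s. ennreal (x powr ((2 - 3 * \<alpha>) - 1)) * ennreal (s powr ((1 - \<alpha>) - 1) * (1 - s) powr ((1 - \<alpha>) - 1)) \<partial>I01 \<partial>I01)"
  proof (intro nn_integral_cong)
    fix s x assume "x \<in> space I01" "s \<in> space I01"
    hence sx: "0 < x" "x < 1" "0 < s" "s < 1" by auto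
    have "x * s * x * (x - x * s) = (x * x * x) * (s * (1 - s))" by (simp add: algebra_simps)
    moreover have "(x * x * x) powr (- \<alpha>) = x powr (- 3 * \<alpha>)"
      using sx by (simp add: powr_mult powr_add[symmetric])
    ultimately have "(x * s * x * (x - x * s)) powr (- \<alpha>) = x powr (- 3 * \<alpha>) * (s powr (- \<alpha>) * (1 - s) powr (- \<alpha>))"
      using sx by (simp add: powr_mult)
    moreover have "x powr ((2 - 3 * \<alpha>) - 1) = x * x powr (- 3 * \<alpha>)" using sx powr_add[of x 1 "- 3 * \<alpha>"] by simp
    ultimately show "ennreal x * \<phi> (x * s) x = ennreal (x powr ((2 - 3 * \<alpha>) - 1)) * ennreal (s powr ((1 - \<alpha>) - 1) * (1 - s) powr ((1 - \<alpha>) - 1))"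
      using sx by (simp add: \<phi>_def ennreal_mult'[symmetric] mult_ac)
  qed
  also have "\<dots> = ennreal (1 / (2 - 3 * \<alpha>)) * ennreal (Beta (1 - \<alpha>) (1 - \<alpha>))"
    using \<alpha> nn_integral_powr_I01[of "2 - 3 * \<alpha>"] nn_integral_Beta[of "1 - \<alpha>" "1 - \<alpha>"]
    by (simp add: nn_integral_cmult nn_integral_multc)
  also have "\<dots> = ennreal (Beta (1 - \<alpha>) (1 - \<alpha>) / (2 - 3 * \<alpha>))"
    using \<alpha> by (subst ennreal_mult'[symmetric]) auto
  finally show ?thesis
    using \<alpha> selberg_int_nonneg[of \<alpha> 1] Gamma_real_pos[of "1 - \<alpha>"] Gamma_real_pos[of "1 - \<alpha> + (1 - \<alpha>)"]
    by (subst (asm) ennreal_inj) (auto simp: Beta_def)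
qed

text \<open>The right-hand side is a constant multiple of
  \<open>Beta a q * Beta (a - \<alpha> / 2) q\<close> with \<open>q = 1 - 3 \<alpha> / 2\<close>, in which form the recursion and the
  monotonicity in \<open>a\<close> are evident.\<close>
lemma selberg_int_Gamma:
  assumes a: "2 * a > \<alpha>"
  shows "selberg_int \<alpha> a = (Gamma (1 - \<alpha>))\<^sup>2 * Gamma (1 - 3 * \<alpha> / 2) * Gamma a * Gamma (a - \<alpha> / 2)
    / (2 * Gamma (1 - \<alpha> / 2) * Gamma (a + 1 - 3 * \<alpha> / 2) * Gamma (a + 1 - 2 * \<alpha>))"
proof -
  define q where "q = 1 - 3 * \<alpha> / 2"
  have q: "q > 0" using \<alpha> by (simp add: q_def)
  define C where "C = selberg_int \<alpha> 1 / (Beta 1 q * Beta (1 - \<alpha> / 2) q)"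
  define g where "g a = C * (Beta a q * Beta (a - \<alpha> / 2) q)" for a
  have Beta_pos: "Beta x q > 0" if "x > 0" for x
    using that q Gamma_real_pos[of x] Gamma_real_pos[of q] Gamma_real_pos[of "x + q"] by (simp add: Beta_def)
  have F1: "selberg_int \<alpha> 1 > 0"
    unfolding selberg_int_1 using \<alpha> Gamma_real_pos[of "1 - \<alpha>"] Gamma_real_pos[of "1 - \<alpha> + (1 - \<alpha>)"] by (simp add: Beta_def)
  have C: "C > 0" using F1 Beta_pos[of 1] Beta_pos[of "1 - \<alpha> / 2"] \<alpha> by (simp add: C_def)
  define \<rho> where "\<rho> x = x * (2 * x - \<alpha>) / ((x + 1 - 2 * \<alpha>) * (2 * x + 2 - 3 * \<alpha>))" for x :: real
  have "selberg_int \<alpha> a = g a"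
  proof (rule recursion_unique[of "\<alpha> / 2" "selberg_int \<alpha>" g \<rho> a])
    show "selberg_int \<alpha> y \<le> selberg_int \<alpha> x" if "\<alpha> / 2 < x" "x \<le> y" for x y
      using that by (intro selberg_int_antimono[OF \<alpha>]) auto
    show "g y \<le> g x" if "\<alpha> / 2 < x" "x \<le> y" for x y
      unfolding g_def using that \<alpha> q C Beta_pos[of x] Beta_pos[of "y - \<alpha> / 2"]
      by (intro mult_left_mono mult_mono Beta_real_mono) (auto intro: less_imp_le Beta_pos)
    show "0 < g x" if "\<alpha> / 2 < x" for x
      using that \<alpha> C Beta_pos[of x] Beta_pos[of "x - \<alpha> / 2"] by (simp add: g_def)
    show "selberg_int \<alpha> (x + 1) = \<rho> x * selberg_int \<alpha> x" if "\<alpha> / 2 < x" for x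
    proof -
      have D: "(x + 1 - 2 * \<alpha>) * (2 * x + 2 - 3 * \<alpha>) \<noteq> 0" using that \<alpha> by auto
      have "((x + 1 - 2 * \<alpha>) * (2 * x + 2 - 3 * \<alpha>)) * selberg_int \<alpha> (x + 1) = (x * (2 * x - \<alpha>)) * selberg_int \<alpha> x"
        using selberg_int_recursion[OF \<alpha>, of x] that by simp
      moreover have "u = n / m * v" if "m * u = n * v" "m \<noteq> 0" for u v n m :: real
        using that by (simp add: field_simps)
      ultimately show ?thesis unfolding \<rho>_def using D by blast
    qed
    show "g (x + 1) = \<rho> x * g x" if x: "\<alpha> / 2 < x" for x
    proof -
      have n: "x \<notin> \<int>\<^sub>\<le>\<^sub>0" "x - \<alpha> / 2 \<notin> \<int>\<^sub>\<le>\<^sub>0" using x \<alpha> by (auto simp: nonpos_Ints_def)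
      have "(x + q) * Beta (x + 1) q = x * Beta x q" by (rule Beta_plus1_left[OF n(1)])
      hence 1: "Beta (x + 1) q = x / (x + q) * Beta x q" using x q \<alpha> by (simp add: field_simps)
      have "(x - \<alpha> / 2 + q) * Beta (x - \<alpha> / 2 + 1) q = (x - \<alpha> / 2) * Beta (x - \<alpha> / 2) q"
        by (rule Beta_plus1_left[OF n(2)])
      hence 2: "Beta (x + 1 - \<alpha> / 2) q = (x - \<alpha> / 2) / (x - \<alpha> / 2 + q) * Beta (x - \<alpha> / 2) q"
        using x q \<alpha> by (simp add: field_simps)
      have "\<rho> x = x / (x + q) * ((x - \<alpha> / 2) / (x - \<alpha> / 2 + q))"
        by (simp add: \<rho>_def q_def divide_simps) (simp add: algebra_simps)
      thus ?thesis unfolding g_def 1 2 by simp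
    qed
    show "(\<rho> \<longlongrightarrow> 1) at_top" unfolding \<rho>_def by real_asymp
    show "selberg_int \<alpha> 1 = g 1" using Beta_pos[of 1] Beta_pos[of "1 - \<alpha> / 2"] \<alpha> by (simp add: g_def C_def)
  qed (use \<alpha> a in auto)
  also have "g a = (Gamma (1 - \<alpha>))\<^sup>2 * Gamma (1 - 3 * \<alpha> / 2) * Gamma a * Gamma (a - \<alpha> / 2)
    / (2 * Gamma (1 - \<alpha> / 2) * Gamma (a + 1 - 3 * \<alpha> / 2) * Gamma (a + 1 - 2 * \<alpha>))"
  proof -
    have pos: "Gamma q > 0" "Gamma (2 - 2 * \<alpha>) > 0" "Gamma (1 - \<alpha> / 2) > 0" using q \<alpha> by auto
    have b1: "Beta 1 q = 1 / q" using Beta_1_right[OF q] by (simp add: Beta_commute)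
    have b2: "Beta (1 - \<alpha> / 2) q = Gamma (1 - \<alpha> / 2) * Gamma q / Gamma (2 - 2 * \<alpha>)"
      by (simp add: Beta_def q_def)
    have b3: "Beta (1 - \<alpha>) (1 - \<alpha>) = (Gamma (1 - \<alpha>))\<^sup>2 / Gamma (2 - 2 * \<alpha>)"
      by (simp add: Beta_def power2_eq_square)
    have b4: "2 - 3 * \<alpha> = 2 * q" by (simp add: q_def)
    have Cv: "C = (Gamma (1 - \<alpha>))\<^sup>2 / (2 * Gamma (1 - \<alpha> / 2) * Gamma q)"
      unfolding C_def selberg_int_1 b1 b2 b3 b4 using pos q by (simp add: divide_simps)
    have e: "a + q = a + 1 - 3 * \<alpha> / 2" "a - \<alpha> / 2 + q = a + 1 - 2 * \<alpha>" by (simp_all add: q_def)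
    have "g a = (Gamma (1 - \<alpha>))\<^sup>2 * Gamma q * Gamma a * Gamma (a - \<alpha> / 2)
      / (2 * Gamma (1 - \<alpha> / 2) * Gamma (a + 1 - 3 * \<alpha> / 2) * Gamma (a + 1 - 2 * \<alpha>))"
      unfolding g_def Beta_def Cv e using pos by (simp add: mult_ac)
    thus ?thesis by (simp add: q_def)
  qed
  finally show ?thesis .
qed

end

section \<open>The trace as a triple integral\<close>

definition wkernel :: "real \<Rightarrow> real \<Rightarrow> real \<Rightarrow> real \<Rightarrow> real" where
  "wkernel \<alpha> d x y = x powr (- d / 2) * y powr (- d / 2) * \<bar>x - y\<bar> powr (- \<alpha>)"

lemma wkernel_sym: "wkernel \<alpha> d x y = wkernel \<alpha> d y x"
  by (simp add: wkernel_def abs_minus_commute mult_ac)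

lemma wkernel_nonneg: "wkernel \<alpha> d x y \<ge> 0"
  by (simp add: wkernel_def)

lemma wkernel_measurable [measurable]:
  assumes [measurable]: "f \<in> borel_measurable M" "g \<in> borel_measurable M"
  shows "(\<lambda>p. wkernel \<alpha> d (f p) (g p)) \<in> borel_measurable M"
  unfolding wkernel_def by measurable

lemma wkernel_scale:
  assumes "0 < z" "0 \<le> u" "0 \<le> v"
  shows "wkernel \<alpha> d (z * u) (z * v) = z powr (- d - \<alpha>) * wkernel \<alpha> d u v"
proof -
  have "\<bar>z * u - z * v\<bar> = z * \<bar>u - v\<bar>" using assms by (simp add: right_diff_distrib[symmetric] abs_mult)
  moreover have "z powr (- d - \<alpha>) = z powr (- d / 2) * z powr (- d / 2) * z powr (- \<alpha>)"
    by (simp add: powr_add[symmetric])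
  ultimately show ?thesis using assms by (simp add: wkernel_def powr_mult)
qed

lemma T_op_eq_kernel_op: "T_op \<alpha> d = kernel_op (\<lambda>(x, y). wkernel \<alpha> d x y)"
  by (simp add: fun_eq_iff T_op_def kernel_op_def wkernel_def)

text \<open>The integrand of the trace of the third power, a product over the edges of a triangle.\<close>
definition cycle_kernel :: "real \<Rightarrow> real \<Rightarrow> real \<Rightarrow> real \<Rightarrow> real \<Rightarrow> real" where
  "cycle_kernel \<alpha> d x y z = wkernel \<alpha> d x y * wkernel \<alpha> d y z * wkernel \<alpha> d x z"

lemma cycle_kernel_measurable [measurable]:
  assumes [measurable]: "f \<in> borel_measurable M" "g \<in> borel_measurable M" "h \<in> borel_measurable M"
  shows "(\<lambda>p. cycle_kernel \<alpha> d (f p) (g p) (h p)) \<in> borel_measurable M"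
  unfolding cycle_kernel_def by measurable

lemma cycle_kernel_sym: "cycle_kernel \<alpha> d x y z = cycle_kernel \<alpha> d y x z" "cycle_kernel \<alpha> d x y z = cycle_kernel \<alpha> d x z y"
  using wkernel_sym[of \<alpha> d x y] wkernel_sym[of \<alpha> d y z] by (simp_all add: cycle_kernel_def mult_ac)

lemma cycle_kernel_nonneg: "cycle_kernel \<alpha> d x y z \<ge> 0"
  by (simp add: cycle_kernel_def wkernel_nonneg)

context
  fixes \<alpha> d :: real
  assumes \<alpha>: "0 < \<alpha>" "\<alpha> < 1 / 2" and d: "2 * d + 2 * \<alpha> < 1"
begin

lemma L2_wkernel: "L2 I01x2 (\<lambda>(x, y). wkernel \<alpha> d x y)"
proof -
  define f where "f x y = ennreal ((wkernel \<alpha> d x y)\<^sup>2)" for x y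
  have [measurable]: "(\<lambda>p. f (g p) (h p)) \<in> borel_measurable M"
    if [measurable]: "g \<in> borel_measurable M" "h \<in> borel_measurable M" for g h and M :: "'b measure"
    unfolding f_def by measurable
  have "(\<integral>\<^sup>+p. f (fst p) (snd p) \<partial>I01x2) = (\<integral>\<^sup>+y. \<integral>\<^sup>+x. f x y \<partial>I01 \<partial>I01)"
    by (subst I01x2.nn_integral_snd[symmetric]) auto
  also have "\<dots> = 2 * (\<integral>\<^sup>+y. \<integral>\<^sup>+x. f x y * indicator {..<y} x \<partial>I01 \<partial>I01)"
    by (rule nn_integral_I01_sym) (measurable, simp add: f_def wkernel_sym)
  also have "(\<integral>\<^sup>+y. \<integral>\<^sup>+x. f x y * indicator {..<y} x \<partial>I01 \<partial>I01) = (\<integral>\<^sup>+y. \<integral>\<^sup>+s. ennreal y * f (y * s) y \<partial>I01 \<partial>I01)"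
    by (intro nn_integral_cong nn_integral_I01_scale) auto
  also have "\<dots> = (\<integral>\<^sup>+y. \<integral>\<^sup>+s. ennreal (y powr ((2 - 2 * d - 2 * \<alpha>) - 1))
      * ennreal (s powr ((1 - d) - 1) * (1 - s) powr ((1 - 2 * \<alpha>) - 1)) \<partial>I01 \<partial>I01)"
  proof (intro nn_integral_cong)
    fix s y assume "y \<in> space I01" "s \<in> space I01"
    hence sy: "0 < y" "y < 1" "0 < s" "s < 1" by auto
    have "wkernel \<alpha> d (y * s) (y * 1) = y powr (- d - \<alpha>) * wkernel \<alpha> d s 1"
      using sy by (intro wkernel_scale) auto
    moreover have "wkernel \<alpha> d s 1 = s powr (- d / 2) * (1 - s) powr (- \<alpha>)" using sy by (simp add: wkernel_def)
    moreover have sq: "(u powr c)\<^sup>2 = u powr (2 * c)" for u c :: real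
      by (simp add: power2_eq_square powr_add[symmetric])
    ultimately have "(wkernel \<alpha> d (y * s) y)\<^sup>2 = y powr (2 * (- d - \<alpha>)) * (s powr (2 * (- d / 2)) * (1 - s) powr (2 * (- \<alpha>)))"
      by (simp only: mult_1_right power_mult_distrib sq)
    hence "(wkernel \<alpha> d (y * s) y)\<^sup>2 = y powr (- 2 * d - 2 * \<alpha>) * (s powr (- d) * (1 - s) powr (- 2 * \<alpha>))"
      by (simp add: algebra_simps)
    moreover have "y powr ((2 - 2 * d - 2 * \<alpha>) - 1) = y * y powr (- 2 * d - 2 * \<alpha>)"
      using sy powr_add[of y 1 "- 2 * d - 2 * \<alpha>"] by (simp add: algebra_simps)
    ultimately show "ennreal y * f (y * s) y = ennreal (y powr ((2 - 2 * d - 2 * \<alpha>) - 1))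
      * ennreal (s powr ((1 - d) - 1) * (1 - s) powr ((1 - 2 * \<alpha>) - 1))"
      using sy by (simp add: f_def ennreal_mult'[symmetric] mult_ac)
  qed
  also have "\<dots> = ennreal (1 / (2 - 2 * d - 2 * \<alpha>)) * ennreal (Beta (1 - d) (1 - 2 * \<alpha>))"
    using \<alpha> d nn_integral_powr_I01[of "2 - 2 * d - 2 * \<alpha>"] nn_integral_Beta[of "1 - d" "1 - 2 * \<alpha>"]
    by (simp add: nn_integral_cmult nn_integral_multc)
  finally have "(\<integral>\<^sup>+p. f (fst p) (snd p) \<partial>I01x2) < \<infinity>"
    by (simp add: ennreal_mult_less_top)
  thus ?thesis
    unfolding L2_iff_nn_integral f_def split_beta by simp
qed

text \<open>Homogeneity of the integrand splits off a power of the largest variable \<open>z\<close>; the double integral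
  that remains is symmetric, hence twice the Selberg integral over a triangle.\<close>
lemma nn_integral_cycle_kernel_max:
  "(\<integral>\<^sup>+z. \<integral>\<^sup>+y. \<integral>\<^sup>+x. ennreal (cycle_kernel \<alpha> d x y z) * indicator {..<z} x * indicator {..<z} y \<partial>I01 \<partial>I01 \<partial>I01)
    = ennreal (2 * selberg_int \<alpha> (1 - d) / (3 * (1 - d - \<alpha>)))"
proof -
  define W where "W = (\<integral>\<^sup>+t. \<integral>\<^sup>+s. ennreal (cycle_kernel \<alpha> d s t 1) \<partial>I01 \<partial>I01)"
  have W: "W = ennreal (2 * selberg_int \<alpha> (1 - d))"
  proof -
    have "W = 2 * (\<integral>\<^sup>+t. \<integral>\<^sup>+s. ennreal (cycle_kernel \<alpha> d s t 1) * indicator {..<t} s \<partial>I01 \<partial>I01)"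
      unfolding W_def by (rule nn_integral_I01_sym) (measurable, simp add: cycle_kernel_sym(1))
    also have "(\<integral>\<^sup>+t. \<integral>\<^sup>+s. ennreal (cycle_kernel \<alpha> d s t 1) * indicator {..<t} s \<partial>I01 \<partial>I01)
        = (\<integral>\<^sup>+t. \<integral>\<^sup>+u. ennreal t * ennreal (cycle_kernel \<alpha> d (t * u) t 1) \<partial>I01 \<partial>I01)"
      by (intro nn_integral_cong nn_integral_I01_scale) auto
    also have "\<dots> = (\<integral>\<^sup>+t. \<integral>\<^sup>+u. ennreal (selberg_fn \<alpha> (1 - d) (u, t)) \<partial>I01 \<partial>I01)"
    proof (intro nn_integral_cong)
      fix t u assume "t \<in> space I01" "u \<in> space I01"
      hence tu: "0 < t" "t < 1" "0 < u" "u < 1" by auto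
      have tu1: "t * u < 1" using tu mult_strict_mono[of t 1 u 1] by simp
      have "wkernel \<alpha> d (t * u) (t * 1) = t powr (- d - \<alpha>) * wkernel \<alpha> d u 1"
        using tu by (intro wkernel_scale) auto
      moreover have "wkernel \<alpha> d u 1 = u powr (- d / 2) * (1 - u) powr (- \<alpha>)"
        "wkernel \<alpha> d t 1 = t powr (- d / 2) * (1 - t) powr (- \<alpha>)"
        "wkernel \<alpha> d (t * u) 1 = t powr (- d / 2) * u powr (- d / 2) * (1 - t * u) powr (- \<alpha>)"
        using tu tu1 by (simp_all add: wkernel_def powr_mult)
      ultimately have "cycle_kernel \<alpha> d (t * u) t 1 = (t powr (- d - \<alpha>) * t powr (- d / 2) * t powr (- d / 2))
          * (u powr (- d / 2) * u powr (- d / 2)) * ((1 - u) powr (- \<alpha>) * (1 - t) powr (- \<alpha>) * (1 - t * u) powr (- \<alpha>))"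
        by (simp add: cycle_kernel_def mult_ac)
      also have "u powr (- d / 2) * u powr (- d / 2) = u powr (1 - d - 1)" by (simp add: powr_add[symmetric])
      also have "(1 - u) powr (- \<alpha>) * (1 - t) powr (- \<alpha>) * (1 - t * u) powr (- \<alpha>)
          = ((1 - u) * (1 - t) * (1 - u * t)) powr (- \<alpha>)"
        using tu tu1 by (simp add: powr_mult mult.commute[of t u])
      finally have "t * cycle_kernel \<alpha> d (t * u) t 1 = (t * (t powr (- d - \<alpha>) * t powr (- d / 2) * t powr (- d / 2)))
          * u powr (1 - d - 1) * ((1 - u) * (1 - t) * (1 - u * t)) powr (- \<alpha>)" by simp
      also have "t * (t powr (- d - \<alpha>) * t powr (- d / 2) * t powr (- d / 2)) = t powr (2 * (1 - d) - 1 - \<alpha>)"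
        using tu powr_add[of t 1 "- d - \<alpha> + - d / 2 + - d / 2"] by (simp add: powr_add[symmetric] algebra_simps)
      finally show "ennreal t * ennreal (cycle_kernel \<alpha> d (t * u) t 1) = ennreal (selberg_fn \<alpha> (1 - d) (u, t))"
        using tu by (simp add: selberg_fn_def ennreal_mult'[symmetric] mult_ac)
    qed
    also have "\<dots> = ennreal (selberg_int \<alpha> (1 - d))" using d \<alpha> by (intro nn_integral_selberg_fn \<alpha>) auto
    finally show ?thesis by (simp add: ennreal_mult')
  qed
  have "(\<integral>\<^sup>+z. \<integral>\<^sup>+y. \<integral>\<^sup>+x. ennreal (cycle_kernel \<alpha> d x y z) * indicator {..<z} x * indicator {..<z} y \<partial>I01 \<partial>I01 \<partial>I01)
      = (\<integral>\<^sup>+z. ennreal (z powr ((3 * (1 - d - \<alpha>)) - 1)) * W \<partial>I01)"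
  proof (intro nn_integral_cong)
    fix z assume "z \<in> space I01"
    hence z: "0 < z" "z < 1" by auto
    have "(\<integral>\<^sup>+y. \<integral>\<^sup>+x. ennreal (cycle_kernel \<alpha> d x y z) * indicator {..<z} x * indicator {..<z} y \<partial>I01 \<partial>I01)
        = (\<integral>\<^sup>+y. (\<integral>\<^sup>+x. ennreal (cycle_kernel \<alpha> d x y z) * indicator {..<z} x \<partial>I01) * indicator {..<z} y \<partial>I01)"
      by (intro nn_integral_cong nn_integral_multc) measurable
    also have "\<dots> = (\<integral>\<^sup>+y. (\<integral>\<^sup>+s. ennreal z * ennreal (cycle_kernel \<alpha> d (z * s) y z) \<partial>I01) * indicator {..<z} y \<partial>I01)"
      using z by (intro nn_integral_cong arg_cong2[where f = "(*)"] nn_integral_I01_scale refl) auto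
    also have "\<dots> = (\<integral>\<^sup>+t. ennreal z * (\<integral>\<^sup>+s. ennreal z * ennreal (cycle_kernel \<alpha> d (z * s) (z * t) z) \<partial>I01) \<partial>I01)"
    proof (rule nn_integral_I01_scale[OF _ z])
      show "(\<lambda>y. \<integral>\<^sup>+s. ennreal z * ennreal (cycle_kernel \<alpha> d (z * s) y z) \<partial>I01) \<in> borel_measurable borel"
        by (rule I01.borel_measurable_nn_integral) (simp add: split_beta')
    qed
    also have "\<dots> = (\<integral>\<^sup>+t. \<integral>\<^sup>+s. ennreal (z powr ((3 * (1 - d - \<alpha>)) - 1)) * ennreal (cycle_kernel \<alpha> d s t 1) \<partial>I01 \<partial>I01)"
    proof (intro nn_integral_cong)
      fix t assume "t \<in> space I01"
      hence t: "0 < t" "t < 1" by auto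
      have "ennreal z * (\<integral>\<^sup>+s. ennreal z * ennreal (cycle_kernel \<alpha> d (z * s) (z * t) z) \<partial>I01)
          = (\<integral>\<^sup>+s. ennreal z * (ennreal z * ennreal (cycle_kernel \<alpha> d (z * s) (z * t) z)) \<partial>I01)"
        by (rule nn_integral_cmult[symmetric]) measurable
      also have "\<dots> = (\<integral>\<^sup>+s. ennreal (z powr ((3 * (1 - d - \<alpha>)) - 1)) * ennreal (cycle_kernel \<alpha> d s t 1) \<partial>I01)"
      proof (intro nn_integral_cong)
        fix s assume "s \<in> space I01"
        hence s: "0 < s" "s < 1" by auto
        have 1: "cycle_kernel \<alpha> d (z * s) (z * t) (z * 1) = (z powr (- d - \<alpha>)) ^ 3 * cycle_kernel \<alpha> d s t 1"
          unfolding cycle_kernel_def using z s t by (subst (1 2 3) wkernel_scale) (auto simp: power3_eq_cube)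
        have 2: "z * (z * (z powr (- d - \<alpha>)) ^ 3) = z powr ((3 * (1 - d - \<alpha>)) - 1)"
        proof -
          have "z * (z * (z powr (- d - \<alpha>)) ^ 3) = z powr 1 * (z powr 1 * (z powr (- d - \<alpha>) * z powr (- d - \<alpha>) * z powr (- d - \<alpha>)))"
            using z by (simp add: power3_eq_cube)
          thus ?thesis unfolding powr_add[symmetric] by (simp add: algebra_simps)
        qed
        have "z * (z * cycle_kernel \<alpha> d (z * s) (z * t) z) = (z * (z * (z powr (- d - \<alpha>)) ^ 3)) * cycle_kernel \<alpha> d s t 1"
          using 1 by simp
        thus "ennreal z * (ennreal z * ennreal (cycle_kernel \<alpha> d (z * s) (z * t) z))
          = ennreal (z powr ((3 * (1 - d - \<alpha>)) - 1)) * ennreal (cycle_kernel \<alpha> d s t 1)"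
          using z unfolding 2 by (simp add: ennreal_mult'[symmetric] mult.assoc cycle_kernel_nonneg)
      qed
      finally show "ennreal z * (\<integral>\<^sup>+s. ennreal z * ennreal (cycle_kernel \<alpha> d (z * s) (z * t) z) \<partial>I01)
          = (\<integral>\<^sup>+s. ennreal (z powr ((3 * (1 - d - \<alpha>)) - 1)) * ennreal (cycle_kernel \<alpha> d s t 1) \<partial>I01)" .
    qed
    also have "\<dots> = ennreal (z powr ((3 * (1 - d - \<alpha>)) - 1)) * W"
      unfolding W_def by (simp add: nn_integral_cmult)
    finally show "(\<integral>\<^sup>+y. \<integral>\<^sup>+x. ennreal (cycle_kernel \<alpha> d x y z) * indicator {..<z} x * indicator {..<z} y \<partial>I01 \<partial>I01)
        = ennreal (z powr ((3 * (1 - d - \<alpha>)) - 1)) * W" .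
  qed
  also have "\<dots> = ennreal (1 / (3 * (1 - d - \<alpha>))) * W"
    using d \<alpha> nn_integral_powr_I01[of "3 * (1 - d - \<alpha>)"] by (simp add: nn_integral_multc)
  also have "\<dots> = ennreal (2 * selberg_int \<alpha> (1 - d) / (3 * (1 - d - \<alpha>)))"
    unfolding W using d \<alpha> by (subst ennreal_mult'[symmetric]) auto
  finally show ?thesis .
qed

text \<open>For almost all triples exactly one variable is the largest, and by symmetry the three cases
  contribute equally.\<close>
lemma nn_integral_cycle_kernel:
  "(\<integral>\<^sup>+x. \<integral>\<^sup>+y. \<integral>\<^sup>+z. ennreal (cycle_kernel \<alpha> d x y z) \<partial>I01 \<partial>I01 \<partial>I01)
    = ennreal (2 * selberg_int \<alpha> (1 - d) / (1 - d - \<alpha>))"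
proof -
  \<comment> \<open>the part of the integrand where the third variable is the largest\<close>
  define m where "m x y z = ennreal (cycle_kernel \<alpha> d x y z) * indicator {..<z} x * indicator {..<z} y" for x y z
  have [measurable]: "(\<lambda>p. m (f p) (g p) (h p)) \<in> borel_measurable M"
    if [measurable]: "f \<in> borel_measurable M" "g \<in> borel_measurable M" "h \<in> borel_measurable M" for f g h and M :: "'b measure"
    unfolding m_def by measurable
  have m_sym: "m x y z = m y x z" for x y z
    by (simp add: m_def mult_ac cycle_kernel_sym(1))
  have sw: "(\<integral>\<^sup>+x. \<integral>\<^sup>+y. \<integral>\<^sup>+z. h x y z \<partial>I01 \<partial>I01 \<partial>I01) = (\<integral>\<^sup>+y. \<integral>\<^sup>+x. \<integral>\<^sup>+z. h x y z \<partial>I01 \<partial>I01 \<partial>I01)"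
    if "(\<lambda>p. h (fst (fst p)) (snd (fst p)) (snd p)) \<in> borel_measurable (I01x2 \<Otimes>\<^sub>M I01)"
    for h :: "real \<Rightarrow> real \<Rightarrow> real \<Rightarrow> ennreal"
  proof (rule I01x2.Fubini'[symmetric])
    show "(\<lambda>(x, y). \<integral>\<^sup>+z. h x y z \<partial>I01) \<in> borel_measurable I01x2"
      unfolding split_beta' by (rule I01.borel_measurable_nn_integral) (use that in \<open>simp only: split_beta'\<close>)
  qed
  have triple: "(\<integral>\<^sup>+x. \<integral>\<^sup>+y. \<integral>\<^sup>+z. h x y z \<partial>I01 \<partial>I01 \<partial>I01)
      = (\<integral>\<^sup>+q. h (fst (fst q)) (snd (fst q)) (snd q) \<partial>(I01x2 \<Otimes>\<^sub>M I01))"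
    if h: "(\<lambda>p. h (fst (fst p)) (snd (fst p)) (snd p)) \<in> borel_measurable (I01x2 \<Otimes>\<^sub>M I01)"
    for h :: "real \<Rightarrow> real \<Rightarrow> real \<Rightarrow> ennreal"
  proof -
    have "(\<lambda>p. \<integral>\<^sup>+z. h (fst p) (snd p) z \<partial>I01) \<in> borel_measurable I01x2"
      by (rule I01.borel_measurable_nn_integral) (use h in \<open>simp only: split_beta'\<close>)
    from I01.nn_integral_fst[OF this] I01.nn_integral_fst[OF h] show ?thesis by simp
  qed
  have add3: "(\<integral>\<^sup>+x. \<integral>\<^sup>+y. \<integral>\<^sup>+z. h x y z + k x y z \<partial>I01 \<partial>I01 \<partial>I01)
      = (\<integral>\<^sup>+x. \<integral>\<^sup>+y. \<integral>\<^sup>+z. h x y z \<partial>I01 \<partial>I01 \<partial>I01) + (\<integral>\<^sup>+x. \<integral>\<^sup>+y. \<integral>\<^sup>+z. k x y z \<partial>I01 \<partial>I01 \<partial>I01)"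
    if hk: "(\<lambda>p. h (fst (fst p)) (snd (fst p)) (snd p)) \<in> borel_measurable (I01x2 \<Otimes>\<^sub>M I01)"
      "(\<lambda>p. k (fst (fst p)) (snd (fst p)) (snd p)) \<in> borel_measurable (I01x2 \<Otimes>\<^sub>M I01)"
    for h k :: "real \<Rightarrow> real \<Rightarrow> real \<Rightarrow> ennreal"
    unfolding triple[OF hk(1)] triple[OF hk(2)] triple[OF borel_measurable_add[OF hk]]
    by (rule nn_integral_add[OF hk])
  define S where "S = (\<integral>\<^sup>+z. \<integral>\<^sup>+y. \<integral>\<^sup>+x. m x y z \<partial>I01 \<partial>I01 \<partial>I01)"
  have inner_sw: "(\<integral>\<^sup>+y. \<integral>\<^sup>+z. h y z \<partial>I01 \<partial>I01) = (\<integral>\<^sup>+z. \<integral>\<^sup>+y. h y z \<partial>I01 \<partial>I01)"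
    if "(\<lambda>p. h (fst p) (snd p)) \<in> borel_measurable I01x2" for h :: "real \<Rightarrow> real \<Rightarrow> ennreal"
    by (rule I01x2.Fubini'[symmetric]) (use that in \<open>simp only: split_beta'\<close>)
  have S1: "(\<integral>\<^sup>+x. \<integral>\<^sup>+y. \<integral>\<^sup>+z. m y z x \<partial>I01 \<partial>I01 \<partial>I01) = S"
    unfolding S_def by (simp add: m_sym)
  have S2: "(\<integral>\<^sup>+x. \<integral>\<^sup>+y. \<integral>\<^sup>+z. m x z y \<partial>I01 \<partial>I01 \<partial>I01) = S"
  proof -
    have "(\<integral>\<^sup>+x. \<integral>\<^sup>+y. \<integral>\<^sup>+z. m x z y \<partial>I01 \<partial>I01 \<partial>I01) = (\<integral>\<^sup>+y. \<integral>\<^sup>+x. \<integral>\<^sup>+z. m x z y \<partial>I01 \<partial>I01 \<partial>I01)"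
      by (rule sw) measurable
    thus ?thesis by (simp add: S_def m_sym)
  qed
  have S3: "(\<integral>\<^sup>+x. \<integral>\<^sup>+y. \<integral>\<^sup>+z. m x y z \<partial>I01 \<partial>I01 \<partial>I01) = S"
  proof -
    have "(\<integral>\<^sup>+x. \<integral>\<^sup>+y. \<integral>\<^sup>+z. m x y z \<partial>I01 \<partial>I01 \<partial>I01) = (\<integral>\<^sup>+x. \<integral>\<^sup>+z. \<integral>\<^sup>+y. m x y z \<partial>I01 \<partial>I01 \<partial>I01)"
      by (intro nn_integral_cong inner_sw) measurable
    also have "\<dots> = (\<integral>\<^sup>+z. \<integral>\<^sup>+x. \<integral>\<^sup>+y. m x y z \<partial>I01 \<partial>I01 \<partial>I01)"
      by (rule sw) measurable
    finally show ?thesis by (simp add: S_def m_sym)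
  qed
  have "(\<integral>\<^sup>+x. \<integral>\<^sup>+y. \<integral>\<^sup>+z. ennreal (cycle_kernel \<alpha> d x y z) \<partial>I01 \<partial>I01 \<partial>I01)
      = (\<integral>\<^sup>+x. \<integral>\<^sup>+y. \<integral>\<^sup>+z. m y z x + (m x z y + m x y z) \<partial>I01 \<partial>I01 \<partial>I01)"
  proof (rule nn_integral_cong)
    fix x assume x: "x \<in> space I01"
    show "(\<integral>\<^sup>+y. \<integral>\<^sup>+z. ennreal (cycle_kernel \<alpha> d x y z) \<partial>I01 \<partial>I01) = (\<integral>\<^sup>+y. \<integral>\<^sup>+z. m y z x + (m x z y + m x y z) \<partial>I01 \<partial>I01)"
    proof (rule nn_integral_cong_AE, rule eventually_mono[OF AE_I01_neq[of x]])
      fix y assume "y \<noteq> x"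
      show "(\<integral>\<^sup>+z. ennreal (cycle_kernel \<alpha> d x y z) \<partial>I01) = (\<integral>\<^sup>+z. m y z x + (m x z y + m x y z) \<partial>I01)"
      proof (rule nn_integral_cong_AE, use AE_I01_neq[of x] AE_I01_neq[of y] in eventually_elim)
        fix z assume "z \<noteq> x" "z \<noteq> y"
        moreover have "cycle_kernel \<alpha> d y z x = cycle_kernel \<alpha> d x y z" "cycle_kernel \<alpha> d x z y = cycle_kernel \<alpha> d x y z"
          using cycle_kernel_sym(2)[of \<alpha> d y z x] cycle_kernel_sym(1)[of \<alpha> d y x z] cycle_kernel_sym(2)[of \<alpha> d x z y] by simp_all
        ultimately show "ennreal (cycle_kernel \<alpha> d x y z) = m y z x + (m x z y + m x y z)"
          using \<open>y \<noteq> x\<close> by (auto simp: m_def indicator_def)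
      qed
    qed
  qed
  also have "\<dots> = (\<integral>\<^sup>+x. \<integral>\<^sup>+y. \<integral>\<^sup>+z. m y z x \<partial>I01 \<partial>I01 \<partial>I01) + ((\<integral>\<^sup>+x. \<integral>\<^sup>+y. \<integral>\<^sup>+z. m x z y \<partial>I01 \<partial>I01 \<partial>I01)
        + (\<integral>\<^sup>+x. \<integral>\<^sup>+y. \<integral>\<^sup>+z. m x y z \<partial>I01 \<partial>I01 \<partial>I01))"
    by (subst add3, (measurable)[2], subst add3, (measurable)[2], rule refl)
  also have "\<dots> = S + (S + S)" unfolding S1 S2 S3 ..
  also have "\<dots> = (1 + (1 + 1)) * S" by (simp only: distrib_right mult_1)
  also have "\<dots> = 3 * S" by simp
  also have "S = ennreal (2 * selberg_int \<alpha> (1 - d) / (3 * (1 - d - \<alpha>)))"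
    unfolding S_def m_def by (rule nn_integral_cycle_kernel_max)
  also have "3 * \<dots> = ennreal (2 * selberg_int \<alpha> (1 - d) / (1 - d - \<alpha>))"
  proof -
    have "3 * (u / (3 * v)) = u / v" for u v :: real by simp
    moreover have "3 * ennreal u = ennreal (3 * u)" for u by (simp add: ennreal_mult')
    ultimately show ?thesis by (simp only:)
  qed
  finally show ?thesis .
qed

lemma trace_integral:
  "(LINT p|I01x2. kcomp I01 (\<lambda>(x, y). wkernel \<alpha> d x y) (\<lambda>(x, y). wkernel \<alpha> d x y) p * (case p of (x, y) \<Rightarrow> wkernel \<alpha> d x y))
    = 2 * selberg_int \<alpha> (1 - d) / (1 - d - \<alpha>)"
proof -
  let ?K = "\<lambda>(x, y). wkernel \<alpha> d x y"
  have int: "integrable I01x2 (\<lambda>p. kcomp I01 ?K ?K p * ?K p)"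
    by (rule L2_integrable_mult[OF I01.L2_kcomp[OF L2_wkernel L2_wkernel] L2_wkernel])
  have kc0: "kcomp I01 ?K ?K p \<ge> 0" for p
    by (cases p) (auto simp: kcomp_def wkernel_nonneg intro!: integral_nonneg_AE)
  have "ennreal (LINT p|I01x2. kcomp I01 ?K ?K p * ?K p) = (\<integral>\<^sup>+p. ennreal (kcomp I01 ?K ?K p * ?K p) \<partial>I01x2)"
    by (rule nn_integral_eq_integral[symmetric, OF int]) (auto simp: kc0 wkernel_nonneg)
  also have "\<dots> = (\<integral>\<^sup>+p. (\<integral>\<^sup>+z. ennreal (cycle_kernel \<alpha> d (fst p) z (snd p)) \<partial>I01) \<partial>I01x2)"
  proof (rule nn_integral_cong_AE, use I01.L2_sections_pair[OF L2_wkernel L2_wkernel] in eventually_elim)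
    fix p assume p: "L2 I01 (\<lambda>z. ?K (fst p, z)) \<and> L2 I01 (\<lambda>z. ?K (z, snd p))"
    obtain x y where xy: "p = (x, y)" by (cases p)
    have "integrable I01 (\<lambda>z. wkernel \<alpha> d x z * wkernel \<alpha> d z y)"
      using p L2_integrable_mult[of I01 "\<lambda>z. wkernel \<alpha> d x z" "\<lambda>z. wkernel \<alpha> d z y"] by (simp add: xy)
    hence "integrable I01 (\<lambda>z. wkernel \<alpha> d x z * wkernel \<alpha> d z y * wkernel \<alpha> d x y)" by simp
    from nn_integral_eq_integral[OF this]
    have "(\<integral>\<^sup>+z. ennreal (cycle_kernel \<alpha> d x z y) \<partial>I01) = ennreal (LINT z|I01. wkernel \<alpha> d x z * wkernel \<alpha> d z y * wkernel \<alpha> d x y)"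
      by (simp add: cycle_kernel_def wkernel_nonneg)
    thus "ennreal (kcomp I01 ?K ?K p * ?K p) = (\<integral>\<^sup>+z. ennreal (cycle_kernel \<alpha> d (fst p) z (snd p)) \<partial>I01)"
      by (simp add: xy kcomp_def)
  qed
  also have "\<dots> = (\<integral>\<^sup>+x. \<integral>\<^sup>+y. \<integral>\<^sup>+z. ennreal (cycle_kernel \<alpha> d x y z) \<partial>I01 \<partial>I01 \<partial>I01)"
    by (subst I01.nn_integral_fst[symmetric]) (auto simp: cycle_kernel_sym(2) split_beta')
  also have "\<dots> = ennreal (2 * selberg_int \<alpha> (1 - d) / (1 - d - \<alpha>))" by (rule nn_integral_cycle_kernel)
  finally show ?thesis
    using d \<alpha> selberg_int_nonneg[of \<alpha> "1 - d"]
    by (subst (asm) ennreal_inj) (auto intro!: integral_nonneg_AE mult_nonneg_nonneg simp: kc0 wkernel_nonneg)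
qed

end

section \<open>The trace formula and the skewness\<close>

lemma Selberg_product_eq:
  fixes \<alpha> d a c :: real
  assumes \<alpha>: "0 < \<alpha>" "\<alpha> < 1 / 2" and d: "2 * d + 2 * \<alpha> < 1" and a: "a = 1 - d" and c: "c = - \<alpha> / 2"
  shows "(\<Prod>j=0..2::nat.
              (Gamma (a + real j * c) * Gamma (1 + real j * c) * Gamma (1 + (real j + 1) * c)) /
              (Gamma (a + 1 + (2 + real j) * c) * Gamma (1 + c)))
    = 2 * selberg_int \<alpha> (1 - d) / (1 - d - \<alpha>)"
proof -
  have three: "(\<Prod>j=0..2::nat. h j) = h 0 * h 1 * h 2" for h :: "nat \<Rightarrow> real"
    by (simp add: numeral_2_eq_2)
  have pos: "Gamma (1 - \<alpha> / 2) > 0" "Gamma (a - \<alpha>) > 0" "Gamma (a + 1 - 3 * \<alpha> / 2) > 0" "Gamma (a + 1 - 2 * \<alpha>) > 0"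
    using \<alpha> d a by auto
  have "a - \<alpha> \<notin> \<int>\<^sub>\<le>\<^sub>0" using \<alpha> d a by (auto simp: nonpos_Ints_def)
  hence G: "Gamma (a + 1 - \<alpha>) = (a - \<alpha>) * Gamma (a - \<alpha>)"
    using Gamma_plus1[of "a - \<alpha>"] by (simp add: algebra_simps)
  have F: "selberg_int \<alpha> (1 - d) = (Gamma (1 - \<alpha>))\<^sup>2 * Gamma (1 - 3 * \<alpha> / 2) * Gamma a * Gamma (a - \<alpha> / 2)
    / (2 * Gamma (1 - \<alpha> / 2) * Gamma (a + 1 - 3 * \<alpha> / 2) * Gamma (a + 1 - 2 * \<alpha>))"
    unfolding a using \<alpha> d by (intro selberg_int_Gamma) auto
  have e: "a + real 0 * c = a" "1 + real 0 * c = 1" "1 + (real 0 + 1) * c = 1 - \<alpha> / 2" "a + 1 + (2 + real 0) * c = a + 1 - \<alpha>"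
    "a + real 1 * c = a - \<alpha> / 2" "1 + real 1 * c = 1 - \<alpha> / 2" "1 + (real 1 + 1) * c = 1 - \<alpha>" "a + 1 + (2 + real 1) * c = a + 1 - 3 * \<alpha> / 2"
    "a + real 2 * c = a - \<alpha>" "1 + real 2 * c = 1 - \<alpha>" "1 + (real 2 + 1) * c = 1 - 3 * \<alpha> / 2" "a + 1 + (2 + real 2) * c = a + 1 - 2 * \<alpha>"
    "1 + c = 1 - \<alpha> / 2"
    by (simp_all add: c)
  have ad: "a - \<alpha> > 0" "1 - d - \<alpha> = a - \<alpha>" using \<alpha> d a by auto
  have alg: "(g0 * 1 * h1) / ((a - \<alpha>) * k0 * h1) * ((g1 * h1 * h2) / (k1 * h1)) * ((k0 * h2 * h3) / (k2 * h1))
      = 2 * (h2\<^sup>2 * h3 * g0 * g1 / (2 * h1 * k1 * k2)) / (a - \<alpha>)"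
    if "h1 > 0" "k0 > 0" "k1 > 0" "k2 > 0" for g0 g1 h1 h2 h3 k0 k1 k2 :: real
    using that ad(1) by (simp add: field_simps power2_eq_square)
  show ?thesis
    unfolding three F e G ad(2) Gamma_1 by (rule alg[OF pos])
qed

lemma selberg_int_at_1:
  fixes \<alpha> :: real
  assumes \<alpha>: "0 < \<alpha>" "\<alpha> < 1 / 2"
  shows "2 * selberg_int \<alpha> (1 - 0) / (1 - 0 - \<alpha>) = 6 * Beta (1 - \<alpha>) (1 - \<alpha>) / ((2 - 3 * \<alpha>) * (3 - 3 * \<alpha>))"
proof -
  have "3 - 3 * \<alpha> = 3 * (1 - \<alpha>)" by simp
  moreover have "2 * (b / u) / v = 6 * b / (u * (3 * v))" for b u v :: real by simp
  ultimately show ?thesis unfolding diff_zero selberg_int_1[OF \<alpha>] by (simp only:)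
qed

lemma trace_cube_T_op:
  fixes \<alpha> d :: real
  assumes \<alpha>: "0 < \<alpha>" "\<alpha> < 1 / 2" and d: "2 * d + 2 * \<alpha> < 1"
    and ev: "eigenvalue_sequence (T_op \<alpha> d) \<mu>"
  shows "summable (\<lambda>j. (\<mu> j)\<^sup>2)" and "(\<lambda>j. \<mu> j ^ 3) sums (2 * selberg_int \<alpha> (1 - d) / (1 - d - \<alpha>))"
proof -
  have K: "L2 I01x2 (\<lambda>(x, y). wkernel \<alpha> d x y)" by (rule L2_wkernel[OF \<alpha> d])
  have sym: "(case (x, y) of (x, y) \<Rightarrow> wkernel \<alpha> d x y) = (case (y, x) of (x, y) \<Rightarrow> wkernel \<alpha> d x y)" for x y
    using wkernel_sym by simp
  note tr = trace_cube_kernel[OF K sym ev[unfolded T_op_eq_kernel_op]]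
  show "summable (\<lambda>j. (\<mu> j)\<^sup>2)" by (rule tr(1))
  show "(\<lambda>j. \<mu> j ^ 3) sums (2 * selberg_int \<alpha> (1 - d) / (1 - d - \<alpha>))"
    using tr(2) unfolding trace_integral[OF \<alpha> d] .
qed

theorem proposition4p1:
  fixes \<alpha> d a c :: real and \<mu> :: "nat \<Rightarrow> real"
  assumes "0 < \<alpha>" and "\<alpha> < 1 / 2" and "2 * d + 2 * \<alpha> < 1"
    and "a = 1 - d" and "c = - \<alpha> / 2"
    and "eigenvalue_sequence (T_op \<alpha> d) \<mu>"
  shows "((\<lambda>j. \<mu> j ^ 3) sums
           (\<Prod>j=0..2::nat.
              (Gamma (a + real j * c) * Gamma (1 + real j * c) * Gamma (1 + (real j + 1) * c)) /
              (Gamma (a + 1 + (2 + real j) * c) * Gamma (1 + c)))) \<and>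
         (\<forall>(M :: 'w measure) Z (N :: 'v measure) Y.
            iid_std_normal M Z \<longrightarrow> has_weighted_limit_law \<alpha> d \<mu> M Z N Y \<longrightarrow>
            cumulant N 3 Y = 8 * (\<Sum>j. \<mu> j ^ 3) / (2 * I2 \<alpha> d) powr (3 / 2)) \<and>
         ((\<Prod>j=0..2::nat.
              (Gamma (1 + real j * c) * Gamma (1 + real j * c) * Gamma (1 + (real j + 1) * c)) /
              (Gamma (1 + 1 + (2 + real j) * c) * Gamma (1 + c))) =
            6 * Beta (1 - \<alpha>) (1 - \<alpha>) / ((2 - 3 * \<alpha>) * (3 - 3 * \<alpha>))) \<and>
         (\<forall>\<nu>. eigenvalue_sequence (K_op \<alpha>) \<nu> \<longrightarrow>
            (\<lambda>j. \<nu> j ^ 3) sums (6 * Beta (1 - \<alpha>) (1 - \<alpha>) / ((2 - 3 * \<alpha>) * (3 - 3 * \<alpha>))))"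
proof (intro conjI allI impI)
  note \<alpha> = assms(1,2) and d = assms(3) and a = assms(4) and c = assms(5) and ev = assms(6)
  have d0: "2 * 0 + 2 * \<alpha> < 1" using \<alpha> by simp
  note tr = trace_cube_T_op[OF \<alpha> d ev]
  show "(\<lambda>j. \<mu> j ^ 3) sums
           (\<Prod>j=0..2::nat.
              (Gamma (a + real j * c) * Gamma (1 + real j * c) * Gamma (1 + (real j + 1) * c)) /
              (Gamma (a + 1 + (2 + real j) * c) * Gamma (1 + c)))"
    unfolding Selberg_product_eq[OF \<alpha> d a c] by (rule tr(2))
  show "(\<Prod>j=0..2::nat.
              (Gamma (1 + real j * c) * Gamma (1 + real j * c) * Gamma (1 + (real j + 1) * c)) /
              (Gamma (1 + 1 + (2 + real j) * c) * Gamma (1 + c))) =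
            6 * Beta (1 - \<alpha>) (1 - \<alpha>) / ((2 - 3 * \<alpha>) * (3 - 3 * \<alpha>))"
    unfolding selberg_int_at_1[OF \<alpha>, symmetric] by (rule Selberg_product_eq[OF \<alpha> d0 _ c]) simp
  show "(\<lambda>j. \<nu> j ^ 3) sums (6 * Beta (1 - \<alpha>) (1 - \<alpha>) / ((2 - 3 * \<alpha>) * (3 - 3 * \<alpha>)))"
    if "eigenvalue_sequence (K_op \<alpha>) \<nu>" for \<nu>
    unfolding selberg_int_at_1[OF \<alpha>, symmetric] by (rule trace_cube_T_op(2)[OF \<alpha> d0 that[unfolded K_op_def]])
  fix M :: "'w measure" and Z and N :: "'v measure" and Y
  assume Z: "iid_std_normal M Z" and law: "has_weighted_limit_law \<alpha> d \<mu> M Z N Y"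
  define s where "s = 2 * I2 \<alpha> d"
  have s0: "s \<ge> 0" unfolding s_def I2_def by (intro mult_nonneg_nonneg integral_nonneg_AE AE_I2) auto
  have "cumulant N 3 Y = (\<Sum>j. 8 * (\<mu> j / sqrt s) ^ 3)"
  proof (rule third_cumulant_chaos[OF Z])
    show "summable (\<lambda>j. (\<mu> j / sqrt s)\<^sup>2)" unfolding power_divide by (intro summable_divide tr(1))
  qed (use law in \<open>auto simp: has_weighted_limit_law_def s_def\<close>)
  also have "\<dots> = (\<Sum>j. 8 / (sqrt s) ^ 3 * \<mu> j ^ 3)" by (simp add: power_divide)
  also have "\<dots> = 8 / (sqrt s) ^ 3 * (\<Sum>j. \<mu> j ^ 3)" by (rule suminf_mult) (use tr(2) in \<open>auto simp: sums_iff\<close>)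
  also have "(sqrt s) ^ 3 = s powr (3 / 2)"
  \<comment> \<open>both sides vanish at \<open>s = 0\<close> since \<open>0 powr _ = 0\<close>\<close>
  proof (cases "s = 0")
    case False
    hence "s > 0" using s0 by simp
    hence "s powr (3 / 2) = (s powr (1 / 2)) powr 3" by (simp add: powr_powr)
    thus ?thesis using \<open>s > 0\<close> by (simp add: powr_half_sqrt)
  qed simp
  finally show "cumulant N 3 Y = 8 * (\<Sum>j. \<mu> j ^ 3) / (2 * I2 \<alpha> d) powr (3 / 2)" by (simp add: s_def)
qed

end
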